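(* Let $\alpha\in\mathbb{R}$. Let $\mu$ be a Borel measure on $\mathbb{R}$ which is supported on at least two distinct points and satisfies $\int_{\mathbb{R}}(1+|t|)^{-1}\,d\mu(t)<\infty$, and let $\nu$ be a Borel measure on $\mathbb{R}$. Let $V$ be defined on compactly supported $C^1$ functions $f$ by $$Vf(s)=f(s)-\alpha\int_{\mathbb{R}}\frac{f(s)-f(t)}{s-t}\,d\mu(t).$$ Assume that $V$ extends to a bounded operator from $L^2(\mu)$ to $L^2(\nu)$ and that (for this extension) $\operatorname{Ker}V=\{0\}$. Then there exists a function $h$ such that $1/h\in L^\infty(\nu)$ and $M_hV$ is a unitary operator from $L^2(\mu)$ to $L^2(\nu)$ (equivalently, $V:L^2(d\mu)\to L^2(|h|^2\,d\nu)$ is unitary). Moreover, the unitary operator $U:=M_hV$ gives the spectral representation of the operator $A_\alpha:=M_t+\alpha(\,\cdot\,,\varphi)\varphi$, $\varphi\equiv\mathbf 1$, in $L^2(\mu)$, namely $UA_\alpha=M_sU$, where $M_s$ is multiplication by the independent variable $s$ in $L^2(\nu)$.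
   Context: $M_h$ denotes the operator of multiplication by $h$; $M_t$ is multiplication by the independent variable in $L^2(\mu)$, with maximal domain, and $L^2$ spaces are complex. For $f\in C^1$, the quotient $\frac{f(s)-f(t)}{s-t}$ is extended by continuity to $t=s$ by the value $f'(s)$. Since $\int(1+|t|)^{-1}d\mu<\infty$, the function $\varphi\equiv\mathbf 1$ belongs to $\mathcal H_{-1}(M_t)=L^2((1+|t|)^{-1}d\mu)$, though not necessarily to $L^2(\mu)$. The operator $A_\alpha=M_t+\alpha(\cdot,\varphi)\varphi$ is the form bounded rank one perturbation, i.e. the self-adjoint operator on $L^2(\mu)$ whose resolvent is $$(A_\alpha-\lambda)^{-1}f=(M_t-\lambda)^{-1}f-\frac{\alpha\,\int\frac{f(t)}{t-\lambda}d\mu(t)}{1+\alpha\int\frac{d\mu(t)}{t-\lambda}}\cdot\frac1{t-\lambda},\qquad f\in L^2(\mu),\ \lambda\in\mathbb{C}\setminus\mathbb{R}$$ (the usual rank one perturbation when $\mathbf 1\in L^2(\mu)$). *)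

theory Defs
  imports "HOL-Analysis.Analysis"
begin

text \<open>
  Elements of the complex space \<open>L\<^sup>2(M)\<close> are given by representatives; equality in \<open>L\<^sup>2(M)\<close> is
  equality almost everywhere.
\<close>

definition L2 :: "real measure \<Rightarrow> (real \<Rightarrow> complex) set" where
  "L2 M = {f. f \<in> borel_measurable M \<and> integrable M (\<lambda>x. (cmod (f x))\<^sup>2)}"

definition L2_inner :: "real measure \<Rightarrow> (real \<Rightarrow> complex) \<Rightarrow> (real \<Rightarrow> complex) \<Rightarrow> complex" where
  "L2_inner M f g = (LINT x|M. f x * cnj (g x))"

definition L2_norm :: "real measure \<Rightarrow> (real \<Rightarrow> complex) \<Rightarrow> real" where
  "L2_norm M f = sqrt (LINT x|M. (cmod (f x))\<^sup>2)"

definition Linfty :: "real measure \<Rightarrow> (real \<Rightarrow> complex) set" where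
  "Linfty M = {f. f \<in> borel_measurable M \<and> (\<exists>C::real. AE x in M. cmod (f x) \<le> C)}"

definition msupport :: "real measure \<Rightarrow> real set" where
  "msupport M = {x. \<forall>S. open S \<longrightarrow> x \<in> S \<longrightarrow> emeasure M S \<noteq> 0}"

text \<open>
  Everywhere defined operators act on representatives. Compatibility with almost everywhere
  equality is a consequence of linearity and boundedness.
\<close>

definition bounded_op ::
  "real measure \<Rightarrow> real measure \<Rightarrow> ((real \<Rightarrow> complex) \<Rightarrow> (real \<Rightarrow> complex)) \<Rightarrow> bool" where
  "bounded_op M N T \<longleftrightarrow>
     (\<forall>f\<in>L2 M. T f \<in> L2 N) \<and>
     (\<forall>f\<in>L2 M. \<forall>g\<in>L2 M. \<forall>a b. AE x in N. T (\<lambda>t. a * f t + b * g t) x = a * T f x + b * T g x) \<and>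
     (\<exists>C. \<forall>f\<in>L2 M. L2_norm N (T f) \<le> C * L2_norm M f)"

definition trivial_kernel ::
  "real measure \<Rightarrow> real measure \<Rightarrow> ((real \<Rightarrow> complex) \<Rightarrow> (real \<Rightarrow> complex)) \<Rightarrow> bool" where
  "trivial_kernel M N T \<longleftrightarrow> (\<forall>f\<in>L2 M. (AE x in N. T f x = 0) \<longrightarrow> (AE x in M. f x = 0))"

definition unitary_op ::
  "real measure \<Rightarrow> real measure \<Rightarrow> ((real \<Rightarrow> complex) \<Rightarrow> (real \<Rightarrow> complex)) \<Rightarrow> bool" where
  "unitary_op M N T \<longleftrightarrow>
     bounded_op M N T \<and>
     (\<forall>f\<in>L2 M. \<forall>g\<in>L2 M. L2_inner N (T f) (T g) = L2_inner M f g) \<and>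
     (\<forall>g\<in>L2 N. \<exists>f\<in>L2 M. AE x in N. T f x = g x)"

text \<open>
  Possibly unbounded operators are given by their graphs, which are closed under changing either
  component on a null set. With this encoding equality of graphs includes equality of domains, and
  the product \<open>B A\<close> of operators on its natural domain is the relational composition
  \<open>A O B\<close> (note the order).
\<close>

type_synonym op_graph = "((real \<Rightarrow> complex) \<times> (real \<Rightarrow> complex)) set"

definition graph_of ::
  "real measure \<Rightarrow> real measure \<Rightarrow> ((real \<Rightarrow> complex) \<Rightarrow> (real \<Rightarrow> complex)) \<Rightarrow> op_graph" where
  "graph_of M N T = {(f, g). f \<in> L2 M \<and> g \<in> L2 N \<and> (AE x in N. g x = T f x)}"

definition mult_graph :: "real measure \<Rightarrow> (real \<Rightarrow> complex) \<Rightarrow> op_graph" where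
  "mult_graph M h = {(f, g). f \<in> L2 M \<and> g \<in> L2 M \<and> (AE x in M. g x = h x * f x)}"

definition linear_graph :: "real measure \<Rightarrow> op_graph \<Rightarrow> bool" where
  "linear_graph M A \<longleftrightarrow>
     A \<subseteq> L2 M \<times> L2 M \<and>
     (\<lambda>_. 0, \<lambda>_. 0) \<in> A \<and>
     (\<forall>(f, g)\<in>A. \<forall>(f', g')\<in>A. \<forall>a b.
        (\<lambda>t. a * f t + b * f' t, \<lambda>t. a * g t + b * g' t) \<in> A) \<and>
     (\<forall>(f, g)\<in>A. \<forall>(f', g')\<in>A. (AE t in M. f t = f' t) \<longrightarrow> (AE t in M. g t = g' t)) \<and>
     (\<forall>(f, g)\<in>A. \<forall>f'\<in>L2 M. \<forall>g'\<in>L2 M.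
        (AE t in M. f' t = f t) \<longrightarrow> (AE t in M. g' t = g t) \<longrightarrow> (f', g') \<in> A)"

definition densely_defined :: "real measure \<Rightarrow> op_graph \<Rightarrow> bool" where
  "densely_defined M A \<longleftrightarrow> (\<forall>f\<in>L2 M. \<forall>e>0. \<exists>g\<in>Domain A. L2_norm M (\<lambda>t. f t - g t) < e)"

definition adjoint_graph :: "real measure \<Rightarrow> op_graph \<Rightarrow> op_graph" where
  "adjoint_graph M A =
     {(u, v). u \<in> L2 M \<and> v \<in> L2 M \<and> (\<forall>(f, g)\<in>A. L2_inner M g u = L2_inner M f v)}"

definition selfadjoint :: "real measure \<Rightarrow> op_graph \<Rightarrow> bool" where
  "selfadjoint M A \<longleftrightarrow> linear_graph M A \<and> densely_defined M A \<and> adjoint_graph M A = A"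

text \<open>The graph of \<open>(A - z)\<^sup>-\<^sup>1\<close>: it consists of the pairs \<open>((A - z) f, f)\<close> with \<open>f\<close> in the domain.\<close>

definition resolvent_graph :: "op_graph \<Rightarrow> complex \<Rightarrow> op_graph" where
  "resolvent_graph A z = {(\<lambda>t. g t - z * f t, f) |f g. (f, g) \<in> A}"

definition rank_one_resolvent ::
  "real measure \<Rightarrow> real \<Rightarrow> complex \<Rightarrow> (real \<Rightarrow> complex) \<Rightarrow> (real \<Rightarrow> complex)" where
  "rank_one_resolvent \<mu> \<alpha> z f = (\<lambda>t.
     f t / (of_real t - z)
     - (of_real \<alpha> * (LINT x|\<mu>. f x / (of_real x - z)))
       / (1 + of_real \<alpha> * (LINT x|\<mu>. 1 / (of_real x - z)))
       * (1 / (of_real t - z)))"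

text \<open>
  The form bounded perturbation \<open>M\<^sub>t + \<alpha> (\<cdot>, \<one>) \<one>\<close>. Existence holds as soon as
  \<open>(1 + \<bar>t\<bar>)\<^sup>-\<^sup>1\<close> is \<open>\<mu>\<close>-integrable; uniqueness is clear, since a resolvent graph determines the operator.
\<close>

definition rank_one_perturbation :: "real measure \<Rightarrow> real \<Rightarrow> op_graph" where
  "rank_one_perturbation \<mu> \<alpha> =
     (THE A. selfadjoint \<mu> A \<and>
        (\<forall>z. z \<notin> \<real> \<longrightarrow> resolvent_graph A z = graph_of \<mu> \<mu> (rank_one_resolvent \<mu> \<alpha> z)))"

definition C1_compact :: "(real \<Rightarrow> complex) set" where
  "C1_compact = {f. f C1_differentiable_on UNIV \<and> compact (closure {x. f x \<noteq> 0})}"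

definition diff_quotient :: "(real \<Rightarrow> complex) \<Rightarrow> real \<Rightarrow> real \<Rightarrow> complex" where
  "diff_quotient f s t =
     (if s = t then vector_derivative f (at s) else (f s - f t) / of_real (s - t))"

definition V_formula ::
  "real measure \<Rightarrow> real \<Rightarrow> (real \<Rightarrow> complex) \<Rightarrow> (real \<Rightarrow> complex)" where
  "V_formula \<mu> \<alpha> f = (\<lambda>s. f s - of_real \<alpha> * (LINT t|\<mu>. diff_quotient f s t))"

end

theory Submission
  imports Defs
begin

text \<open>
  Put \<open>F(z) = \<integral> (t - z)\<^sup>-\<^sup>1 d\<mu>(t)\<close> and let \<open>R\<^sub>z\<close> be the resolvent of the perturbed operator. The
  algebraic core is the identity \<open>V((t - z) g) = (s - z) V g - \<alpha> \<integral> g d\<mu>\<close> for test functions \<open>g\<close>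
  (lemma \<open>V_formula_mult_affine\<close>). Dividing by \<open>s - z\<close> it computes \<open>V (f / (t - z))\<close>, and letting \<open>f\<close>
  run through cutoffs that increase to \<open>1\<close> it gives \<open>V ((t - z)\<^sup>-\<^sup>1) = (1 + \<alpha> F(z)) / (s - z)\<close>
  (\<open>V_kernel_function\<close>), although \<open>1\<close> itself need not lie in \<open>L\<^sup>2(\<mu>)\<close>. The two formulas combine to
  \<open>V R\<^sub>z = (s - z)\<^sup>-\<^sup>1 V\<close>: the operator \<open>V\<close> intertwines the perturbation with multiplication by \<open>s\<close>.

  Let \<open>W\<close> be the Hilbert space adjoint of \<open>V\<close>. Since the adjoint of \<open>R\<^sub>z\<close> is \<open>R\<^sub>z\<close> at the conjugate point,
  \<open>V W\<close> is a positive bounded operator on \<open>L\<^sup>2(\<nu>)\<close> that commutes with all multiplications by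
  \<open>(s - z)\<^sup>-\<^sup>1\<close>, hence is multiplication by a real function \<open>w\<close>
  (\<open>symmetric_commuting_op_is_multiplication\<close>). This \<open>w\<close> is bounded and positive almost everywhere
  (\<open>weight_positive_bounded\<close>): it cannot be negative since \<open>V W\<close> is positive, and on the set where \<open>w = 0\<close> every \<open>V f\<close> has to vanish, whereas \<open>V ((t - z)\<^sup>-\<^sup>1)\<close> vanishes nowhere. So \<open>V\<close> has the polar
  form \<open>V = M U\<close> with \<open>M\<close> the multiplication by \<open>\<surd>w\<close>; injectivity of \<open>V\<close> makes \<open>U\<close> isometric and
  \<open>w > 0\<close> makes it onto (\<open>unitary_op_of_weight\<close>). The required function is \<open>h = 1 / \<surd>w\<close>, and boundedness of
  \<open>w\<close> is the condition \<open>1 / h \<in> L\<^sup>\<infinity>\<close>.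

  Finally the operator \<open>U\<^sup>-\<^sup>1 M\<^sub>s U\<close> is selfadjoint and has the resolvents \<open>R\<^sub>z\<close>. This shows both that the
  perturbation exists and that it is this operator, which is the asserted spectral representation.
\<close>

section \<open>The space \<open>L\<^sup>2\<close> on representatives\<close>

lemma L2_measurable [measurable_dest]: "f \<in> L2 M \<Longrightarrow> f \<in> borel_measurable M"
  and L2_integrable: "f \<in> L2 M \<Longrightarrow> integrable M (\<lambda>x. (cmod (f x))\<^sup>2)"
  by (auto simp: L2_def)

lemma borel_measurable_cnj [measurable]: "cnj \<in> borel_measurable borel"
  by (intro borel_measurable_continuous_onI continuous_intros)

lemma L2_dominated:
  assumes "f \<in> L2 M" "g \<in> borel_measurable M" "AE x in M. cmod (g x) \<le> C * cmod (f x)"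
  shows "g \<in> L2 M"
  unfolding L2_def
proof (safe intro!: assms(2))
  note [measurable] = assms(2) L2_measurable[OF assms(1)]
  have "AE x in M. norm ((cmod (g x))\<^sup>2) \<le> norm (C\<^sup>2 * (cmod (f x))\<^sup>2)"
    using assms(3)
  proof eventually_elim
    case (elim x)
    have "(cmod (g x))\<^sup>2 \<le> (C * cmod (f x))\<^sup>2"
      by (rule power_mono[OF elim]) simp
    then show ?case by (simp add: power_mult_distrib)
  qed
  then show "integrable M (\<lambda>x. (cmod (g x))\<^sup>2)"
    by (intro Bochner_Integration.integrable_bound[OF integrable_mult_right[OF L2_integrable[OF assms(1)], of "C\<^sup>2"]])
       auto
qed

lemma L2_mult_bounded:
  assumes "f \<in> L2 M" "r \<in> borel_measurable M" "\<And>x. cmod (r x) \<le> C"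
  shows "(\<lambda>x. r x * f x) \<in> L2 M"
proof -
  note [measurable] = assms(2) L2_measurable[OF assms(1)]
  show ?thesis
    by (rule L2_dominated[OF assms(1), of _ C]) (auto simp: norm_mult intro!: mult_right_mono assms)
qed

lemma L2_lincomb:
  assumes "f \<in> L2 M" "g \<in> L2 M"
  shows "(\<lambda>x. a * f x + b * g x) \<in> L2 M"
  unfolding L2_def
proof safe
  note [measurable] = L2_measurable[OF assms(1)] L2_measurable[OF assms(2)]
  show "(\<lambda>x. a * f x + b * g x) \<in> borel_measurable M" by measurable
  have "(cmod (a * f x + b * g x))\<^sup>2 \<le> 2 * (cmod a)\<^sup>2 * (cmod (f x))\<^sup>2 + 2 * (cmod b)\<^sup>2 * (cmod (g x))\<^sup>2" for x
  proof -
    have "(cmod (a * f x + b * g x))\<^sup>2 \<le> (cmod (a * f x) + cmod (b * g x))\<^sup>2"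
      by (intro power_mono norm_triangle_ineq) simp
    also have "\<dots> \<le> 2 * (cmod (a * f x))\<^sup>2 + 2 * (cmod (b * g x))\<^sup>2"
      by (smt (verit) sum_squares_bound power2_sum)
    finally show ?thesis by (simp add: norm_mult power_mult_distrib)
  qed
  then show "integrable M (\<lambda>x. (cmod (a * f x + b * g x))\<^sup>2)"
    by (intro Bochner_Integration.integrable_bound[OF Bochner_Integration.integrable_add[OF
          integrable_mult_right[OF L2_integrable[OF assms(1)], of "2 * (cmod a)\<^sup>2"]
          integrable_mult_right[OF L2_integrable[OF assms(2)], of "2 * (cmod b)\<^sup>2"]]])
       (auto intro!: AE_I2)
qed

lemma L2_diff: "f \<in> L2 M \<Longrightarrow> g \<in> L2 M \<Longrightarrow> (\<lambda>x. f x - g x) \<in> L2 M"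
  using L2_lincomb[of f M g 1 "-1"] by simp

lemma L2_scale: "f \<in> L2 M \<Longrightarrow> (\<lambda>x. a * f x) \<in> L2 M"
  using L2_lincomb[of f M f a 0] by simp

lemma L2_zero: "(\<lambda>x. 0) \<in> L2 M"
  by (simp add: L2_def)

lemma L2_inner_integrable:
  assumes "f \<in> L2 M" "g \<in> L2 M"
  shows "integrable M (\<lambda>x. f x * cnj (g x))"
proof -
  note [measurable] = L2_measurable[OF assms(1)] L2_measurable[OF assms(2)]
  have "cmod (f x * cnj (g x)) \<le> (cmod (f x))\<^sup>2 + (cmod (g x))\<^sup>2" for x
  proof -
    have "0 \<le> cmod (f x) * cmod (g x)" by simp
    with sum_squares_bound[of "cmod (f x)" "cmod (g x)"]
    have "cmod (f x) * cmod (g x) \<le> (cmod (f x))\<^sup>2 + (cmod (g x))\<^sup>2" by linarith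
    then show ?thesis by (simp add: norm_mult)
  qed
  then show ?thesis
    by (intro Bochner_Integration.integrable_bound[OF Bochner_Integration.integrable_add[OF
          L2_integrable[OF assms(1)] L2_integrable[OF assms(2)]]]) (auto intro!: AE_I2)
qed

lemma L2_norm_nonneg [simp]: "L2_norm M f \<ge> 0"
  by (simp add: L2_norm_def)

lemma L2_norm_power2: "(L2_norm M f)\<^sup>2 = (LINT x|M. (cmod (f x))\<^sup>2)"
  by (simp add: L2_norm_def)

lemma L2_inner_self: "L2_inner M f f = of_real ((L2_norm M f)\<^sup>2)"
proof -
  have *: "f x * cnj (f x) = of_real ((cmod (f x))\<^sup>2)" for x
    by (metis complex_norm_square)
  show ?thesis unfolding L2_inner_def L2_norm_power2 * by (rule integral_complex_of_real)
qed

lemma L2_inner_lincomb_left: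
  assumes "f \<in> L2 M" "g \<in> L2 M" "k \<in> L2 M"
  shows "L2_inner M (\<lambda>x. a * f x + b * g x) k = a * L2_inner M f k + b * L2_inner M g k"
proof -
  have "L2_inner M (\<lambda>x. a * f x + b * g x) k
      = (LINT x|M. a * (f x * cnj (k x)) + b * (g x * cnj (k x)))"
    by (simp add: L2_inner_def algebra_simps)
  then show ?thesis
    using L2_inner_integrable[OF assms(1,3)] L2_inner_integrable[OF assms(2,3)]
    by (simp add: L2_inner_def)
qed

lemma L2_inner_commute: "L2_inner M g f = cnj (L2_inner M f g)"
  unfolding L2_inner_def using Bochner_Integration.integral_cnj[of M "\<lambda>x. f x * cnj (g x)"]
  by (simp add: mult.commute)

lemma L2_inner_lincomb_right:
  assumes "f \<in> L2 M" "g \<in> L2 M" "k \<in> L2 M"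
  shows "L2_inner M k (\<lambda>x. a * f x + b * g x) = cnj a * L2_inner M k f + cnj b * L2_inner M k g"
  by (subst (1 2 3) L2_inner_commute) (simp add: L2_inner_lincomb_left assms)

lemma L2_inner_diff_left:
  assumes "f \<in> L2 M" "g \<in> L2 M" "k \<in> L2 M"
  shows "L2_inner M (\<lambda>x. f x - g x) k = L2_inner M f k - L2_inner M g k"
  using L2_inner_lincomb_left[OF assms, of 1 "-1"] by simp

lemma L2_inner_diff_right:
  assumes "f \<in> L2 M" "g \<in> L2 M" "k \<in> L2 M"
  shows "L2_inner M k (\<lambda>x. f x - g x) = L2_inner M k f - L2_inner M k g"
  using L2_inner_lincomb_right[OF assms, of 1 "-1"] by simp

lemma L2_inner_cong_AE:
  assumes "f \<in> L2 M" "f' \<in> L2 M" "g \<in> L2 M" "g' \<in> L2 M"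
    "AE x in M. f x = f' x" "AE x in M. g x = g' x"
  shows "L2_inner M f g = L2_inner M f' g'"
proof -
  note [measurable] = assms(1-4)[THEN L2_measurable]
  show ?thesis unfolding L2_inner_def
    by (rule integral_cong_AE, measurable) (use assms(5,6) in auto)
qed

lemma L2_norm_cong_AE:
  assumes "f \<in> L2 M" "f' \<in> L2 M" "AE x in M. f x = f' x"
  shows "L2_norm M f = L2_norm M f'"
proof -
  note [measurable] = assms(1-2)[THEN L2_measurable]
  show ?thesis unfolding L2_norm_def
    by (rule arg_cong[where f = sqrt], rule integral_cong_AE, measurable) (use assms(3) in auto)
qed

lemma L2_norm_eq_0_iff:
  assumes "f \<in> L2 M"
  shows "L2_norm M f = 0 \<longleftrightarrow> (AE x in M. f x = 0)"
  using integral_nonneg_eq_0_iff_AE[OF L2_integrable[OF assms]]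
  by (simp add: L2_norm_def)

lemma L2_norm_power2_lincomb:
  assumes "f \<in> L2 M" "g \<in> L2 M"
  shows "(L2_norm M (\<lambda>x. a * f x + b * g x))\<^sup>2
    = (cmod a)\<^sup>2 * (L2_norm M f)\<^sup>2 + (cmod b)\<^sup>2 * (L2_norm M g)\<^sup>2 + 2 * Re (a * cnj b * L2_inner M f g)"
proof -
  have "complex_of_real ((L2_norm M (\<lambda>x. a * f x + b * g x))\<^sup>2)
      = L2_inner M (\<lambda>x. a * f x + b * g x) (\<lambda>x. a * f x + b * g x)"
    by (simp add: L2_inner_self)
  also have "\<dots> = a * cnj a * L2_inner M f f + b * cnj b * L2_inner M g g
      + (a * cnj b * L2_inner M f g + cnj (a * cnj b * L2_inner M f g))"
    by (simp add: L2_inner_lincomb_left L2_inner_lincomb_right assms L2_lincomb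
        L2_inner_commute[of M g f] algebra_simps)
  finally have "Re (complex_of_real ((L2_norm M (\<lambda>x. a * f x + b * g x))\<^sup>2))
      = Re (a * cnj a * L2_inner M f f + b * cnj b * L2_inner M g g
      + (a * cnj b * L2_inner M f g + cnj (a * cnj b * L2_inner M f g)))" by simp
  then show ?thesis
    by (simp only: L2_inner_self complex_norm_square[symmetric] of_real_mult[symmetric]
        plus_complex.sel Re_complex_of_real complex_cnj cnj.sel)
qed

lemma L2_norm_power2_diff:
  assumes "f \<in> L2 M" "g \<in> L2 M"
  shows "(L2_norm M (\<lambda>x. f x - g x))\<^sup>2
    = (L2_norm M f)\<^sup>2 + (L2_norm M g)\<^sup>2 - 2 * Re (L2_inner M f g)"
  using L2_norm_power2_lincomb[OF assms, of 1 "-1"] by simp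

lemma L2_Cauchy_Schwarz:
  assumes "f \<in> L2 M" "g \<in> L2 M"
  shows "cmod (L2_inner M f g) \<le> L2_norm M f * L2_norm M g"
proof (cases "L2_norm M g = 0")
  case True
  then have "AE x in M. g x = 0" using L2_norm_eq_0_iff[OF assms(2)] by simp
  then have "L2_inner M f g = L2_inner M f (\<lambda>x. 0)"
    by (intro L2_inner_cong_AE assms L2_zero) auto
  then show ?thesis by (simp add: L2_inner_def)
next
  case False
  define n where "n = (L2_norm M g)\<^sup>2"
  define d where "d = L2_inner M f g"
  have n: "n > 0" using False by (simp add: n_def)
  have "0 \<le> (L2_norm M (\<lambda>x. 1 * f x + (- (d / n)) * g x))\<^sup>2" by simp
  also have "\<dots> = (L2_norm M f)\<^sup>2 + (cmod d / n)\<^sup>2 * n - 2 * Re (d * cnj d / n)"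
    using n by (subst L2_norm_power2_lincomb[OF assms]) (simp add: norm_divide d_def[symmetric] n_def[symmetric] mult.commute)
  also have "d * cnj d / n = of_real ((cmod d)\<^sup>2 / n)" by (simp add: complex_norm_square del: of_real_power)
  finally have "0 \<le> (L2_norm M f)\<^sup>2 - (cmod d)\<^sup>2 / n"
    using n by (simp add: power2_eq_square field_simps)
  then have "(cmod d)\<^sup>2 \<le> (L2_norm M f)\<^sup>2 * n" using n by (simp add: field_simps)
  then have "(cmod d)\<^sup>2 \<le> (L2_norm M f * L2_norm M g)\<^sup>2" by (simp add: n_def power_mult_distrib)
  then show ?thesis unfolding d_def by (rule power2_le_imp_le) simp
qed

lemma L2_inner_tendsto:
  assumes "\<And>n. f n \<in> L2 M" "g \<in> L2 M" "k \<in> L2 M"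
    and lim: "(\<lambda>n. L2_norm M (\<lambda>x. f n x - g x)) \<longlonglongrightarrow> 0"
  shows "(\<lambda>n. L2_inner M (f n) k) \<longlonglongrightarrow> L2_inner M g k"
proof (rule LIM_zero_cancel, rule Lim_null_comparison)
  show "\<forall>\<^sub>F n in sequentially. norm (L2_inner M (f n) k - L2_inner M g k)
      \<le> L2_norm M (\<lambda>x. f n x - g x) * L2_norm M k"
    using L2_Cauchy_Schwarz[OF L2_diff assms(3), OF assms(1,2)]
    by (simp add: L2_inner_diff_left assms)
  show "(\<lambda>n. L2_norm M (\<lambda>x. f n x - g x) * L2_norm M k) \<longlonglongrightarrow> 0"
    using tendsto_mult_left_zero[OF lim] .
qed

lemma L2_tendsto_AE_subseq:
  assumes "\<And>n. f n \<in> L2 M" "g \<in> L2 M"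
    and lim: "(\<lambda>n. L2_norm M (\<lambda>x. f n x - g x)) \<longlonglongrightarrow> 0"
  obtains r where "strict_mono (r :: nat \<Rightarrow> nat)" "AE x in M. (\<lambda>n. f (r n) x) \<longlonglongrightarrow> g x"
proof -
  have "(\<lambda>n. (L2_norm M (\<lambda>x. f n x - g x))\<^sup>2) \<longlonglongrightarrow> 0"
    using tendsto_power[OF lim, of 2] by simp
  then have "\<exists>r. strict_mono r \<and> (AE x in M. (\<lambda>n. (cmod (f (r n) x - g x))\<^sup>2) \<longlonglongrightarrow> 0)"
    by (intro tendsto_L1_AE_subseq) (auto simp: L2_norm_power2 intro!: L2_integrable L2_diff assms)
  then obtain r where r: "strict_mono r" "AE x in M. (\<lambda>n. (cmod (f (r n) x - g x))\<^sup>2) \<longlonglongrightarrow> 0" by blast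
  from r(2) have "AE x in M. (\<lambda>n. f (r n) x) \<longlonglongrightarrow> g x"
    by eventually_elim (simp add: tendsto_norm_zero_iff LIM_zero_iff)
  with r(1) show ?thesis by (rule that)
qed

lemma L2_limit_unique_AE:
  assumes "\<And>n. f n \<in> L2 M" "g \<in> L2 M"
    and "(\<lambda>n. L2_norm M (\<lambda>x. f n x - g x)) \<longlonglongrightarrow> 0"
    and "AE x in M. (\<lambda>n. f n x) \<longlonglongrightarrow> k x"
  shows "AE x in M. g x = k x"
proof -
  obtain r where r: "strict_mono (r :: nat \<Rightarrow> nat)" "AE x in M. (\<lambda>n. f (r n) x) \<longlonglongrightarrow> g x"
    using L2_tendsto_AE_subseq[OF assms(1-3)] .
  from r(2) assms(4) show ?thesis
    by eventually_elim (use LIMSEQ_subseq_LIMSEQ[OF _ r(1)] in \<open>auto simp: o_def intro: LIMSEQ_unique\<close>)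
qed

lemma L2_dominated_convergence:
  assumes "\<And>n. f n \<in> borel_measurable M" "g \<in> borel_measurable M" "k \<in> L2 M"
    and "AE x in M. (\<lambda>n. f n x) \<longlonglongrightarrow> g x"
    and "\<And>n. AE x in M. cmod (f n x - g x) \<le> cmod (k x)"
  shows "(\<lambda>n. L2_norm M (\<lambda>x. f n x - g x)) \<longlonglongrightarrow> 0"
proof -
  note [measurable] = assms(1,2) L2_measurable[OF assms(3)]
  have "(\<lambda>n. LINT x|M. (cmod (f n x - g x))\<^sup>2) \<longlonglongrightarrow> (LINT x|M. 0)"
  proof (rule integral_dominated_convergence[where w = "\<lambda>x. (cmod (k x))\<^sup>2"])
    show "AE x in M. (\<lambda>n. (cmod (f n x - g x))\<^sup>2) \<longlonglongrightarrow> 0"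
      using assms(4) by eventually_elim (simp add: tendsto_norm_zero_iff LIM_zero_iff)
    show "AE x in M. norm ((cmod (f n x - g x))\<^sup>2) \<le> (cmod (k x))\<^sup>2" for n
      using assms(5)[of n] by eventually_elim (simp add: power_mono)
  qed (use L2_integrable[OF assms(3)] in measurable)
  from tendsto_real_sqrt[OF this] show ?thesis by (simp add: L2_norm_def)
qed

lemma nn_integral_L2:
  assumes "f \<in> L2 M"
  shows "(\<integral>\<^sup>+x. ennreal ((cmod (f x))\<^sup>2) \<partial>M) = ennreal ((L2_norm M f)\<^sup>2)"
  unfolding L2_norm_power2 by (rule nn_integral_eq_integral[OF L2_integrable[OF assms]]) auto

lemma L2_I_nn_integral:
  assumes "f \<in> borel_measurable M" "(\<integral>\<^sup>+x. ennreal ((cmod (f x))\<^sup>2) \<partial>M) \<le> ennreal (e\<^sup>2)" "e \<ge> 0"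
  shows "f \<in> L2 M" "L2_norm M f \<le> e"
proof -
  note [measurable] = assms(1)
  have "integrable M (\<lambda>x. (cmod (f x))\<^sup>2)"
    by (rule integrableI_bounded) (use assms(2) in \<open>auto simp: less_top[symmetric] top_unique\<close>)
  then show f: "f \<in> L2 M" using assms(1) by (simp add: L2_def)
  have "ennreal ((L2_norm M f)\<^sup>2) \<le> ennreal (e\<^sup>2)" using assms(2) nn_integral_L2[OF f] by simp
  then show "L2_norm M f \<le> e" using assms(3) by (simp add: ennreal_le_iff)
qed

text \<open>
  Along a subsequence the increments have norm at most \<open>2\<^sup>-\<^sup>k\<close>. Weighting their squares by \<open>2\<^sup>k\<close> keeps
  the integrals summable, so almost everywhere the increments decay geometrically and the subsequence converges;
  Fatou's lemma turns the pointwise limit into a limit in norm.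
\<close>
lemma L2_complete:
  assumes f: "\<And>n. f n \<in> L2 M"
    and Cauchy: "\<And>e. e > 0 \<Longrightarrow> \<exists>N. \<forall>m\<ge>N. \<forall>n\<ge>N. L2_norm M (\<lambda>x. f m x - f n x) < e"
  obtains g where "g \<in> L2 M" "(\<lambda>n. L2_norm M (\<lambda>x. f n x - g x)) \<longlonglongrightarrow> 0"
proof -
  note [measurable] = L2_measurable[OF f]
  obtain N where N: "\<And>k m n. m \<ge> N k \<Longrightarrow> n \<ge> N k \<Longrightarrow> L2_norm M (\<lambda>x. f m x - f n x) < (1/2)^k"
    using Cauchy[of "(1/2)^_"] by (metis zero_less_divide_1_iff zero_less_numeral zero_less_power)
  \<comment> \<open>Summation makes \<open>r k\<close> an upper bound of all \<open>N j\<close> with \<open>j \<le> k\<close>.\<close>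
  define r where "r k = (\<Sum>i\<le>k. N i)" for k
  have r: "r k \<ge> N j" if "j \<le> k" for j k
    unfolding r_def using that by (intro member_le_sum) auto
  define d where "d k x = f (r (Suc k)) x - f (r k) x" for k x
  have dL2: "d k \<in> L2 M" for k unfolding d_def by (intro L2_diff f)
  note [measurable] = L2_measurable[OF dL2]
  have dn: "L2_norm M (d k) \<le> (1/2)^k" for k
    unfolding d_def using N[of k "r (Suc k)" "r k"] r[of k k] r[of k "Suc k"] by simp
  have "(\<integral>\<^sup>+x. (\<Sum>k. ennreal (2^k * (cmod (d k x))\<^sup>2)) \<partial>M)
      = (\<Sum>k. \<integral>\<^sup>+x. ennreal (2^k * (cmod (d k x))\<^sup>2) \<partial>M)"
    by (intro nn_integral_suminf) measurable
  also have "\<dots> = (\<Sum>k. ennreal (2^k * (L2_norm M (d k))\<^sup>2))"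
    by (simp add: ennreal_mult nn_integral_cmult nn_integral_L2[OF dL2])
  also have "\<dots> \<le> (\<Sum>k. ennreal ((1/2)^k))"
  proof (intro suminf_le summableI ennreal_leI)
    fix k
    have "2^k * (L2_norm M (d k))\<^sup>2 \<le> 2^k * ((1/2)^k)\<^sup>2"
      by (intro mult_left_mono power_mono dn) auto
    also have "\<dots> = (1/2)^k" by (simp add: power2_eq_square power_one_over)
    finally show "2^k * (L2_norm M (d k))\<^sup>2 \<le> (1/2)^k" .
  qed
  also have "\<dots> = ennreal 2"
    by (subst suminf_ennreal2) (auto simp: suminf_geometric)
  finally have "(\<integral>\<^sup>+x. (\<Sum>k. ennreal (2^k * (cmod (d k x))\<^sup>2)) \<partial>M) \<noteq> \<infinity>"
    by (auto simp: top_unique)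
  then have "AE x in M. (\<Sum>k. ennreal (2^k * (cmod (d k x))\<^sup>2)) \<noteq> \<infinity>"
    by (intro nn_integral_noteq_infinite) measurable
  then have conv: "AE x in M. convergent (\<lambda>k. f (r k) x)"
  proof eventually_elim
    case (elim x)
    then have "summable (\<lambda>k. 2^k * (cmod (d k x))\<^sup>2)"
      by (intro summable_suminf_not_top) auto
    then have "bounded (range (\<lambda>k. 2^k * (cmod (d k x))\<^sup>2))"
      by (rule convergent_imp_bounded[OF summable_LIMSEQ_zero])
    then obtain B where B: "\<And>k. 2^k * (cmod (d k x))\<^sup>2 \<le> B" unfolding bounded_iff by fastforce
    have B0: "B \<ge> 0" by (rule order_trans[OF _ B[of 0]]) simp
    have le: "norm (d k x) \<le> sqrt B * (1 / sqrt 2)^k" for k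
    proof (rule power2_le_imp_le)
      have "((1 / sqrt 2)^k)\<^sup>2 = ((1 / sqrt 2)\<^sup>2)^k"
        by (simp only: power_mult[symmetric] mult.commute)
      also have "(1 / sqrt 2)\<^sup>2 = (1/2 :: real)" by (simp add: power_divide)
      finally have *: "((1 / sqrt 2)^k)\<^sup>2 = (1/2 :: real)^k" .
      have "(sqrt B * (1 / sqrt 2)^k)\<^sup>2 = B / 2^k"
        using B0 by (simp only: power_mult_distrib real_sqrt_pow2 *) (simp add: power_one_over)
      moreover have "(cmod (d k x))\<^sup>2 \<le> B / 2^k"
        using B[of k] by (simp add: pos_le_divide_eq mult.commute)
      ultimately show "(cmod (d k x))\<^sup>2 \<le> (sqrt B * (1 / sqrt 2)^k)\<^sup>2" by simp
    qed (use B0 in simp)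
    have sm: "summable (\<lambda>k. sqrt B * (1 / sqrt 2)^k)"
      by (intro summable_mult summable_geometric) (simp add: real_less_rsqrt)
    have "summable (\<lambda>k. d k x)"
      by (rule summable_comparison_test'[OF sm le])
    then have "convergent (\<lambda>n. \<Sum>k<n. d k x)" by (simp add: summable_iff_convergent)
    then have "convergent (\<lambda>n. f (r n) x - f (r 0) x)"
      unfolding d_def by (simp add: sum_lessThan_telescope[of "\<lambda>k. f (r k) x"])
    then show ?case using convergent_diff_const_right_iff by blast
  qed
  define g where "g x = lim (\<lambda>k. f (r k) x)" for x
  have [measurable]: "g \<in> borel_measurable M" unfolding g_def by measurable
  have g: "AE x in M. (\<lambda>k. f (r k) x) \<longlonglongrightarrow> g x"
    using conv by eventually_elim (simp add: convergent_LIMSEQ_iff g_def)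
  have near: "(\<lambda>x. f n x - g x) \<in> L2 M \<and> L2_norm M (\<lambda>x. f n x - g x) \<le> (1/2)^j" if "n \<ge> N j" for n j
  proof -
    have "(\<integral>\<^sup>+x. ennreal ((cmod (f n x - g x))\<^sup>2) \<partial>M)
        = (\<integral>\<^sup>+x. liminf (\<lambda>k. ennreal ((cmod (f n x - f (r k) x))\<^sup>2)) \<partial>M)"
    proof (rule nn_integral_cong_AE)
      show "AE x in M. ennreal ((cmod (f n x - g x))\<^sup>2)
          = liminf (\<lambda>k. ennreal ((cmod (f n x - f (r k) x))\<^sup>2))"
        using g
      proof eventually_elim
        case (elim x)
        then have "(\<lambda>k. ennreal ((cmod (f n x - f (r k) x))\<^sup>2)) \<longlonglongrightarrow> ennreal ((cmod (f n x - g x))\<^sup>2)"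
          by (intro tendsto_intros)
        then show ?case by (intro lim_imp_Liminf[symmetric]) auto
      qed
    qed
    also have "\<dots> \<le> liminf (\<lambda>k. \<integral>\<^sup>+x. ennreal ((cmod (f n x - f (r k) x))\<^sup>2) \<partial>M)"
      by (intro nn_integral_liminf) measurable
    also have "\<dots> \<le> limsup (\<lambda>k. \<integral>\<^sup>+x. ennreal ((cmod (f n x - f (r k) x))\<^sup>2) \<partial>M)"
      by (rule Liminf_le_Limsup) simp
    also have "\<dots> \<le> ennreal (((1/2)^j)\<^sup>2)"
    proof (rule Limsup_bounded)
      show "\<forall>\<^sub>F k in sequentially. (\<integral>\<^sup>+x. ennreal ((cmod (f n x - f (r k) x))\<^sup>2) \<partial>M) \<le> ennreal (((1/2)^j)\<^sup>2)"
        using eventually_ge_at_top[of j]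
      proof eventually_elim
        case (elim k)
        have "L2_norm M (\<lambda>x. f n x - f (r k) x) < (1/2)^j"
          using that r[OF elim] by (intro N) auto
        then have "(L2_norm M (\<lambda>x. f n x - f (r k) x))\<^sup>2 \<le> ((1/2)^j)\<^sup>2"
          by (intro power_mono) auto
        then show ?case by (subst nn_integral_L2) (auto intro!: L2_diff f ennreal_leI)
      qed
    qed
    finally show ?thesis by (intro conjI L2_I_nn_integral) auto
  qed
  have gL2: "g \<in> L2 M"
    using L2_diff[OF f[of "N 0"] conjunct1[OF near[of 0 "N 0"]]] by simp
  have "(\<lambda>n. L2_norm M (\<lambda>x. f n x - g x)) \<longlonglongrightarrow> 0"
  proof (rule LIMSEQ_I)
    fix e :: real assume "e > 0"
    then obtain j where j: "(1/2)^j < e" using real_arch_pow_inv[of e "1/2"] by auto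
    show "\<exists>no. \<forall>n\<ge>no. norm (L2_norm M (\<lambda>x. f n x - g x) - 0) < e"
      using near[of j] j by (intro exI[of _ "N j"]) (auto intro: le_less_trans)
  qed
  with gL2 show ?thesis by (rule that)
qed

text \<open>
  The representing vector minimizes \<open>J(f) = \<parallel>f\<parallel>\<^sup>2 - 2 Re (l f)\<close>: by the parallelogram law a minimizing sequence is
  Cauchy, and the vanishing of the first variation of \<open>J\<close> at the limit is the asserted identity.
\<close>
lemma L2_Riesz_representation:
  assumes lin: "\<And>f g a b. f \<in> L2 M \<Longrightarrow> g \<in> L2 M \<Longrightarrow> l (\<lambda>x. a * f x + b * g x) = a * l f + b * l g"
    and bound: "\<And>f. f \<in> L2 M \<Longrightarrow> cmod (l f) \<le> C * L2_norm M f"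
  obtains p where "p \<in> L2 M" "\<And>f. f \<in> L2 M \<Longrightarrow> l f = L2_inner M f p"
proof -
  define J where "J f = (L2_norm M f)\<^sup>2 - 2 * Re (l f)" for f
  have J_lower: "J f \<ge> - C\<^sup>2" if "f \<in> L2 M" for f
  proof -
    have "Re (l f) \<le> C * L2_norm M f" using bound[OF that] complex_Re_le_cmod order_trans by blast
    moreover have "0 \<le> (L2_norm M f - C)\<^sup>2" by simp
    ultimately show ?thesis unfolding J_def by (simp add: power2_eq_square algebra_simps)
  qed
  define j where "j = Inf (J ` L2 M)"
  have j_le: "j \<le> J f" if "f \<in> L2 M" for f
    unfolding j_def using that J_lower by (intro cInf_lower bdd_belowI[of _ "- C\<^sup>2"]) auto
  define eps where "eps n = 1 / (real n + 1)" for n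
  have "\<exists>f\<in>L2 M. J f < j + eps n" for n
    using cInf_lessD[of "J ` L2 M" "j + eps n"] L2_zero[of M]
    by (auto simp: j_def eps_def)
  then obtain f where f: "\<And>n. f n \<in> L2 M" and Jf: "\<And>n. J (f n) < j + eps n" by metis
  have close: "(L2_norm M (\<lambda>x. f m x - f n x))\<^sup>2 \<le> 2 * eps m + 2 * eps n" for m n
  proof -
    let ?h = "\<lambda>x. 1/2 * f m x + 1/2 * f n x"
    have "(L2_norm M (\<lambda>x. f m x - f n x))\<^sup>2 = 2 * J (f m) + 2 * J (f n) - 4 * J ?h"
      unfolding J_def L2_norm_power2_diff[OF f f] L2_norm_power2_lincomb[OF f f] lin[OF f f]
      by (simp add: power2_eq_square)
    also have "\<dots> \<le> 2 * eps m + 2 * eps n"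
      using Jf[of m] Jf[of n] j_le[OF L2_lincomb[OF f f], of "1/2" m "1/2" n] by (simp add: field_simps)
    finally show ?thesis .
  qed
  have Cauchy: "\<exists>N. \<forall>m\<ge>N. \<forall>n\<ge>N. L2_norm M (\<lambda>x. f m x - f n x) < e" if "e > 0" for e :: real
  proof -
    obtain N :: nat where N: "4 / e\<^sup>2 < real N" using reals_Archimedean2 by blast
    have small: "2 * eps m < e\<^sup>2 / 2" if "m \<ge> N" for m
    proof -
      have "4 / e\<^sup>2 < real m + 1" using N that by linarith
      then show ?thesis using \<open>e > 0\<close> by (simp add: field_simps eps_def)
    qed
    have "L2_norm M (\<lambda>x. f m x - f n x) < e" if "m \<ge> N" "n \<ge> N" for m n
    proof (rule power2_less_imp_less)
      show "(L2_norm M (\<lambda>x. f m x - f n x))\<^sup>2 < e\<^sup>2"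
        using close[of m n] small[OF that(1)] small[OF that(2)] by linarith
    qed (use \<open>e > 0\<close> in simp)
    then show ?thesis by blast
  qed
  obtain p where p: "p \<in> L2 M" and lim: "(\<lambda>n. L2_norm M (\<lambda>x. f n x - p x)) \<longlonglongrightarrow> 0"
    using L2_complete[OF f Cauchy] by blast
  have "l k = L2_inner M k p" if k: "k \<in> L2 M" for k
  proof -
    define d where "d = L2_inner M p k - cnj (l k)"
    have var: "0 \<le> (cmod c)\<^sup>2 * (L2_norm M k)\<^sup>2 + 2 * Re (cnj c * d)" for c
    proof (rule LIMSEQ_le)
      show "(\<lambda>n. - eps n) \<longlonglongrightarrow> 0" unfolding eps_def using LIMSEQ_inverse_real_of_nat_add_minus[of 0] by (simp add: inverse_eq_divide add.commute)
      show "(\<lambda>n. (cmod c)\<^sup>2 * (L2_norm M k)\<^sup>2 + 2 * Re (cnj c * (L2_inner M (f n) k - cnj (l k))))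
          \<longlonglongrightarrow> (cmod c)\<^sup>2 * (L2_norm M k)\<^sup>2 + 2 * Re (cnj c * d)"
        unfolding d_def by (intro tendsto_intros L2_inner_tendsto[OF f p k lim])
      have "- eps n \<le> (cmod c)\<^sup>2 * (L2_norm M k)\<^sup>2 + 2 * Re (cnj c * (L2_inner M (f n) k - cnj (l k)))" for n
      proof -
        have "j \<le> J (\<lambda>x. 1 * f n x + c * k x)" by (intro j_le L2_lincomb f k)
        also have "\<dots> = J (f n) + ((cmod c)\<^sup>2 * (L2_norm M k)\<^sup>2 + 2 * Re (cnj c * (L2_inner M (f n) k - cnj (l k))))"
          unfolding J_def lin[OF f k] L2_norm_power2_lincomb[OF f k]
          by (simp add: algebra_simps)
        finally show ?thesis using Jf[of n] by linarith
      qed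
      then show "\<exists>N. \<forall>n\<ge>N. - eps n \<le> (cmod c)\<^sup>2 * (L2_norm M k)\<^sup>2 + 2 * Re (cnj c * (L2_inner M (f n) k - cnj (l k)))"
        by blast
    qed
    have "cmod d = 0"
    proof (rule ccontr)
      assume "cmod d \<noteq> 0"
      define B where "B = (L2_norm M k)\<^sup>2 + 1"
      have B: "B > 0" "(L2_norm M k)\<^sup>2 \<le> B" unfolding B_def by (auto intro: add_nonneg_pos)
      \<comment> \<open>The step \<open>-d/B\<close> goes against the gradient \<open>d\<close> and is short enough for the linear term to win.\<close>
      have "0 \<le> (cmod (- d / B))\<^sup>2 * (L2_norm M k)\<^sup>2 + 2 * Re (cnj (- d / B) * d)" by (rule var)
      also have "cnj (- d / B) * d = - of_real ((cmod d)\<^sup>2 / B)"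
        by (simp add: complex_norm_square mult.commute del: of_real_power)
      also have "(cmod (- d / B))\<^sup>2 * (L2_norm M k)\<^sup>2 \<le> (cmod (- d / B))\<^sup>2 * B"
        using B by (intro mult_left_mono) auto
      also have "\<dots> = (cmod d)\<^sup>2 / B" using B by (simp add: norm_divide power2_eq_square)
      finally show False using B \<open>cmod d \<noteq> 0\<close> by (simp add: field_simps)
    qed
    then have "l k = cnj (L2_inner M p k)" by (simp add: d_def)
    then show ?thesis by (simp add: L2_inner_commute[of M k p])
  qed
  with p show ?thesis by (rule that)
qed

section \<open>Bounded operators, adjoints, and functions with vanishing moments\<close>

lemma bounded_op_L2: "bounded_op M N T \<Longrightarrow> f \<in> L2 M \<Longrightarrow> T f \<in> L2 N"
  by (simp add: bounded_op_def)

lemma bounded_op_lincomb: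
  "bounded_op M N T \<Longrightarrow> f \<in> L2 M \<Longrightarrow> g \<in> L2 M \<Longrightarrow>
    AE x in N. T (\<lambda>t. a * f t + b * g t) x = a * T f x + b * T g x"
  by (simp add: bounded_op_def)

lemma bounded_op_diff:
  assumes "bounded_op M N T" "f \<in> L2 M" "g \<in> L2 M"
  shows "AE x in N. T (\<lambda>t. f t - g t) x = T f x - T g x"
  using bounded_op_lincomb[OF assms, of 1 "-1"] by simp

lemma bounded_op_bound:
  assumes "bounded_op M N T"
  obtains C where "C > 0" "\<And>f. f \<in> L2 M \<Longrightarrow> L2_norm N (T f) \<le> C * L2_norm M f"
proof -
  obtain C where C: "\<And>f. f \<in> L2 M \<Longrightarrow> L2_norm N (T f) \<le> C * L2_norm M f"
    using assms unfolding bounded_op_def by blast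
  have "L2_norm N (T f) \<le> (\<bar>C\<bar> + 1) * L2_norm M f" if "f \<in> L2 M" for f
    by (rule order_trans[OF C[OF that]]) (auto intro!: mult_right_mono)
  then show ?thesis by (intro that[of "\<bar>C\<bar> + 1"]) auto
qed

lemma bounded_op_tendsto:
  assumes T: "bounded_op M N T" and f: "\<And>n. f n \<in> L2 M" and g: "g \<in> L2 M"
    and lim: "(\<lambda>n. L2_norm M (\<lambda>x. f n x - g x)) \<longlonglongrightarrow> 0"
  shows "(\<lambda>n. L2_norm N (\<lambda>x. T (f n) x - T g x)) \<longlonglongrightarrow> 0"
proof -
  obtain C where C: "\<And>f. f \<in> L2 M \<Longrightarrow> L2_norm N (T f) \<le> C * L2_norm M f"
    using bounded_op_bound[OF T] by blast
  have eq: "L2_norm N (\<lambda>x. T (f n) x - T g x) = L2_norm N (T (\<lambda>x. f n x - g x))" for n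
    using bounded_op_diff[OF T f g, of n]
    by (intro L2_norm_cong_AE) (auto intro!: L2_diff bounded_op_L2[OF T] f g)
  show ?thesis unfolding eq
  proof (rule Lim_null_comparison)
    show "\<forall>\<^sub>F n in sequentially. norm (L2_norm N (T (\<lambda>x. f n x - g x))) \<le> C * L2_norm M (\<lambda>x. f n x - g x)"
      using C[OF L2_diff[OF f g]] by simp
    show "(\<lambda>n. C * L2_norm M (\<lambda>x. f n x - g x)) \<longlonglongrightarrow> 0"
      using tendsto_mult_right_zero[OF lim] .
  qed
qed

lemma bounded_op_cong_AE:
  assumes T: "bounded_op M N T" and f: "f \<in> L2 M" and g: "g \<in> L2 M" and eq: "AE x in M. f x = g x"
  shows "AE x in N. T f x = T g x"
proof -
  obtain C where C: "\<And>f. f \<in> L2 M \<Longrightarrow> L2_norm N (T f) \<le> C * L2_norm M f"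
    using bounded_op_bound[OF T] by blast
  have "L2_norm M (\<lambda>x. f x - g x) = 0"
    using eq by (subst L2_norm_eq_0_iff) (auto intro!: L2_diff f g)
  then have "L2_norm N (T (\<lambda>x. f x - g x)) = 0"
    using C[OF L2_diff[OF f g]] by (simp add: antisym)
  then have "AE x in N. T (\<lambda>x. f x - g x) x = 0"
    using L2_norm_eq_0_iff[OF bounded_op_L2[OF T L2_diff[OF f g]]] by simp
  with bounded_op_diff[OF T f g] show ?thesis
    by eventually_elim simp
qed

lemma L2_eq_AE_if_inner:
  assumes f: "f \<in> L2 M" and g: "g \<in> L2 M"
    and "\<And>k. k \<in> L2 M \<Longrightarrow> L2_inner M k f = L2_inner M k g"
  shows "AE x in M. f x = g x"
proof -
  let ?d = "\<lambda>x. f x - g x"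
  have d: "?d \<in> L2 M" by (rule L2_diff[OF f g])
  have "L2_inner M ?d ?d = 0"
    using assms(3)[OF d] by (simp add: L2_inner_diff_right[OF f g d])
  then have "L2_norm M ?d = 0" by (simp add: L2_inner_self)
  then show ?thesis using L2_norm_eq_0_iff[OF d] by simp
qed

text \<open>
  The Riesz representation gives the values of the adjoint, and uniqueness of the representing vector makes them
  linear up to null sets.
\<close>
lemma bounded_op_adjoint:
  assumes T: "bounded_op M N T"
  shows "\<exists>W. bounded_op N M W \<and> (\<forall>f\<in>L2 M. \<forall>g\<in>L2 N. L2_inner N (T f) g = L2_inner M f (W g))"
proof -
  note TL2 = bounded_op_L2[OF T]
  obtain C where C: "C > 0" "\<And>f. f \<in> L2 M \<Longrightarrow> L2_norm N (T f) \<le> C * L2_norm M f"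
    using bounded_op_bound[OF T] by blast
  have "\<exists>p. p \<in> L2 M \<and> (\<forall>f\<in>L2 M. L2_inner N (T f) g = L2_inner M f p)" if g: "g \<in> L2 N" for g
  proof (rule L2_Riesz_representation[where l = "\<lambda>f. L2_inner N (T f) g" and M = M and C = "C * L2_norm N g"])
    fix f k a b assume fk: "f \<in> L2 M" "k \<in> L2 M"
    have "L2_inner N (T (\<lambda>x. a * f x + b * k x)) g = L2_inner N (\<lambda>x. a * T f x + b * T k x) g"
      using bounded_op_lincomb[OF T fk]
      by (intro L2_inner_cong_AE) (auto intro!: TL2 L2_lincomb fk g)
    then show "L2_inner N (T (\<lambda>x. a * f x + b * k x)) g = a * L2_inner N (T f) g + b * L2_inner N (T k) g"
      by (simp add: L2_inner_lincomb_left TL2 fk g)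
  next
    fix f assume f: "f \<in> L2 M"
    have "cmod (L2_inner N (T f) g) \<le> L2_norm N (T f) * L2_norm N g"
      by (rule L2_Cauchy_Schwarz[OF TL2[OF f] g])
    also have "\<dots> \<le> (C * L2_norm M f) * L2_norm N g"
      by (intro mult_right_mono C f) simp
    finally show "cmod (L2_inner N (T f) g) \<le> C * L2_norm N g * L2_norm M f"
      by (simp add: mult_ac)
  qed blast
  then obtain W where WL2: "\<And>g. g \<in> L2 N \<Longrightarrow> W g \<in> L2 M"
    and adj: "\<And>f g. f \<in> L2 M \<Longrightarrow> g \<in> L2 N \<Longrightarrow> L2_inner N (T f) g = L2_inner M f (W g)"
    by metis
  have "bounded_op N M W"
    unfolding bounded_op_def
  proof (intro conjI ballI allI exI[of _ C])
    fix g k a b assume gk: "g \<in> L2 N" "k \<in> L2 N"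
    show "AE x in M. W (\<lambda>t. a * g t + b * k t) x = a * W g x + b * W k x"
      by (rule L2_eq_AE_if_inner)
         (auto simp: adj[symmetric] L2_inner_lincomb_right WL2 gk TL2 L2_lincomb intro!: WL2 L2_lincomb gk)
  next
    fix g assume g: "g \<in> L2 N"
    have "(L2_norm M (W g))\<^sup>2 = cmod (L2_inner N (T (W g)) g)"
      by (simp add: adj WL2 g L2_inner_self norm_power)
    also have "\<dots> \<le> L2_norm N (T (W g)) * L2_norm N g"
      by (intro L2_Cauchy_Schwarz TL2 WL2 g)
    also have "\<dots> \<le> (C * L2_norm M (W g)) * L2_norm N g"
      by (intro mult_right_mono C WL2 g) simp
    finally have *: "L2_norm M (W g) * L2_norm M (W g) \<le> L2_norm M (W g) * (C * L2_norm N g)"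
      by (simp add: power2_eq_square mult_ac)
    show "L2_norm M (W g) \<le> C * L2_norm N g"
    proof (cases "L2_norm M (W g) = 0")
      case True
      then show ?thesis using C(1) by simp
    next
      case False
      then have "L2_norm M (W g) > 0" using L2_norm_nonneg[of M "W g"] by linarith
      with * show ?thesis by simp
    qed
  qed (rule WL2)
  then show ?thesis using adj by blast
qed

text \<open>
  The positive and the negative part of \<open>q\<close> are densities of two finite measures that agree on all half-lines.
  Being finite, they coincide, and finiteness again allows to compare their densities, even if \<open>M\<close> is not
  \<open>\<sigma>\<close>-finite.
\<close>
lemma real_AE_zero_if_halfline_integrals_zero:
  fixes q :: "real \<Rightarrow> real"
  assumes sets: "sets M = sets borel" and q: "integrable M q"
    and zero: "\<And>a. (LINT x|M. indicator {a<..} x * q x) = 0"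
  shows "AE x in M. q x = 0"
proof -
  have space: "space M = UNIV" using sets_eq_imp_space_eq[OF sets] by simp
  have half [measurable]: "{a<..} \<in> sets M" for a by (simp add: sets)
  note [measurable] = borel_measurable_integrable[OF q]
  have pos: "integrable M (\<lambda>x. max 0 (q x))" "integrable M (\<lambda>x. max 0 (- q x))" using q by auto
  have ind: "integrable M (\<lambda>x. indicator {a<..} x * r x)" if "integrable M r" for r :: "real \<Rightarrow> real" and a
    using integrable_mult_indicator[OF half that] by simp
  have em: "emeasure (density M (\<lambda>x. ennreal (max 0 (r x)))) {a<..} = ennreal (LINT x|M. indicator {a<..} x * max 0 (r x))"
    if r: "integrable M r" for r :: "real \<Rightarrow> real" and a
  proof -
    note [measurable] = borel_measurable_integrable[OF r]
    have "emeasure (density M (\<lambda>x. ennreal (max 0 (r x)))) {a<..}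
        = (\<integral>\<^sup>+x. ennreal (indicator {a<..} x * max 0 (r x)) \<partial>M)"
      by (subst emeasure_density) (auto intro!: nn_integral_cong split: split_indicator)
    also have "\<dots> = ennreal (LINT x|M. indicator {a<..} x * max 0 (r x))"
      using r by (intro nn_integral_eq_integral ind) auto
    finally show ?thesis .
  qed
  have "density M (\<lambda>x. ennreal (max 0 (q x))) = density M (\<lambda>x. ennreal (max 0 (- q x)))"
  proof (rule measure_eqI_lessThan)
    fix a
    have "(LINT x|M. indicator {a<..} x * max 0 (q x)) - (LINT x|M. indicator {a<..} x * max 0 (- q x))
       = (LINT x|M. indicator {a<..} x * max 0 (q x) - indicator {a<..} x * max 0 (- q x))"
      using pos by (intro Bochner_Integration.integral_diff[symmetric])
        (auto intro!: ind)
    also have "\<dots> = (LINT x|M. indicator {a<..} x * q x)"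
      by (intro Bochner_Integration.integral_cong) (auto simp: max_def)
    also have "\<dots> = 0" by (rule zero)
    finally show "emeasure (density M (\<lambda>x. ennreal (max 0 (q x)))) {a<..} = emeasure (density M (\<lambda>x. ennreal (max 0 (- q x)))) {a<..}"
      using q by (simp add: em)
    show "emeasure (density M (\<lambda>x. ennreal (max 0 (q x)))) {a<..} < \<infinity>"
      using q by (simp add: em)
  qed (simp_all add: sets)
  then have "AE x in M. ennreal (max 0 (q x)) = ennreal (max 0 (- q x))"
    using pos by (subst finite_density_unique[symmetric]) (auto simp: nn_integral_eq_integral)
  then show ?thesis by eventually_elim (auto simp: max_def split: if_splits)
qed

lemma AE_zero_if_halfline_integrals_zero:
  fixes p :: "real \<Rightarrow> complex"
  assumes sets: "sets M = sets borel" and p: "integrable M p"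
    and zero: "\<And>a. (LINT x|M. indicator {a<..} x * p x) = 0"
  shows "AE x in M. p x = 0"
proof -
  have half: "{a<..} \<in> sets M" for a by (simp add: sets)
  have int: "integrable M (\<lambda>x. indicator {a<..} x * p x)" for a
    using integrable_mult_indicator[OF half p, of a]
    by (rule Bochner_Integration.integrable_cong[THEN iffD1, rotated -1]) (auto split: split_indicator)
  have "AE x in M. Re (p x) = 0"
  proof (rule real_AE_zero_if_halfline_integrals_zero[OF sets])
    fix a
    have "(LINT x|M. indicator {a<..} x * Re (p x)) = (LINT x|M. Re (indicator {a<..} x * p x))"
      by (intro Bochner_Integration.integral_cong) (auto split: split_indicator)
    also have "\<dots> = Re (LINT x|M. indicator {a<..} x * p x)" using int by (rule integral_Re)
    finally show "(LINT x|M. indicator {a<..} x * Re (p x)) = 0" using zero[of a] by simp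
  qed (use p in simp)
  moreover have "AE x in M. Im (p x) = 0"
  proof (rule real_AE_zero_if_halfline_integrals_zero[OF sets])
    fix a
    have "(LINT x|M. indicator {a<..} x * Im (p x)) = (LINT x|M. Im (indicator {a<..} x * p x))"
      by (intro Bochner_Integration.integral_cong) (auto split: split_indicator)
    also have "\<dots> = Im (LINT x|M. indicator {a<..} x * p x)" using int by (rule integral_Im)
    finally show "(LINT x|M. indicator {a<..} x * Im (p x)) = 0" using zero[of a] by simp
  qed (use p in simp)
  ultimately show ?thesis by eventually_elim (simp add: complex_eq_iff)
qed

lemma integrable_mult_bounded_real:
  fixes p :: "real \<Rightarrow> complex"
  assumes p: "integrable M p" and [measurable]: "r \<in> borel_measurable M" and "\<And>x. \<bar>r x\<bar> \<le> B"
  shows "integrable M (\<lambda>x. of_real (r x) * p x)"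
proof (rule Bochner_Integration.integrable_bound[OF integrable_mult_right[OF integrable_norm[OF p], of B]])
  show "AE x in M. norm (of_real (r x) * p x) \<le> norm (B * norm (p x))"
  proof (rule AE_I2)
    fix x
    have "\<bar>r x\<bar> * norm (p x) \<le> \<bar>B\<bar> * norm (p x)" using assms(3)[of x] by (intro mult_right_mono) auto
    then show "norm (of_real (r x) * p x) \<le> norm (B * norm (p x))" by (simp add: norm_mult abs_mult)
  qed
qed (use borel_measurable_integrable[OF p] in measurable)

lemma abs_shifted_kernel_le: "\<bar>(s - a) / (s\<^sup>2 + 1)\<bar> \<le> 1 + \<bar>a\<bar>" for a s :: real
proof -
  have "\<bar>s\<bar> \<le> s\<^sup>2 + 1" using sum_squares_bound[of "\<bar>s\<bar>" 1] by simp
  moreover have "\<bar>a\<bar> * 1 \<le> \<bar>a\<bar> * (s\<^sup>2 + 1)" by (intro mult_left_mono) auto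
  ultimately have "\<bar>s - a\<bar> \<le> (1 + \<bar>a\<bar>) * (s\<^sup>2 + 1)" by (simp add: distrib_right)
  moreover have "s\<^sup>2 + 1 > 0" by (simp add: add_nonneg_pos)
  ultimately show ?thesis by (simp add: abs_divide field_simps)
qed

text \<open>
  The bounded function \<open>u(s) = (s - a) / (s\<^sup>2 + 1)\<close> is positive exactly on \<open>{a<..}\<close>. By Weierstrass
  approximation the vanishing of the integrals of \<open>u\<^sup>n p\<close> extends to \<open>k(u) p\<close> for continuous \<open>k\<close>, and
  suitable \<open>k\<close> converge to the indicator of the positive half-line, so that \<open>p\<close> has integral \<open>0\<close> over
  \<open>{a<..}\<close>.
\<close>
lemma AE_zero_if_moments_zero:
  fixes p :: "real \<Rightarrow> complex"
  assumes sets: "sets M = sets borel" and p: "integrable M p"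
    and zero: "\<And>a n. (LINT s|M. of_real (((s - a) / (s\<^sup>2 + 1)) ^ n) * p s) = 0"
  shows "AE x in M. p x = 0"
proof (rule AE_zero_if_halfline_integrals_zero[OF sets p])
  fix a :: real
  have [measurable]: "(\<lambda>x. x) \<in> M \<rightarrow>\<^sub>M borel" by (simp add: measurable_def sets sets_eq_imp_space_eq[OF sets])
  note [measurable] = borel_measurable_integrable[OF p]
  define u where "u s = (s - a) / (s\<^sup>2 + 1)" for s :: real
  have [measurable]: "u \<in> borel_measurable M" unfolding u_def by measurable
  define B where "B = 1 + \<bar>a\<bar>"
  have uB: "\<bar>u s\<bar> \<le> B" for s unfolding u_def B_def by (rule abs_shifted_kernel_le)
  have cont: "(LINT s|M. of_real (k (u s)) * p s) = 0" if k: "continuous_on UNIV k" for k :: "real \<Rightarrow> real"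
  proof -
    have km [measurable]: "k \<in> borel_measurable borel" by (rule borel_measurable_continuous_onI[OF k])
    have "compact (k ` {-B..B})" by (intro compact_continuous_image continuous_on_subset[OF k]) auto
    then have "bounded (k ` {-B..B})" by (rule compact_imp_bounded)
    then obtain K where K: "\<And>y. y \<in> {-B..B} \<Longrightarrow> \<bar>k y\<bar> \<le> K" unfolding bounded_iff by fastforce
    have kint: "integrable M (\<lambda>s. of_real (k (u s)) * p s)"
      by (rule integrable_mult_bounded_real[OF p _ K]) (use uB in \<open>auto simp: abs_le_iff minus_le_iff\<close>)
    have "norm (LINT s|M. of_real (k (u s)) * p s) \<le> e * (LINT s|M. norm (p s))" if e: "e > 0" for e
    proof -
      obtain g where g: "real_polynomial_function g" and close: "\<And>y. y \<in> {-B..B} \<Longrightarrow> \<bar>k y - g y\<bar> < e"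
        using Stone_Weierstrass_real_polynomial_function[OF compact_Icc continuous_on_subset[OF k subset_UNIV] e]
        by blast
      obtain c d where gs: "g = (\<lambda>x. \<Sum>i\<le>d. c i * x ^ i)" using g by (auto simp: real_polynomial_function_iff_sum)
      have uint: "integrable M (\<lambda>s. of_real (u s ^ i) * p s)" for i
        by (rule integrable_mult_bounded_real[OF p, of _ "B ^ i"]) (use uB in \<open>auto simp: power_abs intro!: power_mono\<close>)
      have geq: "of_real (g (u s)) * p s = (\<Sum>i\<le>d. of_real (c i) * (of_real (u s ^ i) * p s))" for s
        by (simp add: gs sum_distrib_right mult.assoc)
      have gint: "integrable M (\<lambda>s. of_real (g (u s)) * p s)"
        unfolding geq by (intro Bochner_Integration.integrable_sum integrable_mult_right uint)
      have "(LINT s|M. of_real (g (u s)) * p s) = 0"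
        unfolding geq using uint zero[of a]
        by (subst Bochner_Integration.integral_sum) (auto simp: u_def intro!: sum.neutral)
      then have "(LINT s|M. of_real (k (u s)) * p s) = (LINT s|M. of_real (k (u s)) * p s - of_real (g (u s)) * p s)"
        using kint gint by simp
      also have "norm \<dots> \<le> (LINT s|M. norm (of_real (k (u s)) * p s - of_real (g (u s)) * p s))" by simp
      also have "\<dots> \<le> (LINT s|M. e * norm (p s))"
      proof (rule integral_mono)
        fix s
        have "\<bar>k (u s) - g (u s)\<bar> \<le> e"
          using close[of "u s"] uB[of s] by (auto simp: abs_le_iff minus_le_iff less_imp_le)
        then have "\<bar>k (u s) - g (u s)\<bar> * norm (p s) \<le> e * norm (p s)" by (intro mult_right_mono) auto
        moreover have "of_real (k (u s)) * p s - of_real (g (u s)) * p s = of_real (k (u s) - g (u s)) * p s"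
          by (simp add: algebra_simps)
        ultimately show "norm (of_real (k (u s)) * p s - of_real (g (u s)) * p s) \<le> e * norm (p s)"
          by (simp only: norm_mult norm_of_real)
      qed (use kint gint p in auto)
      also have "\<dots> = e * (LINT s|M. norm (p s))" by simp
      finally show ?thesis .
    qed
    then have "norm (LINT s|M. of_real (k (u s)) * p s) \<le> 0 * (LINT s|M. norm (p s))"
      by (intro tendsto_lowerbound[where F = "at_right 0" and f = "\<lambda>e. e * (LINT s|M. norm (p s))"] tendsto_intros)
         (auto simp: eventually_at_right_field intro!: exI[of _ 1])
    then show ?thesis by simp
  qed
  define k where "k n y = min 1 (real n * max 0 y)" for n y
  have [measurable]: "k n \<in> borel_measurable borel" for n unfolding k_def by measurable
  have "(\<lambda>n. LINT s|M. of_real (k n (u s)) * p s) \<longlonglongrightarrow> (LINT s|M. indicator {a<..} s * p s)"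
  proof (rule integral_dominated_convergence[where w = "\<lambda>s. norm (p s)"])
    show "AE s in M. (\<lambda>n. of_real (k n (u s)) * p s) \<longlonglongrightarrow> indicator {a<..} s * p s"
    proof (intro AE_I2 tendsto_mult tendsto_const)
      fix s
      show "(\<lambda>n. of_real (k n (u s)) :: complex) \<longlonglongrightarrow> indicator {a<..} s"
      proof (cases "s > a")
        case True
        then have "u s > 0" unfolding u_def by (intro divide_pos_pos) (auto simp: add_nonneg_pos)
        then obtain m :: nat where m: "1 < real m * u s" using reals_Archimedean3 by blast
        have "k n (u s) = 1" if "n \<ge> m" for n
        proof -
          have "real m * u s \<le> real n * u s" using that \<open>u s > 0\<close> by (intro mult_right_mono) auto
          with m have "1 \<le> real n * u s" by linarith
          with \<open>u s > 0\<close> show ?thesis by (simp add: k_def)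
        qed
        then have "\<forall>\<^sub>F n in sequentially. of_real (k n (u s)) = (indicator {a<..} s :: complex)"
          using True by (auto simp: eventually_sequentially intro!: exI[of _ m])
        then show ?thesis by (rule tendsto_eventually)
      next
        case False
        then have "u s \<le> 0" unfolding u_def by (intro divide_nonpos_pos) (auto simp: add_nonneg_pos)
        then show ?thesis using False by (simp add: k_def)
      qed
    qed
    show "AE s in M. norm (of_real (k n (u s)) * p s) \<le> norm (p s)" for n
      by (intro AE_I2) (auto simp: norm_mult k_def intro!: mult_left_le_one_le)
    show "(\<lambda>s. indicator {a<..} s * p s) \<in> borel_measurable M" by (intro borel_measurable_times borel_measurable_indicator) (auto simp: sets)
  qed (use p in \<open>auto intro!: integrable_norm\<close>)
  moreover have "(LINT s|M. of_real (k n (u s)) * p s) = 0" for n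
    by (rule cont) (auto simp: k_def intro!: continuous_intros)
  ultimately show "(LINT s|M. indicator {a<..} s * p s) = 0" by (simp add: LIMSEQ_const_iff)
qed

section \<open>Operators commuting with multiplication\<close>

lemma borel_id_measurable: "sets M = sets borel \<Longrightarrow> (\<lambda>x. x) \<in> M \<rightarrow>\<^sub>M borel"
  by (simp add: measurable_def sets_eq_imp_space_eq)

text \<open>
  Partial fractions write \<open>(s - a) / (s\<^sup>2 + 1)\<close> as a combination of \<open>1 / (s - \<i>)\<close> and \<open>1 / (s + \<i>)\<close>, so \<open>T\<close>
  commutes with multiplication by its powers. Together with symmetry this says that
  \<open>T g \<sqdot> cnj g0 - g \<sqdot> cnj (T g0)\<close> has vanishing moments, so it vanishes and \<open>T g = w g\<close> with
  \<open>w = T g0 / g0\<close>; the choice \<open>g = g0\<close> shows that \<open>w\<close> is real.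
\<close>
lemma symmetric_commuting_op_is_multiplication:
  assumes sets: "sets N = sets borel"
    and T: "bounded_op N N T"
    and sym: "\<And>f g. f \<in> L2 N \<Longrightarrow> g \<in> L2 N \<Longrightarrow> L2_inner N (T f) g = L2_inner N f (T g)"
    and comm: "\<And>z g. z \<notin> \<real> \<Longrightarrow> g \<in> L2 N \<Longrightarrow>
      AE s in N. T (\<lambda>s. g s / (of_real s - z)) s = T g s / (of_real s - z)"
    and g0: "g0 \<in> L2 N" "AE s in N. g0 s \<noteq> 0"
  obtains w :: "real \<Rightarrow> real" where "w \<in> borel_measurable N"
    "\<And>g. g \<in> L2 N \<Longrightarrow> AE s in N. T g s = of_real (w s) * g s"
proof -
  note id [measurable] = borel_id_measurable[OF sets]
  note TL2 = bounded_op_L2[OF T]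
  define u where "u a s = (s - a) / (s\<^sup>2 + 1)" for a s :: real
  have um [measurable]: "u a \<in> borel_measurable N" for a unfolding u_def by measurable
  have uB: "cmod (of_real (u a s)) \<le> 1 + \<bar>a\<bar>" for a s
    unfolding u_def norm_of_real by (rule abs_shifted_kernel_le)
  have uL2: "(\<lambda>s. of_real (u a s) * g s) \<in> L2 N" if "g \<in> L2 N" for a g
    by (rule L2_mult_bounded[OF that _ uB]) measurable
  have ii: "\<i> \<notin> \<real>" "-\<i> \<notin> \<real>" by (auto simp: complex_is_Real_iff)
  have upf: "of_real (u a s) * x = (1 + a * \<i>) / 2 * (x / (of_real s - \<i>)) + (1 - a * \<i>) / 2 * (x / (of_real s - (- \<i>)))"
    for a s x
  proof -
    have 1: "complex_of_real s - \<i> \<noteq> 0" "complex_of_real s + \<i> \<noteq> 0" by (auto simp: complex_eq_iff)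
    have 2: "(complex_of_real s - \<i>) * (complex_of_real s + \<i>) = of_real (s\<^sup>2 + 1)"
      by (simp add: algebra_simps power2_eq_square)
    have "(1 + a * \<i>) / 2 * (x / (of_real s - \<i>)) + (1 - a * \<i>) / 2 * (x / (of_real s - (- \<i>)))
       = x * ((1 + a * \<i>) * (of_real s + \<i>) + (1 - a * \<i>) * (of_real s - \<i>)) / (2 * ((of_real s - \<i>) * (of_real s + \<i>)))"
    proof -
      have "c / 2 * (x / A) + d / 2 * (x / B) = x * (c * B + d * A) / (2 * (A * B))"
        if "A \<noteq> 0" "B \<noteq> 0" for A B c d :: complex
        using that by (simp add: field_simps)
      from this[OF 1] show ?thesis by simp
    qed
    also have "(1 + a * \<i>) * (of_real s + \<i>) + (1 - a * \<i>) * (of_real s - \<i>) = 2 * of_real (s - a)"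
      by (simp add: algebra_simps)
    also have "x * (2 * d) / (2 * S) = d / S * x" for d S :: complex by simp
    finally show ?thesis by (simp only: 2 u_def of_real_divide)
  qed
  have resL2: "(\<lambda>s. g s / (of_real s - z)) \<in> L2 N" if "g \<in> L2 N" "Im z = 1 \<or> Im z = -1" for g z
  proof (rule L2_dominated[OF that(1), of _ 1])
    note [measurable] = L2_measurable[OF that(1)]
    show "(\<lambda>s. g s / (complex_of_real s - z)) \<in> borel_measurable N" by measurable
    have "cmod (of_real s - z) \<ge> 1" for s using abs_Im_le_cmod[of "of_real s - z"] that(2) by auto
    then have "cmod (g s) / cmod (of_real s - z) \<le> cmod (g s) / 1" for s
      by (intro divide_left_mono mult_pos_pos less_le_trans[OF zero_less_one]) auto
    then show "AE s in N. cmod (g s / (of_real s - z)) \<le> 1 * cmod (g s)" by (simp add: norm_divide)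
  qed
  have commu: "AE s in N. T (\<lambda>s. of_real (u a s) * g s) s = of_real (u a s) * T g s" if g: "g \<in> L2 N" for a g
  proof -
    have r: "(\<lambda>s. g s / (of_real s - \<i>)) \<in> L2 N" "(\<lambda>s. g s / (of_real s - (- \<i>))) \<in> L2 N"
      by (rule resL2[OF g], simp)+
    from bounded_op_lincomb[OF T r, of "(1 + a * \<i>) / 2" "(1 - a * \<i>) / 2"]
      comm[OF ii(1) g] comm[OF ii(2) g]
    show ?thesis unfolding upf by eventually_elim (simp only:)
  qed
  have powL2: "(\<lambda>s. of_real (u a s ^ n) * g s) \<in> L2 N" if "g \<in> L2 N" for a n g
    using that by (induction n) (auto dest: uL2 simp: mult.assoc)
  have commn: "AE s in N. T (\<lambda>s. of_real (u a s ^ n) * g s) s = of_real (u a s ^ n) * T g s" if g: "g \<in> L2 N" for a n g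
  proof (induction n)
    case (Suc n)
    from commu[OF powL2[OF g], of a a n] Suc show ?case
      by eventually_elim (simp add: mult.assoc)
  qed simp
  have key: "AE s in N. T g s * cnj (g0 s) = g s * cnj (T g0 s)" if g: "g \<in> L2 N" for g
  proof -
    let ?p = "\<lambda>s. T g s * cnj (g0 s) - g s * cnj (T g0 s)"
    have "AE s in N. ?p s = 0"
    proof (rule AE_zero_if_moments_zero[OF sets])
      show "integrable N ?p" by (intro Bochner_Integration.integrable_diff L2_inner_integrable TL2 g g0)
      fix a n
      have "L2_inner N (\<lambda>s. of_real (u a s ^ n) * T g s) g0 = L2_inner N (T (\<lambda>s. of_real (u a s ^ n) * g s)) g0"
        using commn[OF g, of a n] by (intro L2_inner_cong_AE) (auto intro!: TL2 powL2 g g0 simp del: of_real_power)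
      also have "\<dots> = L2_inner N (\<lambda>s. of_real (u a s ^ n) * g s) (T g0)"
        by (rule sym[OF powL2[OF g] g0(1)])
      finally have "(LINT s|N. of_real (u a s ^ n) * T g s * cnj (g0 s)) - (LINT s|N. of_real (u a s ^ n) * g s * cnj (T g0 s)) = 0"
        by (simp add: L2_inner_def)
      then have "(LINT s|N. of_real (u a s ^ n) * T g s * cnj (g0 s) - of_real (u a s ^ n) * g s * cnj (T g0 s)) = 0"
        by (subst Bochner_Integration.integral_diff) (auto intro!: L2_inner_integrable TL2 powL2 g g0 simp del: of_real_power)
      then show "(LINT s|N. of_real (((s - a) / (s\<^sup>2 + 1)) ^ n) * ?p s) = 0"
        by (simp add: u_def algebra_simps)
    qed
    then show ?thesis by simp
  qed
  define w where "w s = Re (T g0 s / g0 s)" for s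
  note [measurable] = L2_measurable[OF g0(1)] L2_measurable[OF TL2[OF g0(1)]]
  show ?thesis
  proof (rule that)
    show "w \<in> borel_measurable N" unfolding w_def by measurable
    fix g assume g: "g \<in> L2 N"
    show "AE s in N. T g s = of_real (w s) * g s"
      using key[OF g] key[OF g0(1)] g0(2)
    proof eventually_elim
      case (elim s)
      have "T g0 s / g0 s = cnj (T g0 s / g0 s)"
        using elim(2,3) by (simp add: field_simps)
      then have "Im (T g0 s / g0 s) = 0" by (metis complex_cnj_cancel_iff cnj.simps(2) equal_neg_zero neg_equal_zero)
      moreover have "cnj y = of_real (Re y)" if "Im y = 0" for y using that by (simp add: complex_eq_iff)
      ultimately have "cnj (T g0 s / g0 s) = of_real (w s)" unfolding w_def by blast
      moreover have "T g s = g s * cnj (T g0 s / g0 s)" using elim(1,3) by (simp add: field_simps)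
      ultimately show ?case by simp
    qed
  qed
qed

lemma L2_indicator:
  assumes "f \<in> L2 M" "B \<in> sets M"
  shows "(\<lambda>x. indicator B x * f x) \<in> L2 M"
  by (rule L2_mult_bounded[OF assms(1), of _ 1]) (use assms(2) in \<open>auto split: split_indicator\<close>)

text \<open>
  Everything comes from \<open>\<parallel>W k\<parallel>\<^sup>2 = \<integral> w |k|\<^sup>2\<close>, tested on the truncations \<open>k\<close> of the almost everywhere
  nonzero function \<open>T e\<close> to a set \<open>B\<close>. If \<open>w \<le> 0\<close> on \<open>B\<close> then \<open>W k = 0\<close>, so \<open>k\<close> is orthogonal to \<open>T e\<close> and
  \<open>B\<close> is null; if \<open>w > D\<^sup>2 + 1\<close> on \<open>B\<close>, where \<open>D\<close> is a bound for \<open>W\<close>, the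
  inequality \<open>\<parallel>W k\<parallel> \<le> D \<parallel>k\<parallel>\<close> forces \<open>B\<close> to be null.
\<close>
lemma weight_positive_bounded:
  assumes T: "bounded_op M N T" and W: "bounded_op N M W"
    and adj: "\<forall>f\<in>L2 M. \<forall>g\<in>L2 N. L2_inner N (T f) g = L2_inner M f (W g)"
    and w [measurable]: "w \<in> borel_measurable N"
    and TW: "\<forall>g\<in>L2 N. AE s in N. T (W g) s = of_real (w s) * g s"
    and e: "e \<in> L2 M" "AE s in N. T e s \<noteq> 0"
  shows "AE s in N. w s > 0" and "\<exists>C. AE s in N. w s \<le> C"
proof -
  note TL2 = bounded_op_L2[OF T] and WL2 = bounded_op_L2[OF W]
  note adj = adj[rule_format] and TW = TW[rule_format]
  let ?g = "T e"
  have g: "?g \<in> L2 N" by (rule TL2[OF e(1)])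
  note [measurable] = L2_measurable[OF g]
  have norm_W: "(L2_norm M (W k))\<^sup>2 = (LINT s|N. w s * (cmod (k s))\<^sup>2)" 
    and int_W: "integrable N (\<lambda>s. w s * (cmod (k s))\<^sup>2)" if k: "k \<in> L2 N" for k
  proof -
    note [measurable] = L2_measurable[OF k]
    have AE: "AE s in N. T (W k) s * cnj (k s) = of_real (w s * (cmod (k s))\<^sup>2)"
      using TW[OF k] by eventually_elim (simp add: complex_norm_square mult.assoc del: of_real_power)
    have i: "integrable N (\<lambda>s. T (W k) s * cnj (k s))" by (intro L2_inner_integrable TL2 WL2 k)
    have "integrable N (\<lambda>s. complex_of_real (w s * (cmod (k s))\<^sup>2))"
      by (rule integrable_cong_AE_imp[OF i]) (use AE in auto)
    then show "integrable N (\<lambda>s. w s * (cmod (k s))\<^sup>2)" by (simp only: complex_of_real_integrable_eq)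
    have "complex_of_real ((L2_norm M (W k))\<^sup>2) = L2_inner N (T (W k)) k"
      by (simp add: adj WL2 k L2_inner_self)
    also have "\<dots> = (LINT s|N. complex_of_real (w s * (cmod (k s))\<^sup>2))"
      unfolding L2_inner_def by (rule integral_cong_AE) (use AE i in auto)
    also have "\<dots> = complex_of_real (LINT s|N. w s * (cmod (k s))\<^sup>2)"
      by (rule integral_complex_of_real)
    finally show "(L2_norm M (W k))\<^sup>2 = (LINT s|N. w s * (cmod (k s))\<^sup>2)" by (simp only: of_real_eq_iff)
  qed
  have null: "AE s in N. s \<notin> B" if B: "B \<in> sets N" and le: "(LINT s|N. indicator B s * (cmod (?g s))\<^sup>2) \<le> 0" for B
  proof -
    have int: "integrable N (\<lambda>s. indicator B s * (cmod (?g s))\<^sup>2)"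
      using integrable_mult_indicator[OF B L2_integrable[OF g]] by simp
    have "(LINT s|N. indicator B s * (cmod (?g s))\<^sup>2) = 0"
      by (rule antisym[OF le]) (auto intro!: integral_nonneg_AE)
    then have "AE s in N. indicator B s * (cmod (?g s))\<^sup>2 = 0"
      by (subst (asm) integral_nonneg_eq_0_iff_AE[OF int]) auto
    with e(2) show ?thesis by eventually_elim (auto split: split_indicator_asm)
  qed
  have sq: "(cmod (indicator B s * x))\<^sup>2 = indicator B s * (cmod x)\<^sup>2" for B :: "real set" and s x
    by (auto split: split_indicator)
  let ?B = "{s \<in> space N. w s \<le> 0}"
  have B [measurable]: "?B \<in> sets N" by measurable
  have gB: "(\<lambda>s. indicator ?B s * ?g s) \<in> L2 N" by (rule L2_indicator[OF g B])
  have "(L2_norm M (W (\<lambda>s. indicator ?B s * ?g s)))\<^sup>2 \<le> 0"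
  proof -
    have "0 \<le> (LINT s|N. - (w s * (indicator ?B s * (cmod (?g s))\<^sup>2)))"
      by (intro integral_nonneg_AE AE_I2) (auto split: split_indicator intro!: mult_nonpos_nonneg)
    then show ?thesis unfolding norm_W[OF gB] sq by simp
  qed
  then have "L2_norm M (W (\<lambda>s. indicator ?B s * ?g s)) = 0" by simp
  then have "L2_inner M e (W (\<lambda>s. indicator ?B s * ?g s)) = 0"
    using L2_Cauchy_Schwarz[OF e(1) WL2[OF gB]] by simp
  then have "L2_inner N ?g (\<lambda>s. indicator ?B s * ?g s) = 0" by (simp only: adj[OF e(1) gB])
  also have "L2_inner N ?g (\<lambda>s. indicator ?B s * ?g s) = (LINT s|N. complex_of_real (indicator ?B s * (cmod (?g s))\<^sup>2))"
    unfolding L2_inner_def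
    by (intro Bochner_Integration.integral_cong) (auto split: split_indicator simp: complex_norm_square simp del: of_real_power)
  also have "\<dots> = of_real (LINT s|N. indicator ?B s * (cmod (?g s))\<^sup>2)" by (rule integral_complex_of_real)
  finally have "AE s in N. s \<notin> ?B" by (intro null B) simp
  with AE_space show "AE s in N. w s > 0" by eventually_elim auto
  obtain D where D: "D > 0" "\<And>k. k \<in> L2 N \<Longrightarrow> L2_norm M (W k) \<le> D * L2_norm N k"
    using bounded_op_bound[OF W] by blast
  let ?E = "{s \<in> space N. w s > D\<^sup>2 + 1}"
  have E [measurable]: "?E \<in> sets N" by measurable
  have gE: "(\<lambda>s. indicator ?E s * ?g s) \<in> L2 N" by (rule L2_indicator[OF g E])
  have intE: "integrable N (\<lambda>s. indicator ?E s * (cmod (?g s))\<^sup>2)"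
    using integrable_mult_indicator[OF E L2_integrable[OF g]] by simp
  have "(LINT s|N. (D\<^sup>2 + 1) * (indicator ?E s * (cmod (?g s))\<^sup>2)) \<le> (LINT s|N. w s * (indicator ?E s * (cmod (?g s))\<^sup>2))"
    using int_W[OF gE] intE unfolding sq
    by (intro integral_mono) (auto split: split_indicator intro!: mult_right_mono)
  also have "\<dots> = (L2_norm M (W (\<lambda>s. indicator ?E s * ?g s)))\<^sup>2" unfolding norm_W[OF gE] sq ..
  also have "\<dots> \<le> (D * L2_norm N (\<lambda>s. indicator ?E s * ?g s))\<^sup>2" by (intro power_mono D gE) simp
  also have "\<dots> = D\<^sup>2 * (LINT s|N. indicator ?E s * (cmod (?g s))\<^sup>2)" by (simp add: power_mult_distrib L2_norm_power2 sq)
  finally have "(D\<^sup>2 + 1) * (LINT s|N. indicator ?E s * (cmod (?g s))\<^sup>2) \<le> D\<^sup>2 * (LINT s|N. indicator ?E s * (cmod (?g s))\<^sup>2)"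
    by (simp only: Bochner_Integration.integral_mult_right_zero)
  then have "(LINT s|N. indicator ?E s * (cmod (?g s))\<^sup>2) \<le> 0" by (simp only: distrib_right)
  then have "AE s in N. s \<notin> ?E" by (intro null E)
  with AE_space have "AE s in N. w s \<le> D\<^sup>2 + 1" by eventually_elim auto
  then show "\<exists>C. AE s in N. w s \<le> C" by blast
qed

section \<open>Normalizing an operator to a unitary one\<close>

lemma L2_norm_triangle_diff:
  assumes "f \<in> L2 M" "g \<in> L2 M"
  shows "L2_norm M (\<lambda>x. f x - g x) \<le> L2_norm M f + L2_norm M g"
proof (rule power2_le_imp_le)
  have "- Re (L2_inner M f g) \<le> L2_norm M f * L2_norm M g"
    using L2_Cauchy_Schwarz[OF assms] abs_Re_le_cmod[of "L2_inner M f g"] by linarith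
  then show "(L2_norm M (\<lambda>x. f x - g x))\<^sup>2 \<le> (L2_norm M f + L2_norm M g)\<^sup>2"
    unfolding L2_norm_power2_diff[OF assms] by (simp add: power2_sum)
qed simp

lemma L2_tendsto_imp_Cauchy:
  assumes f: "\<And>n. f n \<in> L2 M" and g: "g \<in> L2 M"
    and lim: "(\<lambda>n. L2_norm M (\<lambda>x. f n x - g x)) \<longlonglongrightarrow> 0" and "e > 0"
  shows "\<exists>N. \<forall>m\<ge>N. \<forall>n\<ge>N. L2_norm M (\<lambda>x. f m x - f n x) < e"
proof -
  obtain N where N: "\<And>n. n \<ge> N \<Longrightarrow> L2_norm M (\<lambda>x. f n x - g x) < e / 2"
    using LIMSEQ_D[OF lim, of "e / 2"] \<open>e > 0\<close> by auto
  have "L2_norm M (\<lambda>x. f m x - f n x) < e" if "m \<ge> N" "n \<ge> N" for m n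
    using L2_norm_triangle_diff[OF L2_diff[OF f[of m] g] L2_diff[OF f[of n] g]] N[OF that(1)] N[OF that(2)]
    by simp
  then show ?thesis by blast
qed

lemma L2_inner_tendsto_right:
  assumes "\<And>n. f n \<in> L2 M" "g \<in> L2 M" "k \<in> L2 M"
    and lim: "(\<lambda>n. L2_norm M (\<lambda>x. f n x - g x)) \<longlonglongrightarrow> 0"
  shows "(\<lambda>n. L2_inner M k (f n)) \<longlonglongrightarrow> L2_inner M k g"
  by (subst (1 2) L2_inner_commute) (intro tendsto_cnj L2_inner_tendsto assms)

text \<open>
  This is the polar decomposition of \<open>T\<close> when \<open>T T\<^sup>*\<close> is multiplication by \<open>w > 0\<close>. Formally \<open>U = w\<^sup>-\<^sup>1\<^sup>/\<^sup>2 T\<close>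
  has the isometric right inverse \<open>W w\<^sup>-\<^sup>1\<^sup>/\<^sup>2\<close>. As \<open>w\<^sup>-\<^sup>1\<^sup>/\<^sup>2\<close> is unbounded, the functions are cut off to
  the sets \<open>B n\<close> on which \<open>w > 1 / (n + 1)\<close>: a Bessel inequality and Fatou's lemma show that \<open>U f\<close> lies in \<open>L\<^sup>2\<close>, and
  the cut off preimages of \<open>k\<close> form a Cauchy sequence, whose limit \<open>f\<close> satisfies \<open>U f = k\<close> and
  \<open>\<langle>e, f\<rangle> = \<langle>U e, k\<rangle>\<close> for all \<open>e\<close>. Injectivity of \<open>T\<close> identifies this preimage of \<open>U f\<close> with \<open>f\<close>, so \<open>U\<close>
  preserves inner products.
\<close>
lemma unitary_op_of_weight:
  assumes T: "bounded_op M N T" and W: "bounded_op N M W"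
    and adj: "\<forall>f\<in>L2 M. \<forall>g\<in>L2 N. L2_inner N (T f) g = L2_inner M f (W g)"
    and w [measurable]: "w \<in> borel_measurable N"
    and TW: "\<forall>g\<in>L2 N. AE s in N. T (W g) s = of_real (w s) * g s"
    and pos: "AE s in N. w s > 0"
    and ker: "trivial_kernel M N T"
  shows "unitary_op M N (\<lambda>f s. of_real (1 / sqrt (w s)) * T f s)"
proof -
  note TL2 = bounded_op_L2[OF T] and WL2 = bounded_op_L2[OF W]
  note adj = adj[rule_format] and TW = TW[rule_format]
  define h where "h s = complex_of_real (1 / sqrt (w s))" for s
  have [measurable]: "h \<in> borel_measurable N" unfolding h_def by measurable
  define B where "B n = {s \<in> space N. w s > 1 / (real n + 1)}" for n
  have [measurable]: "B n \<in> sets N" for n unfolding B_def by measurable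
  have B_pos: "w s > 0 \<and> 1 / w s \<le> real n + 1" if "s \<in> B n" for s n
  proof -
    have "w s > 1 / (real n + 1)" using that by (simp add: B_def)
    moreover have "1 / (real n + 1) > 0" by simp
    ultimately have "w s > 0" by linarith
    with \<open>w s > 1 / (real n + 1)\<close> show ?thesis by (simp add: field_simps)
  qed
  have B_lim: "(\<lambda>n. indicator (B n) s :: complex) \<longlonglongrightarrow> 1" if sN: "s \<in> space N" and ws: "w s > 0" for s
  proof (rule tendsto_eventually)
    obtain m :: nat where m: "inverse (real (Suc m)) < w s" using reals_Archimedean[OF ws] by blast
    have "s \<in> B n" if "n \<ge> m" for n
    proof -
      have "1 / (real n + 1) \<le> inverse (real (Suc m))" using that by (simp add: field_simps)
      with m \<open>s \<in> space N\<close> show ?thesis by (simp add: B_def)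
    qed
    then show "\<forall>\<^sub>F n in sequentially. indicator (B n) s = (1 :: complex)"
      by (auto simp: eventually_sequentially intro!: exI[of _ m])
  qed
  have isoW: "L2_norm M (W g) = L2_norm N k"
    if g: "g \<in> L2 N" and k: "k \<in> L2 N" and gk: "AE s in N. k s = of_real (sqrt (w s)) * g s" for g k
  proof -
    note [measurable] = L2_measurable[OF g] L2_measurable[OF k] L2_measurable[OF TL2[OF WL2[OF g]]]
    have "complex_of_real ((L2_norm M (W g))\<^sup>2) = L2_inner N (T (W g)) g"
      by (simp add: adj WL2 g L2_inner_self)
    also have "\<dots> = L2_inner N k k"
      unfolding L2_inner_def
    proof (rule integral_cong_AE)
      show "AE s in N. T (W g) s * cnj (g s) = k s * cnj (k s)"
        using TW[OF g] gk pos
      proof eventually_elim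
        case (elim s)
        have "complex_of_real (w s) = of_real (sqrt (w s)) * of_real (sqrt (w s))"
          using elim(3) by (simp flip: of_real_mult)
        then show ?case unfolding elim(1,2) by simp
      qed
    qed measurable
    finally have "(L2_norm M (W g))\<^sup>2 = (L2_norm N k)\<^sup>2" by (simp only: L2_inner_self of_real_eq_iff)
    then show ?thesis by (simp add: power2_eq_iff_nonneg)
  qed
  have cutL2: "(\<lambda>s. indicator (B n) s * (h s * k s)) \<in> L2 N" if k: "k \<in> L2 N" for n k
  proof (rule L2_dominated[OF k, of _ "sqrt (real n + 1)"])
    note [measurable] = L2_measurable[OF k]
    show "(\<lambda>s. indicator (B n) s * (h s * k s)) \<in> borel_measurable N" by measurable
    show "AE s in N. cmod (indicator (B n) s * (h s * k s)) \<le> sqrt (real n + 1) * cmod (k s)"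
    proof (rule AE_I2)
      fix s
      show "cmod (indicator (B n) s * (h s * k s)) \<le> sqrt (real n + 1) * cmod (k s)"
      proof (cases "s \<in> B n")
        case True
        then have "sqrt (1 / w s) \<le> sqrt (real n + 1)" "w s > 0" using B_pos[OF True] by auto
        then have "sqrt (1 / w s) * cmod (k s) \<le> sqrt (real n + 1) * cmod (k s)" by (intro mult_right_mono) auto
        then show ?thesis using True \<open>w s > 0\<close> by (simp add: norm_mult norm_divide h_def real_sqrt_divide)
      qed simp
    qed
  qed
  \<comment> \<open>The cut off \<open>x\<close> of \<open>U f\<close> has \<open>\<parallel>x\<parallel>\<^sup>2 = \<langle>f, W g\<rangle>\<close> for a \<open>g\<close> with \<open>\<parallel>W g\<parallel> = \<parallel>x\<parallel>\<close>, whence \<open>\<parallel>x\<parallel> \<le> \<parallel>f\<parallel>\<close>.\<close>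
  have UL2: "(\<lambda>s. h s * T f s) \<in> L2 N" if f: "f \<in> L2 M" for f
  proof (rule L2_I_nn_integral)
    note [measurable] = L2_measurable[OF TL2[OF f]]
    show "(\<lambda>s. h s * T f s) \<in> borel_measurable N" by measurable
    let ?x = "\<lambda>n s. indicator (B n) s * (h s * T f s)"
    have x: "?x n \<in> L2 N" for n by (rule cutL2[OF TL2[OF f]])
    have x_le: "L2_norm N (?x n) \<le> L2_norm M f" for n
    proof -
      let ?g = "\<lambda>s. indicator (B n) s * (h s * (indicator (B n) s * (h s * T f s)))"
      have g: "?g \<in> L2 N" by (rule cutL2[OF x])
      have Wg: "L2_norm M (W ?g) = L2_norm N (?x n)"
      proof (rule isoW[OF g x])
        show "AE s in N. ?x n s = of_real (sqrt (w s)) * ?g s"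
          using pos by eventually_elim (auto simp: h_def split: split_indicator)
      qed
      have "of_real ((L2_norm N (?x n))\<^sup>2) = L2_inner N (?x n) (?x n)" by (simp only: L2_inner_self)
      also have "\<dots> = L2_inner N (T f) ?g"
        unfolding L2_inner_def by (intro Bochner_Integration.integral_cong) (auto simp: h_def split: split_indicator)
      also have "\<dots> = L2_inner M f (W ?g)" by (rule adj[OF f g])
      finally have "cmod (of_real ((L2_norm N (?x n))\<^sup>2)) = cmod (L2_inner M f (W ?g))" by simp
      also have "\<dots> \<le> L2_norm M f * L2_norm N (?x n)"
        using L2_Cauchy_Schwarz[OF f WL2[OF g]] by (simp only: Wg)
      finally have *: "L2_norm N (?x n) * L2_norm N (?x n) \<le> L2_norm M f * L2_norm N (?x n)"
        by (simp only: norm_of_real abs_power2 power2_eq_square)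
      show ?thesis
      proof (cases "L2_norm N (?x n) = 0")
        case False
        then have "L2_norm N (?x n) > 0" using L2_norm_nonneg[of N "?x n"] by linarith
        with * show ?thesis by simp
      next
        case True
        show ?thesis unfolding True by simp
      qed
    qed
    have "(\<integral>\<^sup>+s. ennreal ((cmod (h s * T f s))\<^sup>2) \<partial>N) = (\<integral>\<^sup>+s. liminf (\<lambda>n. ennreal ((cmod (?x n s))\<^sup>2)) \<partial>N)"
    proof (rule nn_integral_cong_AE)
      show "AE s in N. ennreal ((cmod (h s * T f s))\<^sup>2) = liminf (\<lambda>n. ennreal ((cmod (?x n s))\<^sup>2))"
        using pos AE_space
      proof eventually_elim
        case (elim s)
        have "(\<lambda>n. ennreal ((cmod (?x n s))\<^sup>2)) \<longlonglongrightarrow> ennreal ((cmod (1 * (h s * T f s)))\<^sup>2)"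
          by (intro tendsto_intros B_lim elim)
        then show ?case by (intro lim_imp_Liminf[symmetric]) auto
      qed
    qed
    also have "\<dots> \<le> liminf (\<lambda>n. \<integral>\<^sup>+s. ennreal ((cmod (?x n s))\<^sup>2) \<partial>N)"
      by (intro nn_integral_liminf) measurable
    also have "\<dots> \<le> limsup (\<lambda>n. \<integral>\<^sup>+s. ennreal ((cmod (?x n s))\<^sup>2) \<partial>N)"
      by (rule Liminf_le_Limsup) simp
    also have "\<dots> \<le> ennreal ((L2_norm M f)\<^sup>2)"
      by (intro Limsup_bounded always_eventually allI)
         (auto simp only: nn_integral_L2[OF x] intro!: ennreal_leI power_mono x_le L2_norm_nonneg)
    finally show "(\<integral>\<^sup>+s. ennreal ((cmod (h s * T f s))\<^sup>2) \<partial>N) \<le> ennreal ((L2_norm M f)\<^sup>2)" .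
  qed simp
  have preimage: "\<exists>f\<in>L2 M. (AE s in N. T f s = of_real (sqrt (w s)) * k s)
      \<and> (\<forall>e\<in>L2 M. L2_inner M e f = L2_inner N (\<lambda>s. h s * T e s) k)" if k: "k \<in> L2 N" for k
  proof -
    note [measurable] = L2_measurable[OF k]
    define x where "x n s = indicator (B n) s * k s" for n s
    define g where "g n s = indicator (B n) s * (h s * k s)" for n s
    have x: "x n \<in> L2 N" for n unfolding x_def by (rule L2_indicator[OF k]) measurable
    have g: "g n \<in> L2 N" for n unfolding g_def by (rule cutL2[OF k])
    have xg: "AE s in N. x n s = of_real (sqrt (w s)) * g n s" for n
      using pos by eventually_elim (auto simp: x_def g_def h_def split: split_indicator)
    have xlim_AE: "AE s in N. (\<lambda>n. x n s) \<longlonglongrightarrow> k s"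
      using pos AE_space
    proof eventually_elim
      case (elim s)
      have "(\<lambda>n. x n s) \<longlonglongrightarrow> 1 * k s" unfolding x_def by (intro tendsto_intros B_lim elim)
      then show ?case by simp
    qed
    have xlim: "(\<lambda>n. L2_norm N (\<lambda>s. x n s - k s)) \<longlonglongrightarrow> 0"
    proof (rule L2_dominated_convergence[OF L2_measurable[OF x] _ k xlim_AE])
      show "AE s in N. cmod (x n s - k s) \<le> cmod (k s)" for n
        by (intro AE_I2) (auto simp: x_def split: split_indicator)
    qed measurable
    \<comment> \<open>As \<open>x n\<close> is \<open>\<surd>w g n\<close>, distances between the \<open>x n\<close> are distances between the \<open>W (g n)\<close>.\<close>
    have Wdiff: "L2_norm M (\<lambda>t. W (g m) t - W (g n) t) = L2_norm N (\<lambda>s. x m s - x n s)" for m n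
    proof -
      have "L2_norm M (\<lambda>t. W (g m) t - W (g n) t) = L2_norm M (W (\<lambda>s. g m s - g n s))"
        using bounded_op_diff[OF W g g, of m n]
        by (intro L2_norm_cong_AE) (auto intro!: WL2 L2_diff g)
      also have "\<dots> = L2_norm N (\<lambda>s. x m s - x n s)"
      proof (intro isoW L2_diff g x)
        show "AE s in N. x m s - x n s = of_real (sqrt (w s)) * (g m s - g n s)"
          using xg[of m] xg[of n] by eventually_elim (simp add: algebra_simps)
      qed
      finally show ?thesis .
    qed
    have Cauchy: "\<exists>K. \<forall>m\<ge>K. \<forall>n\<ge>K. L2_norm M (\<lambda>t. W (g m) t - W (g n) t) < e" if "e > 0" for e
      unfolding Wdiff by (rule L2_tendsto_imp_Cauchy[OF x k xlim that])
    obtain f where f: "f \<in> L2 M" and flim: "(\<lambda>n. L2_norm M (\<lambda>t. W (g n) t - f t)) \<longlonglongrightarrow> 0"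
      using L2_complete[of "\<lambda>n. W (g n)" M, OF WL2[OF g] Cauchy] by blast
    have "AE s in N. T f s = of_real (sqrt (w s)) * k s"
    proof (rule L2_limit_unique_AE[OF _ TL2[OF f] bounded_op_tendsto[OF T WL2[OF g] f flim]])
      have "AE s in N. \<forall>n. T (W (g n)) s = of_real (sqrt (w s)) * x n s"
      proof (subst AE_all_countable, rule allI)
        fix n
        show "AE s in N. T (W (g n)) s = of_real (sqrt (w s)) * x n s"
          using TW[OF g[of n]] xg[of n] pos
        proof eventually_elim
          case (elim s)
          have "complex_of_real (w s) = of_real (sqrt (w s)) * of_real (sqrt (w s))"
            using elim(3) by (simp flip: of_real_mult)
          then show ?case unfolding elim(1,2) by simp
        qed
      qed
      with xlim_AE show "AE s in N. (\<lambda>n. T (W (g n)) s) \<longlonglongrightarrow> of_real (sqrt (w s)) * k s"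
        by eventually_elim (auto intro!: tendsto_intros)
    qed (intro TL2 WL2 g)
    moreover have "L2_inner M e f = L2_inner N (\<lambda>s. h s * T e s) k" if e: "e \<in> L2 M" for e
    proof -
      have "(\<lambda>n. L2_inner M e (W (g n))) \<longlonglongrightarrow> L2_inner M e f"
        by (rule L2_inner_tendsto_right[OF WL2[OF g] f e flim])
      moreover have "L2_inner M e (W (g n)) = L2_inner N (\<lambda>s. h s * T e s) (x n)" for n
        unfolding adj[OF e g, symmetric]
        unfolding L2_inner_def
        by (intro Bochner_Integration.integral_cong) (auto simp: g_def x_def h_def)
      moreover have "(\<lambda>n. L2_inner N (\<lambda>s. h s * T e s) (x n)) \<longlonglongrightarrow> L2_inner N (\<lambda>s. h s * T e s) k"
        by (rule L2_inner_tendsto_right[OF x k UL2[OF e] xlim])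
      ultimately show ?thesis using LIMSEQ_unique by force
    qed
    ultimately show ?thesis using f by blast
  qed
  have inner: "L2_inner N (\<lambda>s. h s * T e s) (\<lambda>s. h s * T f s) = L2_inner M e f"
    if e: "e \<in> L2 M" and f: "f \<in> L2 M" for e f
  proof -
    obtain f' where f': "f' \<in> L2 M" "AE s in N. T f' s = of_real (sqrt (w s)) * (h s * T f s)"
      "L2_inner M e f' = L2_inner N (\<lambda>s. h s * T e s) (\<lambda>s. h s * T f s)"
      using preimage[OF UL2[OF f]] e by blast
    have "AE s in N. T (\<lambda>t. f' t - f t) s = 0"
      using f'(2) bounded_op_diff[OF T f'(1) f] pos
      by eventually_elim (auto simp: h_def)
    then have "AE t in M. f' t - f t = 0"
      using ker L2_diff[OF f'(1) f] unfolding trivial_kernel_def by blast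
    then have "L2_inner M e f' = L2_inner M e f"
      by (intro L2_inner_cong_AE e f f') auto
    then show ?thesis using f'(3) by simp
  qed
  show ?thesis unfolding unitary_op_def h_def[symmetric]
  proof (intro conjI ballI)
    show "bounded_op M N (\<lambda>f s. h s * T f s)"
      unfolding bounded_op_def
    proof (intro conjI ballI allI exI[of _ 1])
      fix f g a b assume fg: "f \<in> L2 M" "g \<in> L2 M"
      show "AE s in N. h s * T (\<lambda>t. a * f t + b * g t) s = a * (h s * T f s) + b * (h s * T g s)"
        using bounded_op_lincomb[OF T fg, of a b] by eventually_elim (simp add: algebra_simps)
    next
      fix f assume f: "f \<in> L2 M"
      have "(L2_norm N (\<lambda>s. h s * T f s))\<^sup>2 = (L2_norm M f)\<^sup>2"
        using inner[OF f f] by (simp only: L2_inner_self of_real_eq_iff)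
      then show "L2_norm N (\<lambda>s. h s * T f s) \<le> 1 * L2_norm M f"
        by (simp add: power2_eq_iff_nonneg)
    qed (rule UL2)
    show "L2_inner N (\<lambda>s. h s * T f s) (\<lambda>s. h s * T g s) = L2_inner M f g" if "f \<in> L2 M" "g \<in> L2 M" for f g
      by (rule inner[OF that])
    show "\<exists>f\<in>L2 M. AE s in N. h s * T f s = k s" if k: "k \<in> L2 N" for k
    proof -
      obtain f where f: "f \<in> L2 M" "AE s in N. T f s = of_real (sqrt (w s)) * k s"
        using preimage[OF k] by blast
      have "AE s in N. h s * T f s = k s"
        using f(2) pos by eventually_elim (auto simp: h_def)
      with f(1) show ?thesis by blast
    qed
  qed
qed

text \<open>
  Multiplication by \<open>h\<close> identifies \<open>L\<^sup>2(|h|\<^sup>2 N)\<close> with \<open>L\<^sup>2(N)\<close>; as \<open>h\<close> vanishes only on a null set, both measures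
  have the same null sets.
\<close>
lemma unitary_op_density:
  assumes U: "unitary_op M N (\<lambda>f s. h s * T f s)"
    and T: "\<And>f. f \<in> L2 M \<Longrightarrow> T f \<in> borel_measurable N"
    and h [measurable]: "h \<in> borel_measurable N" and h0: "AE s in N. h s \<noteq> 0"
  shows "unitary_op M (density N (\<lambda>s. ennreal ((cmod (h s))\<^sup>2))) T" (is "unitary_op M ?D T")
proof -
  have AE_D: "(AE s in ?D. P s) \<longleftrightarrow> (AE s in N. P s)" for P
  proof -
    have "(AE s in ?D. P s) \<longleftrightarrow> (AE s in N. h s \<noteq> 0 \<longrightarrow> P s)" by (subst AE_density) auto
    also have "\<dots> \<longleftrightarrow> (AE s in N. P s)"
    proof
      assume "AE s in N. h s \<noteq> 0 \<longrightarrow> P s"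
      with h0 show "AE s in N. P s" by eventually_elim simp
    qed auto
    finally show ?thesis .
  qed
  have L2_D: "f \<in> L2 ?D \<longleftrightarrow> (\<lambda>s. h s * f s) \<in> L2 N" if f [measurable]: "f \<in> borel_measurable N" for f
  proof -
    have "integrable ?D (\<lambda>s. (cmod (f s))\<^sup>2) \<longleftrightarrow> integrable N (\<lambda>s. (cmod (h s))\<^sup>2 *\<^sub>R (cmod (f s))\<^sup>2)"
      by (rule integrable_density) auto
    then show ?thesis using f by (simp add: L2_def norm_mult power_mult_distrib)
  qed
  have inner_D: "L2_inner ?D f g = L2_inner N (\<lambda>s. h s * f s) (\<lambda>s. h s * g s)"
    if [measurable]: "f \<in> borel_measurable N" "g \<in> borel_measurable N" for f g
  proof -
    have "L2_inner ?D f g = (LINT s|N. (cmod (h s))\<^sup>2 *\<^sub>R (f s * cnj (g s)))"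
      unfolding L2_inner_def by (rule integral_density) auto
    also have "\<dots> = L2_inner N (\<lambda>s. h s * f s) (\<lambda>s. h s * g s)"
      unfolding L2_inner_def
      by (intro Bochner_Integration.integral_cong refl)
         (simp add: scaleR_conv_of_real complex_norm_square mult_ac del: of_real_power)
    finally show ?thesis .
  qed
  have norm_D: "L2_norm ?D f = L2_norm N (\<lambda>s. h s * f s)" if "f \<in> borel_measurable N" for f
  proof -
    have "(L2_norm ?D f)\<^sup>2 = (L2_norm N (\<lambda>s. h s * f s))\<^sup>2"
      using inner_D[OF that that] by (simp only: L2_inner_self of_real_eq_iff)
    then show ?thesis by (simp add: power2_eq_iff_nonneg)
  qed
  have Ub: "bounded_op M N (\<lambda>f s. h s * T f s)" using U by (simp add: unitary_op_def)
  show ?thesis unfolding unitary_op_def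
  proof (intro conjI ballI)
    show "bounded_op M ?D T" unfolding bounded_op_def
    proof (intro conjI ballI allI)
      fix f assume "f \<in> L2 M"
      then show "T f \<in> L2 ?D" by (subst L2_D) (auto intro: T bounded_op_L2[OF Ub])
    next
      fix f g a b assume fg: "f \<in> L2 M" "g \<in> L2 M"
      show "AE s in ?D. T (\<lambda>t. a * f t + b * g t) s = a * T f s + b * T g s"
        unfolding AE_D using bounded_op_lincomb[OF Ub fg, of a b] h0
      proof eventually_elim
        case (elim s)
        then have "h s * T (\<lambda>t. a * f t + b * g t) s = h s * (a * T f s + b * T g s)"
          by (simp add: algebra_simps)
        with elim(2) show ?case by simp
      qed
    next
      obtain C where "\<And>f. f \<in> L2 M \<Longrightarrow> L2_norm N (\<lambda>s. h s * T f s) \<le> C * L2_norm M f"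
        using bounded_op_bound[OF Ub] by blast
      then show "\<exists>C. \<forall>f\<in>L2 M. L2_norm ?D (T f) \<le> C * L2_norm M f" using norm_D T by metis
    qed
    show "L2_inner ?D (T f) (T g) = L2_inner M f g" if "f \<in> L2 M" "g \<in> L2 M" for f g
      using U that by (simp add: inner_D T unitary_op_def)
    show "\<exists>f\<in>L2 M. AE s in ?D. T f s = g s" if g: "g \<in> L2 ?D" for g
    proof -
      have "g \<in> borel_measurable N" using L2_measurable[OF g] by simp
      then have "(\<lambda>s. h s * g s) \<in> L2 N" using L2_D g by blast
      moreover have "\<forall>g\<in>L2 N. \<exists>f\<in>L2 M. AE s in N. h s * T f s = g s"
        using U by (simp add: unitary_op_def)
      ultimately obtain f where f: "f \<in> L2 M" "AE s in N. h s * T f s = h s * g s" by auto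
      have "AE s in N. T f s = g s" using f(2) h0 by eventually_elim simp
      with f(1) show ?thesis unfolding AE_D by blast
    qed
  qed
qed

section \<open>Pulling multiplication back along a unitary operator\<close>

lemma unitary_op_bounded: "unitary_op M N U \<Longrightarrow> bounded_op M N U"
  by (simp add: unitary_op_def)

lemma unitary_op_inner:
  "unitary_op M N U \<Longrightarrow> f \<in> L2 M \<Longrightarrow> g \<in> L2 M \<Longrightarrow> L2_inner N (U f) (U g) = L2_inner M f g"
  by (simp add: unitary_op_def)

lemma unitary_op_norm:
  assumes "unitary_op M N U" "f \<in> L2 M"
  shows "L2_norm N (U f) = L2_norm M f"
proof -
  have "(L2_norm N (U f))\<^sup>2 = (L2_norm M f)\<^sup>2"
    using unitary_op_inner[OF assms assms(2)] by (simp only: L2_inner_self of_real_eq_iff)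
  then show ?thesis by (simp add: power2_eq_iff_nonneg)
qed

lemma unitary_op_surj:
  assumes "unitary_op M N U" "k \<in> L2 N"
  obtains f where "f \<in> L2 M" "AE s in N. U f s = k s"
  using assms by (auto simp: unitary_op_def)

lemma unitary_op_norm_diff:
  assumes U: "unitary_op M N U" and f: "f \<in> L2 M" and g: "g \<in> L2 M"
  shows "L2_norm M (\<lambda>x. f x - g x) = L2_norm N (\<lambda>s. U f s - U g s)"
proof -
  note Ub = unitary_op_bounded[OF U]
  have "L2_norm M (\<lambda>x. f x - g x) = L2_norm N (U (\<lambda>x. f x - g x))"
    by (rule unitary_op_norm[OF U L2_diff[OF f g], symmetric])
  also have "\<dots> = L2_norm N (\<lambda>s. U f s - U g s)"
    using bounded_op_diff[OF Ub f g] by (intro L2_norm_cong_AE L2_diff bounded_op_L2[OF Ub] f g)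
  finally show ?thesis .
qed

lemma unitary_op_inj_AE:
  assumes U: "unitary_op M N U" and f: "f \<in> L2 M" and g: "g \<in> L2 M"
    and eq: "AE s in N. U f s = U g s"
  shows "AE x in M. f x = g x"
proof -
  note Ub = unitary_op_bounded[OF U]
  have "L2_norm M (\<lambda>x. f x - g x) = L2_norm N (\<lambda>s. U f s - U g s)"
    by (rule unitary_op_norm_diff[OF U f g])
  also have "\<dots> = 0"
    using eq by (subst L2_norm_eq_0_iff) (auto intro!: L2_diff bounded_op_L2[OF Ub] f g)
  finally show ?thesis by (subst (asm) L2_norm_eq_0_iff) (auto intro!: L2_diff f g)
qed

text \<open>
  The operator \<open>U\<^sup>-\<^sup>1 M\<^sub>s U\<close> with its natural domain; the inverse is avoided by comparing both components in
  \<open>L\<^sup>2(N)\<close>.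
\<close>
definition mult_pullback :: "real measure \<Rightarrow> real measure \<Rightarrow> ((real \<Rightarrow> complex) \<Rightarrow> (real \<Rightarrow> complex)) \<Rightarrow> op_graph" where
  "mult_pullback M N U = {(f, g). f \<in> L2 M \<and> g \<in> L2 M \<and> (AE s in N. U g s = of_real s * U f s)}"

text \<open>
  Functions supported in a bounded window lie in the domain of multiplication by \<open>s\<close>, and every such function is of
  the form \<open>U f\<close>. They are dense, and testing a pair of the adjoint against them, with the truncated
  difference \<open>s U u - U v\<close> itself as test function, shows that the pair lies in the graph.
\<close>
lemma selfadjoint_mult_pullback:
  assumes sets: "sets N = sets borel" and U: "unitary_op M N U"
  shows "selfadjoint M (mult_pullback M N U)"
proof -
  let ?A = "mult_pullback M N U"
  note Ub = unitary_op_bounded[OF U]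
  note UL2 = bounded_op_L2[OF Ub]
  note [measurable] = borel_id_measurable[OF sets]
  have Icc: "{- real n..real n} \<in> sets N" for n by (simp add: sets)
  have AD: "f \<in> L2 M" "g \<in> L2 M" "AE s in N. U g s = of_real s * U f s" if "(f, g) \<in> ?A" for f g
    using that by (auto simp: mult_pullback_def)
  have AI: "(f, g) \<in> ?A" if "f \<in> L2 M" "g \<in> L2 M" "AE s in N. U g s = of_real s * U f s" for f g
    using that by (auto simp: mult_pullback_def)
  \<comment> \<open>The domain contains the preimages of all square integrable functions with bounded support.\<close>
  have window: "\<exists>f g. (f, g) \<in> ?A \<and> (AE s in N. U f s = indicator {- real n..real n} s * k s)
      \<and> (AE s in N. U g s = indicator {- real n..real n} s * (of_real s * k s))"
    if k: "k \<in> borel_measurable N" "(\<lambda>s. indicator {- real n..real n} s * k s) \<in> L2 N" for k n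
  proof -
    note [measurable] = k(1) Icc
    have "(\<lambda>s. indicator {- real n..real n} s * (of_real s * k s)) \<in> L2 N"
      by (rule L2_dominated[OF k(2), of _ "real n"])
         (auto simp: norm_mult split: split_indicator intro!: AE_I2 mult_right_mono)
    then obtain g where g: "g \<in> L2 M" "AE s in N. U g s = indicator {- real n..real n} s * (of_real s * k s)"
      using unitary_op_surj[OF U] by blast
    obtain f where f: "f \<in> L2 M" "AE s in N. U f s = indicator {- real n..real n} s * k s"
      using unitary_op_surj[OF U k(2)] by blast
    have "(f, g) \<in> ?A"
      by (intro AI f g) (use f(2) g(2) in \<open>eventually_elim, simp\<close>)
    then show ?thesis using f(2) g(2) by blast
  qed
  have lin: "linear_graph M ?A"
    unfolding linear_graph_def
  proof (intro conjI)
    show "?A \<subseteq> L2 M \<times> L2 M" by (auto simp: mult_pullback_def)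
    have U0: "AE s in N. U (\<lambda>_. 0) s = 0"
      using bounded_op_lincomb[OF Ub L2_zero L2_zero, of 0 0] by simp
    show "(\<lambda>_. 0, \<lambda>_. 0) \<in> ?A"
      by (intro AI L2_zero) (use U0 in \<open>eventually_elim, simp\<close>)
    show "\<forall>(f, g)\<in>?A. \<forall>(f', g')\<in>?A. \<forall>a b. (\<lambda>t. a * f t + b * f' t, \<lambda>t. a * g t + b * g' t) \<in> ?A"
    proof (clarify)
      fix f g f' g' a b assume A: "(f, g) \<in> ?A" "(f', g') \<in> ?A"
      note fg = AD[OF A(1)] and fg' = AD[OF A(2)]
      show "(\<lambda>t. a * f t + b * f' t, \<lambda>t. a * g t + b * g' t) \<in> ?A"
        by (intro AI L2_lincomb fg fg') (use fg(3) fg'(3) bounded_op_lincomb[OF Ub fg(1) fg'(1), of a b]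
          bounded_op_lincomb[OF Ub fg(2) fg'(2), of a b] in \<open>eventually_elim, simp add: algebra_simps\<close>)
    qed
    have "AE t in M. g t = g' t"
      if A: "(f, g) \<in> ?A" "(f', g') \<in> ?A" and eq: "AE t in M. f t = f' t" for f g f' g'
    proof -
      note fg = AD[OF A(1)] and fg' = AD[OF A(2)]
      have "AE s in N. U g s = U g' s"
        using fg(3) fg'(3) bounded_op_cong_AE[OF Ub fg(1) fg'(1) eq] by eventually_elim simp
      then show ?thesis by (rule unitary_op_inj_AE[OF U fg(2) fg'(2)])
    qed
    then show "\<forall>(f, g)\<in>?A. \<forall>(f', g')\<in>?A. (AE t in M. f t = f' t) \<longrightarrow> (AE t in M. g t = g' t)"
      by blast
    have "(f', g') \<in> ?A"
      if A: "(f, g) \<in> ?A" and L2': "f' \<in> L2 M" "g' \<in> L2 M"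
        and eq: "AE t in M. f' t = f t" "AE t in M. g' t = g t" for f g f' g'
    proof -
      note fg = AD[OF A]
      show ?thesis
        by (intro AI L2') (use fg(3) bounded_op_cong_AE[OF Ub L2'(1) fg(1) eq(1)]
          bounded_op_cong_AE[OF Ub L2'(2) fg(2) eq(2)] in \<open>eventually_elim, simp\<close>)
    qed
    then show "\<forall>(f, g)\<in>?A. \<forall>f'\<in>L2 M. \<forall>g'\<in>L2 M.
        (AE t in M. f' t = f t) \<longrightarrow> (AE t in M. g' t = g t) \<longrightarrow> (f', g') \<in> ?A"
      by blast
  qed
  have dense: "densely_defined M ?A"
    unfolding densely_defined_def
  proof (intro ballI allI impI)
    fix f and e :: real assume f: "f \<in> L2 M" and "e > 0"
    note [measurable] = L2_measurable[OF UL2[OF f]] Icc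
    let ?k = "\<lambda>n s. indicator {- real n..real n} s * U f s"
    have "(\<lambda>n. L2_norm N (\<lambda>s. ?k n s - U f s)) \<longlonglongrightarrow> 0"
    proof (rule L2_dominated_convergence[OF _ _ UL2[OF f]])
      show "AE s in N. (\<lambda>n. ?k n s) \<longlonglongrightarrow> U f s"
      proof (rule AE_I2, rule tendsto_eventually)
        fix s
        obtain m :: nat where m: "\<bar>s\<bar> \<le> real m" using real_arch_simple by blast
        then have "?k n s = U f s" if "n \<ge> m" for n using that by (auto simp: indicator_def abs_le_iff)
        then show "\<forall>\<^sub>F n in sequentially. ?k n s = U f s" by (auto simp: eventually_sequentially)
      qed
      show "AE s in N. cmod (?k n s - U f s) \<le> cmod (U f s)" for n
        by (intro AE_I2) (auto split: split_indicator)
    qed measurable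
    from LIMSEQ_D[OF this \<open>e > 0\<close>] obtain n where n: "L2_norm N (\<lambda>s. ?k n s - U f s) < e" by auto
    have kL2: "?k n \<in> L2 N" by (rule L2_indicator[OF UL2[OF f] Icc])
    obtain p q where pq: "(p, q) \<in> ?A" "AE s in N. U p s = ?k n s"
      using window[OF L2_measurable[OF UL2[OF f]] kL2] by blast
    have p: "p \<in> L2 M" using AD[OF pq(1)] by simp
    have "L2_norm M (\<lambda>t. f t - p t) = L2_norm M (\<lambda>t. p t - f t)"
      by (simp add: L2_norm_def norm_minus_commute)
    also have "\<dots> = L2_norm N (\<lambda>s. U p s - U f s)" by (rule unitary_op_norm_diff[OF U p f])
    also have "\<dots> = L2_norm N (\<lambda>s. ?k n s - U f s)"
      by (intro L2_norm_cong_AE L2_diff UL2 p f kL2) (use pq(2) in \<open>eventually_elim, simp\<close>)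
    finally have "L2_norm M (\<lambda>t. f t - p t) < e" using n by simp
    then show "\<exists>g\<in>Domain ?A. L2_norm M (\<lambda>t. f t - g t) < e"
      by (rule bexI[OF _ DomainI[OF pq(1)]])
  qed
  have adj: "adjoint_graph M ?A = ?A"
  proof (intro equalityI subsetI)
    fix x assume "x \<in> ?A"
    then obtain u v where x: "x = (u, v)" and uv: "(u, v) \<in> ?A" by (cases x) auto
    note uv = AD[OF uv]
    have "L2_inner M g u = L2_inner M f v" if "(f, g) \<in> ?A" for f g
    proof -
      note fg = AD[OF that]
      note [measurable] = L2_measurable[OF UL2[OF fg(1)]] L2_measurable[OF UL2[OF fg(2)]]
        L2_measurable[OF UL2[OF uv(1)]] L2_measurable[OF UL2[OF uv(2)]]
      have "L2_inner N (U g) (U u) = L2_inner N (U f) (U v)"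
        unfolding L2_inner_def
        by (rule integral_cong_AE, measurable) (use fg(3) uv(3) in \<open>eventually_elim, simp\<close>)
      then show ?thesis by (simp add: unitary_op_inner[OF U] fg uv)
    qed
    then show "x \<in> adjoint_graph M ?A" unfolding x adjoint_graph_def using uv by auto
  next
    fix x assume "x \<in> adjoint_graph M ?A"
    moreover obtain u v where x: "x = (u, v)" by (cases x)
    ultimately have u: "u \<in> L2 M" and v: "v \<in> L2 M"
      and all: "\<forall>(f, g)\<in>?A. L2_inner M g u = L2_inner M f v"
      by (simp_all add: adjoint_graph_def)
    have sym: "L2_inner M g u = L2_inner M f v" if "(f, g) \<in> ?A" for f g
      using all that by blast
    note [measurable] = L2_measurable[OF UL2[OF u]] L2_measurable[OF UL2[OF v]] Icc
    define d where "d s = of_real s * U u s - U v s" for s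
    have [measurable]: "d \<in> borel_measurable N" unfolding d_def by measurable
    have "AE s in N. indicator {- real n..real n} s * d s = 0" for n
    proof -
      have suL2: "(\<lambda>s. indicator {- real n..real n} s * (of_real s * U u s)) \<in> L2 N"
        by (rule L2_dominated[OF UL2[OF u], of _ "real n"])
           (auto simp: norm_mult split: split_indicator intro!: AE_I2 mult_right_mono)
      have dL2: "(\<lambda>s. indicator {- real n..real n} s * d s) \<in> L2 N"
        using L2_diff[OF suL2 L2_indicator[OF UL2[OF v] Icc, of n]] by (simp add: d_def algebra_simps)
      let ?d = "\<lambda>s. indicator {- real n..real n} s * d s"
      obtain f g where fg: "(f, g) \<in> ?A" "AE s in N. U f s = ?d s"
          "AE s in N. U g s = indicator {- real n..real n} s * (of_real s * d s)"
        using window[OF _ dL2] by auto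
      note fgL2 = AD[OF fg(1)]
      note [measurable] = L2_measurable[OF UL2[OF fgL2(1)]] L2_measurable[OF UL2[OF fgL2(2)]]
      have eq: "AE s in N. ?d s * cnj (?d s) = U g s * cnj (U u s) - U f s * cnj (U v s)"
        using fg(2,3)
      proof eventually_elim
        case (elim s)
        show ?case unfolding elim
          by (cases "s \<in> {- real n..real n}") (simp_all add: d_def algebra_simps del: atLeastAtMost_iff)
      qed
      have "L2_inner N ?d ?d = (LINT s|N. U g s * cnj (U u s) - U f s * cnj (U v s))"
        unfolding L2_inner_def
        by (rule integral_cong_AE[OF _ _ eq]) measurable
      also have "\<dots> = L2_inner N (U g) (U u) - L2_inner N (U f) (U v)"
        unfolding L2_inner_def
        by (intro Bochner_Integration.integral_diff L2_inner_integrable UL2 fgL2 u v)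
      also have "\<dots> = 0" using sym[OF fg(1)] by (simp add: unitary_op_inner[OF U] fgL2 u v)
      finally have "L2_norm N ?d = 0" by (simp add: L2_inner_self)
      then show ?thesis using L2_norm_eq_0_iff[OF dL2] by simp
    qed
    then have "AE s in N. \<forall>n. indicator {- real n..real n} s * d s = 0" unfolding AE_all_countable by (rule allI)
    then have "AE s in N. U v s = of_real s * U u s"
    proof eventually_elim
      case (elim s)
      obtain m :: nat where "\<bar>s\<bar> \<le> real m" using real_arch_simple by blast
      with elim[rule_format, of m] have "d s = 0" by (auto simp: indicator_def abs_le_iff split: if_splits)
      then show ?case by (simp add: d_def)
    qed
    then show "x \<in> ?A" unfolding x by (intro AI u v)
  qed
  show ?thesis using lin dense adj by (simp add: selfadjoint_def)
qed

lemma resolvent_graphI: "(f, g) \<in> A \<Longrightarrow> (\<lambda>t. g t - z * f t, f) \<in> resolvent_graph A z"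
  unfolding resolvent_graph_def mem_Collect_eq by (rule exI[of _ f], rule exI[of _ g]) simp

lemma resolvent_graphE:
  assumes "(k, f) \<in> resolvent_graph A z"
  obtains g where "(f, g) \<in> A" "k = (\<lambda>t. g t - z * f t)"
  using assms unfolding resolvent_graph_def by (elim CollectE exE conjE) (simp only: prod.inject)

lemma resolvent_graph_mult_pullback:
  assumes sets: "sets N = sets borel" and U: "unitary_op M N U" and z: "z \<notin> \<real>"
    and R: "\<And>f. f \<in> L2 M \<Longrightarrow> R f \<in> L2 M"
    and UR: "\<And>f. f \<in> L2 M \<Longrightarrow> AE s in N. U (R f) s = U f s / (of_real s - z)"
  shows "resolvent_graph (mult_pullback M N U) z = graph_of M M R"
proof (intro equalityI subsetI)
  note Ub = unitary_op_bounded[OF U]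
  have nz: "of_real s - z \<noteq> 0" for s using z by auto
  fix x assume "x \<in> resolvent_graph (mult_pullback M N U) z"
  moreover obtain k f where "x = (k, f)" by (cases x)
  ultimately obtain g where x: "x = (\<lambda>t. g t - z * f t, f)" and "(f, g) \<in> mult_pullback M N U"
    by (auto elim: resolvent_graphE)
  then have f: "f \<in> L2 M" and g: "g \<in> L2 M" and fg: "AE s in N. U g s = of_real s * U f s"
    by (simp_all add: mult_pullback_def)
  have k: "(\<lambda>t. g t - z * f t) \<in> L2 M" by (intro L2_diff L2_scale f g)
  have Uk: "AE s in N. U (\<lambda>t. g t - z * f t) s = U g s - z * U f s"
    using bounded_op_lincomb[OF Ub g f, of 1 "-z"] by simp
  have "AE s in N. U f s = U (R (\<lambda>t. g t - z * f t)) s"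
    using Uk fg UR[OF k]
  proof eventually_elim
    case (elim s)
    have "U g s - z * U f s = (of_real s - z) * U f s" using elim(2) by (simp add: algebra_simps)
    with elim nz[of s] show ?case by simp
  qed
  then have "AE t in M. f t = R (\<lambda>t. g t - z * f t) t" by (rule unitary_op_inj_AE[OF U f R[OF k]])
  then show "x \<in> graph_of M M R" unfolding x graph_of_def using f k by simp
next
  note Ub = unitary_op_bounded[OF U]
  have nz: "of_real s - z \<noteq> 0" for s using z by auto
  fix x assume "x \<in> graph_of M M R"
  then obtain k f where x: "x = (k, f)" and k: "k \<in> L2 M" and f: "f \<in> L2 M" and fk: "AE t in M. f t = R k t"
    by (auto simp: graph_of_def)
  have "AE s in N. U (\<lambda>t. 1 * k t + z * f t) s = of_real s * U f s"
    using bounded_op_lincomb[OF Ub k f, of 1 z] bounded_op_cong_AE[OF Ub f R[OF k] fk] UR[OF k]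
  proof eventually_elim
    case (elim s)
    have "U k s = (of_real s - z) * U f s" using elim(2,3) nz[of s] by simp
    with elim(1) show ?case by (simp add: algebra_simps)
  qed
  then have "(f, \<lambda>t. k t + z * f t) \<in> mult_pullback M N U"
    using L2_lincomb[OF k f, of 1 z] f by (simp add: mult_pullback_def)
  from resolvent_graphI[OF this, of z] show "x \<in> resolvent_graph (mult_pullback M N U) z"
    unfolding x by simp
qed

text \<open>
  The map \<open>(f, g) \<mapsto> (g - z f, f)\<close> is injective on pairs of functions.
\<close>
lemma op_graph_eq_if_resolvent_graph_eq:
  assumes "resolvent_graph A z = resolvent_graph B z"
  shows "A = B"
proof -
  have "(f, g) \<in> B" if eq: "resolvent_graph A z = resolvent_graph B z" and fg: "(f, g) \<in> A" for A B f g
  proof -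
    have "(\<lambda>t. g t - z * f t, f) \<in> resolvent_graph B z"
      using resolvent_graphI[OF fg, of z] by (simp only: eq)
    then obtain g' where g': "(f, g') \<in> B" "(\<lambda>t. g t - z * f t) = (\<lambda>t. g' t - z * f t)"
      by (rule resolvent_graphE)
    have "g' t = g t" for t using fun_cong[OF g'(2), of t] by simp
    then have "g' = g" by (rule ext)
    with g'(1) show ?thesis by simp
  qed
  from this[OF assms] this[OF assms[symmetric]] show ?thesis by (intro equalityI subrelI)
qed

lemma graph_of_mult_pullback:
  assumes U: "unitary_op M N U"
  shows "mult_pullback M N U O graph_of M N U = graph_of M N U O mult_graph N of_real"
proof (intro equalityI subsetI)
  note UL2 = bounded_op_L2[OF unitary_op_bounded[OF U]]
  fix x assume "x \<in> mult_pullback M N U O graph_of M N U"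
  then obtain f g k where x: "x = (f, k)" and f: "f \<in> L2 M" and "g \<in> L2 M" and k: "k \<in> L2 N"
    and "AE s in N. U g s = of_real s * U f s" "AE s in N. k s = U g s"
    by (auto simp: mult_pullback_def graph_of_def)
  then have "AE s in N. k s = of_real s * U f s" by (elim AE_mp) auto
  then have "(U f, k) \<in> mult_graph N of_real" using UL2[OF f] k by (simp add: mult_graph_def)
  moreover have "(f, U f) \<in> graph_of M N U" using f UL2[OF f] by (simp add: graph_of_def)
  ultimately show "x \<in> graph_of M N U O mult_graph N of_real" unfolding x by blast
next
  fix x assume "x \<in> graph_of M N U O mult_graph N of_real"
  then obtain f p k where x: "x = (f, k)" and f: "f \<in> L2 M" and k: "k \<in> L2 N"
    and "AE s in N. p s = U f s" and "AE s in N. k s = of_real s * p s"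
    by (auto simp: mult_graph_def graph_of_def)
  then have kf: "AE s in N. k s = of_real s * U f s" by (elim AE_mp) auto
  obtain g where g: "g \<in> L2 M" "AE s in N. U g s = k s" using unitary_op_surj[OF U k] .
  have "AE s in N. U g s = of_real s * U f s" using g(2) kf by eventually_elim simp
  then have "(f, g) \<in> mult_pullback M N U" using f g(1) by (simp add: mult_pullback_def)
  moreover have "(g, k) \<in> graph_of M N U" using g k by (auto simp: graph_of_def)
  ultimately show "x \<in> mult_pullback M N U O graph_of M N U" unfolding x by blast
qed

section \<open>Test functions and difference quotients\<close>

lemma resolvent_kernel_decay:
  assumes "z \<notin> \<real>"
  shows "cmod (1 / (of_real t - z)) \<le> ((1 + cmod z) / \<bar>Im z\<bar> + 1) / (1 + \<bar>t\<bar>)"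
proof -
  have Im: "\<bar>Im z\<bar> > 0" using assms by (simp add: complex_is_Real_iff)
  let ?d = "cmod (of_real t - z)"
  have d: "?d \<ge> \<bar>Im z\<bar>" using abs_Im_le_cmod[of "of_real t - z"] by simp
  have "1 + \<bar>t\<bar> \<le> (1 + cmod z) + ?d"
    using norm_triangle_sub[of "complex_of_real t" z] by simp
  also have "1 + cmod z \<le> (1 + cmod z) / \<bar>Im z\<bar> * ?d"
  proof -
    have "(1 + cmod z) / \<bar>Im z\<bar> * \<bar>Im z\<bar> \<le> (1 + cmod z) / \<bar>Im z\<bar> * ?d"
      by (rule mult_left_mono[OF d]) simp
    then show ?thesis using Im by simp
  qed
  finally have "1 + \<bar>t\<bar> \<le> ((1 + cmod z) / \<bar>Im z\<bar> + 1) * ?d" by (simp add: algebra_simps)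
  moreover have "?d > 0" using d Im by linarith
  moreover have "1 + \<bar>t\<bar> > 0" by simp
  ultimately have "1 / ?d \<le> ((1 + cmod z) / \<bar>Im z\<bar> + 1) / (1 + \<bar>t\<bar>)"
    by (simp add: pos_divide_le_eq pos_le_divide_eq)
  then show ?thesis by (simp add: norm_divide)
qed

lemma resolvent_kernel_bounded:
  assumes "z \<notin> \<real>"
  shows "cmod (1 / (of_real t - z)) \<le> 1 / \<bar>Im z\<bar>"
proof -
  have Im: "\<bar>Im z\<bar> > 0" using assms by (simp add: complex_is_Real_iff)
  have d: "cmod (of_real t - z) \<ge> \<bar>Im z\<bar>" using abs_Im_le_cmod[of "of_real t - z"] by simp
  with Im have "1 / cmod (of_real t - z) \<le> 1 / \<bar>Im z\<bar>"
    by (intro divide_left_mono mult_pos_pos) (auto intro: less_le_trans)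
  then show ?thesis by (simp add: norm_divide)
qed

lemma nonreal_minus_neq_0: "z \<notin> \<real> \<Longrightarrow> of_real t - z \<noteq> 0"
  by auto

lemma nonreal_cnj: "z \<notin> \<real> \<Longrightarrow> cnj z \<notin> \<real>"
  by (simp add: complex_is_Real_iff)

lemma L2_resolvent_kernel:
  assumes "sets M = sets borel" "z \<notin> \<real>" "f \<in> L2 M"
  shows "(\<lambda>t. f t / (of_real t - z)) \<in> L2 M"
proof -
  note [measurable] = borel_id_measurable[OF assms(1)]
  have "(\<lambda>t. 1 / (of_real t - z) * f t) \<in> L2 M"
    by (rule L2_mult_bounded[OF assms(3) _ resolvent_kernel_bounded[OF assms(2)]]) measurable
  then show ?thesis by simp
qed

lemma C1_resolvent_kernel:
  fixes z :: complex
  assumes "z \<notin> \<real>"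
  shows "(\<lambda>t. 1 / (of_real t - z)) C1_differentiable_on UNIV"
  unfolding C1_differentiable_on_def
proof (intro exI conjI ballI)
  fix t
  have nz: "of_real t - z \<noteq> 0" by (rule nonreal_minus_neq_0[OF assms])
  have "((\<lambda>w. 1 / (w - z)) has_field_derivative (- 1 / (of_real t - z)\<^sup>2)) (at (of_real t))"
    by (rule derivative_eq_intros refl | use nz in \<open>simp add: power2_eq_square field_simps\<close>)+
  then show "((\<lambda>t. 1 / (of_real t - z)) has_vector_derivative (- 1 / (of_real t - z)\<^sup>2)) (at t)"
    by (rule has_vector_derivative_real_field)
next
  show "continuous_on UNIV (\<lambda>t. - 1 / (of_real t - z)\<^sup>2)"
    using nonreal_minus_neq_0[OF assms] by (intro continuous_intros) auto
qed

lemma norm_diff_le_of_vector_derivative_le: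
  fixes f :: "real \<Rightarrow> complex"
  assumes "convex S" "\<And>x. x \<in> S \<Longrightarrow> (f has_vector_derivative D x) (at x)" "\<And>x. x \<in> S \<Longrightarrow> cmod (D x) \<le> B"
    and "s \<in> S" "t \<in> S"
  shows "cmod (f s - f t) \<le> B * \<bar>s - t\<bar>"
proof -
  have "norm (f s - f t) \<le> B * norm (s - t)"
  proof (rule differentiable_bound[OF assms(1) _ _ assms(4,5)])
    show "(f has_derivative (\<lambda>h. h *\<^sub>R D x)) (at x within S)" if "x \<in> S" for x
      using has_vector_derivative_at_within[OF assms(2)[OF that]] by (simp add: has_vector_derivative_def)
    show "onorm (\<lambda>h. h *\<^sub>R D x) \<le> B" if "x \<in> S" for x
      by (rule onorm_le) (use assms(3)[OF that] in \<open>simp add: mult.commute[of B] mult_left_mono\<close>)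
  qed
  then show ?thesis by simp
qed

lemma C1_compact_continuous: "f \<in> C1_compact \<Longrightarrow> continuous_on UNIV f"
  by (simp add: C1_compact_def C1_differentiable_imp_continuous_on)

lemma C1_compact_mult:
  assumes "f \<in> C1_compact" "g C1_differentiable_on UNIV"
  shows "(\<lambda>x. g x * f x) \<in> C1_compact"
proof -
  have "closure {x. g x * f x \<noteq> 0} \<subseteq> closure {x. f x \<noteq> 0}" by (rule closure_mono) auto
  then have "compact (closure {x. g x * f x \<noteq> 0})"
    using assms(1) compact_Int_closed[of "closure {x. f x \<noteq> 0}" "closure {x. g x * f x \<noteq> 0}"]
    by (simp add: C1_compact_def Int_absorb1)
  then show ?thesis using assms by (simp add: C1_compact_def)
qed

lemma C1_compact_bounded:
  assumes "f \<in> C1_compact"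
  obtains R B where "R > 0" "B > 0" "\<And>t. cmod (f t) \<le> B" "\<And>t. \<bar>t\<bar> > R \<Longrightarrow> f t = 0"
proof -
  let ?K = "closure {x. f x \<noteq> 0}"
  have K: "compact ?K" using assms by (simp add: C1_compact_def)
  obtain R where R: "R > 0" "\<And>t. t \<in> ?K \<Longrightarrow> \<bar>t\<bar> \<le> R"
    using compact_imp_bounded[OF K] by (auto simp: bounded_pos)
  have zero: "f t = 0" if "t \<notin> ?K" for t using that closure_subset[of "{x. f x \<noteq> 0}"] by auto
  have "bounded (f ` ?K)"
    by (intro compact_imp_bounded compact_continuous_image[OF continuous_on_subset[OF C1_compact_continuous[OF assms]] K]) simp
  then obtain B where B: "B > 0" "\<And>t. t \<in> ?K \<Longrightarrow> cmod (f t) \<le> B" by (auto simp: bounded_pos)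
  have "cmod (f t) \<le> B" for t using B zero[of t] by (cases "t \<in> ?K") auto
  moreover have "f t = 0" if "\<bar>t\<bar> > R" for t using R(2)[of t] zero[of t] that by fastforce
  ultimately show ?thesis using R(1) B(1) that by blast
qed

lemma C1_compact_decay:
  assumes "f \<in> C1_compact"
  obtains K where "\<And>t. cmod (f t) \<le> K / (1 + \<bar>t\<bar>)"
proof -
  obtain R B where RB: "R > 0" "B > 0" "\<And>t. cmod (f t) \<le> B" "\<And>t. \<bar>t\<bar> > R \<Longrightarrow> f t = 0"
    using C1_compact_bounded[OF assms] by blast
  have "cmod (f t) \<le> B * (1 + R) / (1 + \<bar>t\<bar>)" for t
  proof (cases "\<bar>t\<bar> > R")
    case True
    then show ?thesis using RB by simp
  next
    case False
    have "cmod (f t) * (1 + \<bar>t\<bar>) \<le> B * (1 + R)" using RB False by (intro mult_mono) auto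
    moreover have "1 + \<bar>t\<bar> > 0" by simp
    ultimately show ?thesis by (simp add: pos_le_divide_eq)
  qed
  then show ?thesis by (rule that)
qed

text \<open>
  A function of \<open>t\<close> that is bounded near \<open>s\<close> and decays like a Cauchy kernel away from \<open>s\<close> is dominated by the
  integrable weight \<open>1 / (1 + |t|)\<close>, with a constant that depends only on \<open>A\<close> and \<open>s\<close>. This uniformity is
  what dominated convergence for the cutoffs needs.
\<close>
lemma cauchy_type_decay:
  fixes s t :: real
  assumes "\<bar>s - t\<bar> \<le> 1 \<Longrightarrow> c \<le> A" "\<bar>s - t\<bar> > 1 \<Longrightarrow> c \<le> A / \<bar>s - t\<bar>" "A \<ge> 0"
  shows "c \<le> A * (2 + \<bar>s\<bar>) / (1 + \<bar>t\<bar>)"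
proof -
  have pos: "1 + \<bar>t\<bar> > 0" by simp
  have "c * (1 + \<bar>t\<bar>) \<le> A * (2 + \<bar>s\<bar>)"
  proof (cases "\<bar>s - t\<bar> \<le> 1")
    case True
    have "c * (1 + \<bar>t\<bar>) \<le> A * (1 + \<bar>t\<bar>)" using assms(1)[OF True] by (intro mult_right_mono) auto
    also have "\<dots> \<le> A * (2 + \<bar>s\<bar>)" using True assms(3) by (intro mult_left_mono) auto
    finally show ?thesis .
  next
    case False
    then have st: "\<bar>s - t\<bar> > 1" by simp
    have "\<bar>s\<bar> * 1 \<le> \<bar>s\<bar> * \<bar>s - t\<bar>" using st by (intro mult_left_mono) auto
    moreover have "1 + \<bar>t\<bar> \<le> 1 + \<bar>s\<bar> + \<bar>s - t\<bar>" by simp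
    ultimately have *: "1 + \<bar>t\<bar> \<le> (2 + \<bar>s\<bar>) * \<bar>s - t\<bar>" using st by (simp add: distrib_right)
    have "c * (1 + \<bar>t\<bar>) \<le> A / \<bar>s - t\<bar> * (1 + \<bar>t\<bar>)" using assms(2)[OF st] by (intro mult_right_mono) auto
    also have "\<dots> \<le> A / \<bar>s - t\<bar> * ((2 + \<bar>s\<bar>) * \<bar>s - t\<bar>)" using assms(3) by (intro mult_left_mono *) simp
    also have "\<dots> = A * (2 + \<bar>s\<bar>)" using st by simp
    finally show ?thesis .
  qed
  then show ?thesis using pos by (simp add: pos_le_divide_eq)
qed

lemma C1_vector_derivative:
  "f C1_differentiable_on UNIV \<Longrightarrow> (f has_vector_derivative vector_derivative f (at s)) (at s)"
  by (simp add: C1_differentiable_on_eq vector_derivative_works[symmetric])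

text \<open>
  The Leibniz rule for difference quotients, applied to the factor \<open>t - z\<close> whose own difference quotient is \<open>1\<close>.
\<close>
lemma diff_quotient_mult_affine:
  assumes g: "g C1_differentiable_on UNIV"
  shows "diff_quotient (\<lambda>t. (of_real t - z) * g t) s t = (of_real s - z) * diff_quotient g s t + g t"
proof (cases "s = t")
  case True
  have "((\<lambda>t. (of_real t - z) * g t) has_vector_derivative
      ((of_real s - z) * vector_derivative g (at s) + (1 - 0) * g s)) (at s)"
    by (intro has_vector_derivative_mult C1_vector_derivative[OF g] has_vector_derivative_diff
          has_vector_derivative_const) (auto intro!: derivative_eq_intros)
  from vector_derivative_at[OF this] True show ?thesis by (simp add: diff_quotient_def)
next
  case False
  then have "complex_of_real s - of_real t \<noteq> 0" by simp
  then show ?thesis using False by (simp add: diff_quotient_def field_simps)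
qed

lemma C1_compact_diff_quotient_decay:
  assumes f: "f \<in> C1_compact"
  obtains K where "\<And>t. cmod (diff_quotient f s t) \<le> K / (1 + \<bar>t\<bar>)"
proof -
  have C1: "f C1_differentiable_on UNIV" using f by (simp add: C1_compact_def)
  obtain R B where B: "B > 0" "\<And>t. cmod (f t) \<le> B" using C1_compact_bounded[OF f] by metis
  have "continuous_on {s-1..s+1} (\<lambda>x. vector_derivative f (at x))"
    using C1 continuous_on_subset by (auto simp: C1_differentiable_on_eq)
  then have "bounded ((\<lambda>x. vector_derivative f (at x)) ` {s-1..s+1})"
    by (intro compact_imp_bounded compact_continuous_image) auto
  then obtain D where D: "D > 0" "\<And>x. x \<in> {s-1..s+1} \<Longrightarrow> cmod (vector_derivative f (at x)) \<le> D"
    by (auto simp: bounded_pos)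
  have "cmod (diff_quotient f s t) \<le> (D + 2 * B) * (2 + \<bar>s\<bar>) / (1 + \<bar>t\<bar>)" for t
  proof (rule cauchy_type_decay)
    assume st: "\<bar>s - t\<bar> \<le> 1"
    show "cmod (diff_quotient f s t) \<le> D + 2 * B"
    proof (cases "s = t")
      case True
      then show ?thesis using D(2)[of s] B(1) by (simp add: diff_quotient_def)
    next
      case False
      have "cmod (f s - f t) \<le> D * \<bar>s - t\<bar>"
        by (rule norm_diff_le_of_vector_derivative_le[of "{s-1..s+1}", OF _ C1_vector_derivative[OF C1] D(2)])
           (use st in auto)
      then have "cmod (f s - f t) / \<bar>s - t\<bar> \<le> D" using False by (simp add: divide_le_eq)
      then show ?thesis using False B(1)
        by (simp add: diff_quotient_def norm_divide flip: of_real_diff)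
    qed
  next
    assume st: "\<bar>s - t\<bar> > 1"
    have "cmod (f s - f t) \<le> D + 2 * B" using norm_triangle_ineq4[of "f s" "f t"] B(2)[of s] B(2)[of t] D(1) by linarith
    then have "cmod (f s - f t) / \<bar>s - t\<bar> \<le> (D + 2 * B) / \<bar>s - t\<bar>" by (intro divide_right_mono) auto
    then show "cmod (diff_quotient f s t) \<le> (D + 2 * B) / \<bar>s - t\<bar>"
      using st by (auto simp add: diff_quotient_def norm_divide simp flip: of_real_diff)
  qed (use B D in simp)
  then show ?thesis by (rule that)
qed

lemma DERIV_max_power2: "((\<lambda>y::real. (max 0 y)\<^sup>2) has_real_derivative 2 * max 0 y) (at y)"
proof -
  consider "y > 0" | "y < 0" | "y = 0" by linarith
  then show ?thesis
  proof cases
    case 1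
    have d: "((\<lambda>y::real. y\<^sup>2) has_real_derivative 2 * max 0 y) (at y)"
      using 1 by (auto intro!: derivative_eq_intros)
    have ev: "\<forall>\<^sub>F x in nhds y. (max 0 x)\<^sup>2 = x\<^sup>2"
      using eventually_nhds_in_open[of "{0<..}" y] 1 by (auto elim!: eventually_mono)
    show ?thesis by (rule DERIV_cong_ev[OF refl ev refl, THEN iffD2, OF d])
  next
    case 2
    have d: "((\<lambda>y::real. 0) has_real_derivative 2 * max 0 y) (at y)"
      using 2 by (auto intro!: derivative_eq_intros)
    have ev: "\<forall>\<^sub>F x in nhds y. (max 0 x)\<^sup>2 = 0"
      using eventually_nhds_in_open[of "{..<0}" y] 2 by (auto elim!: eventually_mono)
    show ?thesis by (rule DERIV_cong_ev[OF refl ev refl, THEN iffD2, OF d])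
  next
    case 3
    have "(\<lambda>h::real. (max 0 h)\<^sup>2 / h) \<midarrow>0\<rightarrow> 0"
    proof (rule Lim_null_comparison)
      have "norm ((max 0 h)\<^sup>2 / h) \<le> \<bar>h\<bar>" for h :: real
        by (cases "h > 0") (simp_all add: power2_eq_square max_def)
      then show "\<forall>\<^sub>F h in at 0. norm ((max 0 h)\<^sup>2 / h) \<le> \<bar>h :: real\<bar>"
        by (intro always_eventually allI)
      show "(\<lambda>h::real. \<bar>h\<bar>) \<midarrow>0\<rightarrow> 0" by (rule tendsto_rabs_zero) (rule tendsto_ident_at)
    qed
    then show ?thesis using 3 by (simp add: DERIV_def)
  qed
qed

text \<open>
  The square makes the positive part continuously differentiable. The rescaling makes the Lipschitz constant
  tend to \<open>0\<close>, which is why the integral term of the transform disappears in the limit. The shift by one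
  avoids a division by \<open>0\<close>.
\<close>
definition cutoff :: "nat \<Rightarrow> real \<Rightarrow> complex" where
  "cutoff n t = of_real ((max 0 (1 - (t / (real n + 1))\<^sup>2))\<^sup>2)"

lemma cutoff_has_vector_derivative:
  "(cutoff n has_vector_derivative
     of_real (2 * max 0 (1 - (t / (real n + 1))\<^sup>2) * (- 2 * (t / (real n + 1)) / (real n + 1)))) (at t)"
proof -
  have inner: "((\<lambda>t. 1 - (t / (real n + 1))\<^sup>2) has_real_derivative (- 2 * (t / (real n + 1)) / (real n + 1))) (at t)"
    by (rule derivative_eq_intros refl | simp)+
  have "((\<lambda>t. (max 0 (1 - (t / (real n + 1))\<^sup>2))\<^sup>2) has_real_derivative
      (2 * max 0 (1 - (t / (real n + 1))\<^sup>2) * (- 2 * (t / (real n + 1)) / (real n + 1)))) (at t)"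
    by (rule DERIV_chain2[OF DERIV_max_power2 inner])
  then show ?thesis unfolding cutoff_def by (rule has_vector_derivative_of_real)
qed

lemma cutoff_derivative_bound:
  "\<bar>2 * max 0 (1 - (t / (real n + 1))\<^sup>2) * (- 2 * (t / (real n + 1)) / (real n + 1))\<bar> \<le> 4 / (real n + 1)"
proof -
  let ?x = "t / (real n + 1)"
  have "max 0 (1 - ?x\<^sup>2) * \<bar>?x\<bar> \<le> 1"
  proof (cases "\<bar>?x\<bar> \<le> 1")
    case True
    then have "max 0 (1 - ?x\<^sup>2) * \<bar>?x\<bar> \<le> 1 * 1" by (intro mult_mono) auto
    then show ?thesis by simp
  next
    case False
    then have "?x\<^sup>2 \<ge> 1" using abs_square_le_1[of ?x] by linarith
    then have "max 0 (1 - ?x\<^sup>2) = 0" by simp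
    then show ?thesis by simp
  qed
  then have "4 * (max 0 (1 - ?x\<^sup>2) * \<bar>?x\<bar>) / (real n + 1) \<le> 4 * 1 / (real n + 1)"
    by (intro divide_right_mono mult_left_mono) auto
  moreover have "\<bar>2 * max 0 (1 - ?x\<^sup>2) * (- 2 * ?x / (real n + 1))\<bar> = 4 * (max 0 (1 - ?x\<^sup>2) * \<bar>?x\<bar>) / (real n + 1)"
    by (simp add: abs_mult abs_divide)
  ultimately show ?thesis by simp
qed

lemma cutoff_bounds: "cmod (cutoff n t) \<le> 1" "cmod (cutoff n s - cutoff n t) \<le> 1"
proof -
  have *: "0 \<le> (max 0 (1 - (t / (real n + 1))\<^sup>2))\<^sup>2 \<and> (max 0 (1 - (t / (real n + 1))\<^sup>2))\<^sup>2 \<le> 1" for t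
    by (auto intro!: power_le_one)
  then show "cmod (cutoff n t) \<le> 1" unfolding cutoff_def norm_of_real by (metis abs_of_nonneg)
  show "cmod (cutoff n s - cutoff n t) \<le> 1"
    unfolding cutoff_def norm_of_real of_real_diff[symmetric] using *[of s] *[of t] by linarith
qed

lemma cutoff_Lipschitz: "cmod (cutoff n s - cutoff n t) \<le> 4 / (real n + 1) * \<bar>s - t\<bar>"
  by (rule norm_diff_le_of_vector_derivative_le[of UNIV, OF _ cutoff_has_vector_derivative])
     (simp_all only: convex_UNIV norm_of_real cutoff_derivative_bound UNIV_I)

lemma cutoff_tendsto_1: "(\<lambda>n. cutoff n t) \<longlonglongrightarrow> 1"
proof -
  have "(\<lambda>n. t * inverse (real (Suc n))) \<longlonglongrightarrow> t * 0"
    by (intro tendsto_intros LIMSEQ_inverse_real_of_nat)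
  then have "(\<lambda>n. t / (real n + 1)) \<longlonglongrightarrow> 0" by (simp add: divide_inverse add.commute)
  then have "(\<lambda>n. cutoff n t) \<longlonglongrightarrow> of_real ((max 0 (1 - 0\<^sup>2))\<^sup>2)"
    unfolding cutoff_def by (intro tendsto_intros)
  then show ?thesis by simp
qed

lemma cutoff_nonzero: "\<bar>t\<bar> \<le> real n \<Longrightarrow> cutoff n t \<noteq> 0"
proof -
  assume "\<bar>t\<bar> \<le> real n"
  then have "\<bar>t / (real n + 1)\<bar> < 1" by (simp add: abs_divide)
  then have "(t / (real n + 1))\<^sup>2 < 1" by (simp only: abs_square_less_1)
  then show ?thesis unfolding cutoff_def of_real_eq_0_iff by simp
qed

lemma cutoff_C1_compact: "cutoff n \<in> C1_compact"
proof -
  have "cutoff n C1_differentiable_on UNIV"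
    unfolding C1_differentiable_on_def
    by (rule exI, rule conjI, rule ballI, rule cutoff_has_vector_derivative)
       (intro continuous_intros, auto)
  moreover have "{x. cutoff n x \<noteq> 0} \<subseteq> {- (real n + 1)..real n + 1}"
  proof
    fix x assume "x \<in> {x. cutoff n x \<noteq> 0}"
    then have "(x / (real n + 1))\<^sup>2 < 1" by (auto simp: cutoff_def max_def split: if_splits)
    then have "\<bar>x / (real n + 1)\<bar> < 1" by (simp only: abs_square_less_1)
    then have "\<bar>x\<bar> < real n + 1" by (simp add: abs_divide)
    then show "x \<in> {- (real n + 1)..real n + 1}" by auto
  qed
  then have "bounded {x. cutoff n x \<noteq> 0}" by (rule bounded_subset[OF bounded_closed_interval])
  ultimately show ?thesis by (simp add: C1_compact_def)
qed

lemma diff_quotient_cutoff_bound: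
  "cmod (diff_quotient (cutoff n) s t) \<le> 4 / (real n + 1)"
  "cmod (diff_quotient (cutoff n) s t) \<le> 4 * (2 + \<bar>s\<bar>) / (1 + \<bar>t\<bar>)"
proof -
  show 1: "cmod (diff_quotient (cutoff n) s t) \<le> 4 / (real n + 1)" for t
  proof (cases "s = t")
    case True
    then show ?thesis
      by (simp only: diff_quotient_def if_True simp_thms vector_derivative_at[OF cutoff_has_vector_derivative]
          norm_of_real cutoff_derivative_bound)
  next
    case False
    then have "cmod (cutoff n s - cutoff n t) / \<bar>s - t\<bar> \<le> 4 / (real n + 1)"
      using cutoff_Lipschitz[of n s t] by (simp add: divide_le_eq)
    then show ?thesis using False by (simp add: diff_quotient_def norm_divide flip: of_real_diff)
  qed
  show "cmod (diff_quotient (cutoff n) s t) \<le> 4 * (2 + \<bar>s\<bar>) / (1 + \<bar>t\<bar>)"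
  proof (rule cauchy_type_decay)
    have "4 / (real n + 1) \<le> 4" by (simp add: divide_le_eq)
    with 1[of t] show "cmod (diff_quotient (cutoff n) s t) \<le> 4" by linarith
    assume st: "\<bar>s - t\<bar> > 1"
    have "cmod (cutoff n s - cutoff n t) \<le> 4" using cutoff_bounds(2)[of n s t] by linarith
    then have "cmod (cutoff n s - cutoff n t) / \<bar>s - t\<bar> \<le> 4 / \<bar>s - t\<bar>" by (intro divide_right_mono) auto
    then show "cmod (diff_quotient (cutoff n) s t) \<le> 4 / \<bar>s - t\<bar>"
      using st by (auto simp add: diff_quotient_def norm_divide simp flip: of_real_diff)
  qed simp
qed

section \<open>The perturbed resolvent and its intertwining by the transform\<close>

locale form_bounded_measure =
  fixes \<mu> :: "real measure"
  assumes mu_borel: "sets \<mu> = sets borel"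
    and mu_integral: "(\<integral>\<^sup>+ t. ennreal (1 / (1 + \<bar>t\<bar>)) \<partial>\<mu>) < \<infinity>"
begin

lemma measurable_id [measurable]: "(\<lambda>x. x) \<in> \<mu> \<rightarrow>\<^sub>M borel"
  by (rule borel_id_measurable[OF mu_borel])

lemma integrable_weight: "integrable \<mu> (\<lambda>t. 1 / (1 + \<bar>t\<bar>))"
  by (rule integrableI_nonneg) (use mu_integral in auto)

lemma integrable_decay:
  fixes f :: "real \<Rightarrow> complex"
  assumes "f \<in> borel_measurable \<mu>" "\<And>t. cmod (f t) \<le> K / (1 + \<bar>t\<bar>)"
  shows "integrable \<mu> f"
  using integrable_mult_right[OF integrable_weight, of K] assms(1)
proof (rule Bochner_Integration.integrable_bound)
  show "AE t in \<mu>. norm (f t) \<le> norm (K * (1 / (1 + \<bar>t\<bar>)))"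
  proof (rule AE_I2)
    fix t
    have "cmod (f t) \<le> K / (1 + \<bar>t\<bar>)" by (rule assms(2))
    also have "\<dots> \<le> \<bar>K / (1 + \<bar>t\<bar>)\<bar>" by (rule abs_ge_self)
    finally show "norm (f t) \<le> norm (K * (1 / (1 + \<bar>t\<bar>)))" by simp
  qed
qed

lemma L2_decay:
  assumes f: "f \<in> borel_measurable \<mu>" and le: "\<And>t. cmod (f t) \<le> K / (1 + \<bar>t\<bar>)"
  shows "f \<in> L2 \<mu>"
  unfolding L2_def
proof (safe intro!: f)
  note [measurable] = f
  show "integrable \<mu> (\<lambda>t. (cmod (f t))\<^sup>2)"
  proof (rule Bochner_Integration.integrable_bound[OF integrable_mult_right[OF integrable_weight, of "K\<^sup>2"]])
    show "AE t in \<mu>. norm ((cmod (f t))\<^sup>2) \<le> norm (K\<^sup>2 * (1 / (1 + \<bar>t\<bar>)))"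
    proof (rule AE_I2)
      fix t :: real
      have "(cmod (f t))\<^sup>2 \<le> (K / (1 + \<bar>t\<bar>))\<^sup>2" by (intro power_mono le) simp
      also have "\<dots> = K\<^sup>2 * (1 / (1 + \<bar>t\<bar>)) * (1 / (1 + \<bar>t\<bar>))" by (simp add: power2_eq_square)
      also have "\<dots> \<le> K\<^sup>2 * (1 / (1 + \<bar>t\<bar>)) * 1" by (intro mult_left_mono) auto
      finally show "norm ((cmod (f t))\<^sup>2) \<le> norm (K\<^sup>2 * (1 / (1 + \<bar>t\<bar>)))" by simp
    qed
  qed measurable
qed

lemma C1_compact_measurable: "f \<in> C1_compact \<Longrightarrow> f \<in> borel_measurable \<mu>"
  using borel_measurable_continuous_onI[OF C1_compact_continuous, of f]
  by (simp add: measurable_cong_sets[OF mu_borel refl])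

lemma C1_compact_integrable: "f \<in> C1_compact \<Longrightarrow> integrable \<mu> f"
  by (metis C1_compact_decay C1_compact_measurable integrable_decay)

lemma C1_compact_L2: "f \<in> C1_compact \<Longrightarrow> f \<in> L2 \<mu>"
  by (metis C1_compact_decay C1_compact_measurable L2_decay)

lemma diff_quotient_measurable:
  assumes [measurable]: "f \<in> borel_measurable \<mu>"
  shows "diff_quotient f s \<in> borel_measurable \<mu>"
proof -
  have "{t \<in> space \<mu>. s = t} = {s}" using sets_eq_imp_space_eq[OF mu_borel] by auto
  then have "{t \<in> space \<mu>. s = t} \<in> sets \<mu>" by (simp add: mu_borel)
  then show ?thesis unfolding diff_quotient_def by (intro measurable_If) measurable
qed

lemma diff_quotient_integrable: "f \<in> C1_compact \<Longrightarrow> integrable \<mu> (diff_quotient f s)"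
  by (metis C1_compact_diff_quotient_decay C1_compact_measurable diff_quotient_measurable integrable_decay)

lemma kernel_L2: "z \<notin> \<real> \<Longrightarrow> (\<lambda>t. 1 / (of_real t - z)) \<in> L2 \<mu>"
  by (rule L2_decay[OF _ resolvent_kernel_decay]) measurable

lemma kernel_integrable: "z \<notin> \<real> \<Longrightarrow> integrable \<mu> (\<lambda>t. 1 / (of_real t - z))" for z :: complex
  by (rule integrable_decay[OF _ resolvent_kernel_decay]) measurable

text \<open>
  Density of the test functions, in dual form. Continuously differentiable functions
  \<open>1 - exp (- n ((t - a)\<^sub>+)\<^sup>2)\<close> increase to the indicator of \<open>{a<..}\<close>; multiplied by a cutoff they are test functions, so
  the integral of \<open>cutoff \<sqdot> cnj d\<close> over every half-line vanishes.
\<close>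
lemma AE_zero_if_orthogonal_C1_compact:
  assumes d: "d \<in> L2 \<mu>" and orth: "\<And>f. f \<in> C1_compact \<Longrightarrow> L2_inner \<mu> f d = 0"
  shows "AE t in \<mu>. d t = 0"
proof -
  note [measurable] = L2_measurable[OF d] C1_compact_measurable[OF cutoff_C1_compact]
  have "AE t in \<mu>. cutoff m t * cnj (d t) = 0" for m
  proof (rule AE_zero_if_halfline_integrals_zero[OF mu_borel])
    show p: "integrable \<mu> (\<lambda>t. cutoff m t * cnj (d t))"
      by (rule L2_inner_integrable[OF C1_compact_L2[OF cutoff_C1_compact] d])
    fix a
    define k where "k n t = 1 - exp (- (real n * (max 0 (t - a))\<^sup>2))" for n t
    have k_nonneg: "0 \<le> k n t" and k_le: "k n t \<le> 1" for n t by (simp_all add: k_def)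
    have [measurable]: "k n \<in> borel_measurable borel" for n unfolding k_def by measurable
    have kC1: "(\<lambda>t. complex_of_real (k n t)) C1_differentiable_on UNIV" for n
      unfolding C1_differentiable_on_def
    proof (intro exI conjI ballI)
      fix t
      have inner: "((\<lambda>t. t - a) has_real_derivative 1) (at t)" by (auto intro!: derivative_eq_intros)
      have outer: "((\<lambda>y. 1 - exp (- (real n * y))) has_real_derivative exp (- (real n * y)) * real n) (at y)" for y
        by (auto intro!: derivative_eq_intros)
      have "(k n has_real_derivative (exp (- (real n * (max 0 (t - a))\<^sup>2)) * real n) * (2 * max 0 (t - a) * 1)) (at t)"
        unfolding k_def by (rule DERIV_chain2[OF outer DERIV_chain2[OF DERIV_max_power2 inner]])
      then show "((\<lambda>t. complex_of_real (k n t)) has_vector_derivative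
          of_real ((exp (- (real n * (max 0 (t - a))\<^sup>2)) * real n) * (2 * max 0 (t - a) * 1))) (at t)"
        by (rule has_vector_derivative_of_real)
    qed (intro continuous_intros)
    have "(\<lambda>n. LINT t|\<mu>. of_real (k n t) * (cutoff m t * cnj (d t)))
        \<longlonglongrightarrow> (LINT t|\<mu>. indicator {a<..} t * (cutoff m t * cnj (d t)))"
    proof (rule integral_dominated_convergence[where w = "\<lambda>t. norm (cutoff m t * cnj (d t))"])
      show "AE t in \<mu>. (\<lambda>n. of_real (k n t) * (cutoff m t * cnj (d t))) \<longlonglongrightarrow> indicator {a<..} t * (cutoff m t * cnj (d t))"
      proof (intro AE_I2 tendsto_mult tendsto_const)
        fix t
        show "(\<lambda>n. complex_of_real (k n t)) \<longlonglongrightarrow> indicator {a<..} t"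
        proof (cases "t > a")
          case True
          then have q: "0 \<le> exp (- ((max 0 (t - a))\<^sup>2))" "exp (- ((max 0 (t - a))\<^sup>2)) < 1" by auto
          have "(\<lambda>n. exp (- ((max 0 (t - a))\<^sup>2)) ^ n) \<longlonglongrightarrow> 0" by (rule LIMSEQ_realpow_zero[OF q])
          then have "(\<lambda>n. 1 - exp (- (real n * (max 0 (t - a))\<^sup>2))) \<longlonglongrightarrow> 1 - 0"
            by (intro tendsto_intros) (simp add: exp_of_nat_mult[symmetric])
          then have "(\<lambda>n. complex_of_real (k n t)) \<longlonglongrightarrow> of_real (1 - 0)"
            unfolding k_def by (rule tendsto_of_real)
          then show ?thesis using True by simp
        next
          case False
          then show ?thesis by (simp add: k_def max_def)
        qed
      qed
      show "AE t in \<mu>. norm (of_real (k n t) * (cutoff m t * cnj (d t))) \<le> norm (cutoff m t * cnj (d t))" for n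
      proof (rule AE_I2)
        fix t
        have "\<bar>k n t\<bar> * norm (cutoff m t * cnj (d t)) \<le> 1 * norm (cutoff m t * cnj (d t))"
          using k_nonneg[of n t] k_le[of n t] by (intro mult_right_mono) auto
        then show "norm (of_real (k n t) * (cutoff m t * cnj (d t))) \<le> norm (cutoff m t * cnj (d t))"
          by (simp only: norm_mult norm_of_real mult_1_left)
      qed
      show "(\<lambda>t. indicator {a<..} t * (cutoff m t * cnj (d t))) \<in> borel_measurable \<mu>"
        by (intro borel_measurable_times borel_measurable_indicator borel_measurable_integrable[OF p]) (simp add: mu_borel)
      show "integrable \<mu> (\<lambda>t. norm (cutoff m t * cnj (d t)))" by (rule integrable_norm[OF p])
    qed measurable
    moreover have "(LINT t|\<mu>. of_real (k n t) * (cutoff m t * cnj (d t))) = 0" for n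
      using orth[OF C1_compact_mult[OF cutoff_C1_compact kC1], of n m] by (simp add: L2_inner_def mult.assoc)
    ultimately show "(LINT t|\<mu>. indicator {a<..} t * (cutoff m t * cnj (d t))) = 0" by (simp add: LIMSEQ_const_iff)
  qed
  then have "AE t in \<mu>. \<forall>m. cutoff m t * cnj (d t) = 0" unfolding AE_all_countable by (rule allI)
  then show ?thesis
  proof eventually_elim
    case (elim t)
    obtain m :: nat where "\<bar>t\<bar> \<le> real m" using real_arch_simple by blast
    then have "cutoff m t \<noteq> 0" by (rule cutoff_nonzero)
    with elim[rule_format, of m] show ?case by simp
  qed
qed

text \<open>
  Here the perturbation appears: multiplication by \<open>t\<close> turns into multiplication by \<open>s\<close> up to the rank one term
  \<open>\<alpha> \<integral> g d\<mu>\<close>.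
\<close>
lemma V_formula_mult_affine:
  assumes g: "g \<in> C1_compact"
  shows "V_formula \<mu> \<alpha> (\<lambda>t. (of_real t - z) * g t) s
    = (of_real s - z) * V_formula \<mu> \<alpha> g s - of_real \<alpha> * (LINT t|\<mu>. g t)"
proof -
  have C1: "g C1_differentiable_on UNIV" using g by (simp add: C1_compact_def)
  have eq: "(LINT t|\<mu>. diff_quotient (\<lambda>t. (of_real t - z) * g t) s t)
      = (of_real s - z) * (LINT t|\<mu>. diff_quotient g s t) + (LINT t|\<mu>. g t)"
    unfolding diff_quotient_mult_affine[OF C1]
    using diff_quotient_integrable[OF g, of s] C1_compact_integrable[OF g]
    by (subst Bochner_Integration.integral_add) auto
  show ?thesis unfolding V_formula_def eq by (simp add: algebra_simps)
qed

text \<open>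
  Formally the transform fixes the constant function \<open>1\<close>, whose difference quotient is \<open>0\<close>.
\<close>
lemma V_formula_cutoff_tendsto_1: "(\<lambda>n. V_formula \<mu> \<alpha> (cutoff n) s) \<longlonglongrightarrow> 1"
proof -
  have "(\<lambda>n. LINT t|\<mu>. diff_quotient (cutoff n) s t) \<longlonglongrightarrow> (LINT t|\<mu>. 0)"
  proof (rule integral_dominated_convergence[where w = "\<lambda>t. 4 * (2 + \<bar>s\<bar>) * (1 / (1 + \<bar>t\<bar>))"])
    show "AE t in \<mu>. (\<lambda>n. diff_quotient (cutoff n) s t) \<longlonglongrightarrow> 0"
    proof (rule AE_I2, rule Lim_null_comparison)
      fix t
      show "\<forall>\<^sub>F n in sequentially. norm (diff_quotient (cutoff n) s t) \<le> 4 * inverse (real (Suc n))"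
        using diff_quotient_cutoff_bound(1)[of _ s t] by (simp add: divide_inverse add.commute)
      have "(\<lambda>n. 4 * inverse (real (Suc n))) \<longlonglongrightarrow> 4 * 0"
        by (intro tendsto_mult tendsto_const LIMSEQ_inverse_real_of_nat)
      then show "(\<lambda>n. 4 * inverse (real (Suc n))) \<longlonglongrightarrow> 0" by simp
    qed
    show "AE t in \<mu>. norm (diff_quotient (cutoff n) s t) \<le> 4 * (2 + \<bar>s\<bar>) * (1 / (1 + \<bar>t\<bar>))" for n
      using diff_quotient_cutoff_bound(2)[of n s] by simp
    show "diff_quotient (cutoff n) s \<in> borel_measurable \<mu>" for n
      by (intro diff_quotient_measurable C1_compact_measurable cutoff_C1_compact)
    show "integrable \<mu> (\<lambda>t. 4 * (2 + \<bar>s\<bar>) * (1 / (1 + \<bar>t\<bar>)))"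
      by (rule integrable_mult_right[OF integrable_weight])
  qed simp
  then have "(\<lambda>n. V_formula \<mu> \<alpha> (cutoff n) s) \<longlonglongrightarrow> 1 - of_real \<alpha> * (LINT t|\<mu>. 0)"
    unfolding V_formula_def by (intro tendsto_intros cutoff_tendsto_1)
  then show ?thesis by simp
qed

definition borel_transform :: "complex \<Rightarrow> complex" where
  "borel_transform z = (LINT t|\<mu>. 1 / (of_real t - z))"

lemma borel_transform_cnj: "borel_transform (cnj z) = cnj (borel_transform z)"
  unfolding borel_transform_def by (subst Bochner_Integration.integral_cnj[symmetric]) simp

text \<open>
  The imaginary part of the Borel transform is \<open>Im z \<integral> |t - z|\<^sup>-\<^sup>2 d\<mu>(t)\<close>. If it vanishes then \<open>\<mu> = 0\<close>, and then the
  expression equals \<open>1\<close>.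
\<close>
lemma one_plus_borel_transform_neq_0:
  assumes z: "z \<notin> \<real>"
  shows "1 + of_real \<alpha> * borel_transform z \<noteq> 0"
proof
  assume *: "1 + of_real \<alpha> * borel_transform z = 0"
  have Im_z: "Im z \<noteq> 0" using z by (simp add: complex_is_Real_iff)
  have int: "integrable \<mu> (\<lambda>t. (cmod (1 / (of_real t - z)))\<^sup>2)" by (rule L2_integrable[OF kernel_L2[OF z]])
  have ImK: "Im (1 / (of_real t - z)) = Im z * (cmod (1 / (of_real t - z)))\<^sup>2" for t
    by (simp add: Im_divide norm_divide power_divide cmod_power2)
  have "Im (of_real \<alpha> * borel_transform z) = 0" using * by (simp add: complex_eq_iff)
  moreover have "\<alpha> \<noteq> 0" using * by auto
  ultimately have "0 = Im (borel_transform z)" by simp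
  also have "\<dots> = (LINT t|\<mu>. Im (1 / (of_real t - z)))"
    unfolding borel_transform_def by (rule integral_Im[OF kernel_integrable[OF z], symmetric])
  also have "\<dots> = Im z * (LINT t|\<mu>. (cmod (1 / (of_real t - z)))\<^sup>2)" unfolding ImK by simp
  finally have "(LINT t|\<mu>. (cmod (1 / (of_real t - z)))\<^sup>2) = 0" using Im_z by simp
  then have "AE t in \<mu>. (cmod (1 / (of_real t - z)))\<^sup>2 = 0"
    by (subst (asm) integral_nonneg_eq_0_iff_AE[OF int]) auto
  then have "AE t in \<mu>. 1 / (of_real t - z) = 0" by eventually_elim simp
  then have "borel_transform z = 0" unfolding borel_transform_def by (rule integral_eq_zero_AE)
  with * show False by simp
qed

abbreviation "R \<equiv> rank_one_resolvent \<mu>"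

lemma rank_one_resolvent_eq:
  "R \<alpha> z f = (\<lambda>t. 1 * (f t / (of_real t - z))
     + (- (of_real \<alpha> * (LINT x|\<mu>. f x / (of_real x - z)) / (1 + of_real \<alpha> * borel_transform z))) * (1 / (of_real t - z)))"
  by (simp add: rank_one_resolvent_def borel_transform_def)

lemma rank_one_resolvent_L2:
  assumes "z \<notin> \<real>" "f \<in> L2 \<mu>"
  shows "R \<alpha> z f \<in> L2 \<mu>"
  unfolding rank_one_resolvent_eq
  by (intro L2_lincomb L2_resolvent_kernel[OF mu_borel] kernel_L2 assms)

lemma inner_kernel: "L2_inner \<mu> f (\<lambda>t. 1 / (of_real t - cnj z)) = (LINT t|\<mu>. f t / (of_real t - z))"
  by (simp add: L2_inner_def)

text \<open>
  The rank one term of the resolvent is a multiple of \<open>\<langle>f, \<phi>\<^sub>c\<rangle> \<phi>\<^sub>z\<close> with \<open>\<phi>\<^sub>z(t) = (t - z)\<^sup>-\<^sup>1\<close> and \<open>c = cnj z\<close>. Its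
  coefficient is conjugated when \<open>z\<close> is, because \<open>\<alpha>\<close> is real and the Borel transform commutes with
  conjugation.
\<close>
lemma rank_one_resolvent_adjoint:
  assumes z: "z \<notin> \<real>" and f: "f \<in> L2 \<mu>" and g: "g \<in> L2 \<mu>"
  shows "L2_inner \<mu> (R \<alpha> z f) g = L2_inner \<mu> f (R \<alpha> (cnj z) g)"
proof -
  note z' = nonreal_cnj[OF z]
  note res = L2_resolvent_kernel[OF mu_borel]
  have "L2_inner \<mu> (\<lambda>t. 1 / (of_real t - z)) g = cnj (L2_inner \<mu> g (\<lambda>t. 1 / (of_real t - cnj (cnj z))))"
    by (subst L2_inner_commute) simp
  then have phi: "L2_inner \<mu> (\<lambda>t. 1 / (of_real t - z)) g = cnj (LINT t|\<mu>. g t / (of_real t - cnj z))"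
    by (simp only: inner_kernel)
  have "L2_inner \<mu> (\<lambda>t. f t / (of_real t - z)) g = L2_inner \<mu> f (\<lambda>t. g t / (of_real t - cnj z))"
    by (simp add: L2_inner_def)
  then show ?thesis
    unfolding rank_one_resolvent_eq
    by (simp only: L2_inner_lincomb_left[OF res[OF z f] kernel_L2[OF z] g]
        L2_inner_lincomb_right[OF res[OF z' g] kernel_L2[OF z'] f] inner_kernel phi borel_transform_cnj)
       (simp add: mult_ac)
qed

end

locale regularized_transform = form_bounded_measure \<mu> for \<mu> :: "real measure" +
  fixes \<alpha> :: real and \<nu> :: "real measure" and V :: "(real \<Rightarrow> complex) \<Rightarrow> (real \<Rightarrow> complex)"
  assumes nu_borel: "sets \<nu> = sets borel"
    and V_bounded: "bounded_op \<mu> \<nu> V"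
    and V_extends: "\<forall>f\<in>C1_compact. AE s in \<nu>. V f s = V_formula \<mu> \<alpha> f s"
    and V_kernel: "trivial_kernel \<mu> \<nu> V"
begin

lemmas V_L2 = bounded_op_L2[OF V_bounded]

lemma V_resolvent_C1_compact:
  assumes z: "z \<notin> \<real>" and f: "f \<in> C1_compact"
  shows "AE s in \<nu>. V (\<lambda>t. f t / (of_real t - z)) s
    = (V_formula \<mu> \<alpha> f s + of_real \<alpha> * (LINT t|\<mu>. f t / (of_real t - z))) / (of_real s - z)"
proof -
  let ?g = "\<lambda>t. f t / (of_real t - z)"
  have g: "?g \<in> C1_compact" using C1_compact_mult[OF f C1_resolvent_kernel[OF z]] by simp
  have fg: "(\<lambda>t. (of_real t - z) * ?g t) = f" using nonreal_minus_neq_0[OF z] by (simp add: fun_eq_iff)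
  have "V_formula \<mu> \<alpha> f s = (of_real s - z) * V_formula \<mu> \<alpha> ?g s - of_real \<alpha> * (LINT t|\<mu>. ?g t)" for s
    using V_formula_mult_affine[OF g, of \<alpha> z s] by (simp only: fg)
  then have "V_formula \<mu> \<alpha> ?g s = (V_formula \<mu> \<alpha> f s + of_real \<alpha> * (LINT t|\<mu>. ?g t)) / (of_real s - z)" for s
    using nonreal_minus_neq_0[OF z, of s] by (simp add: field_simps)
  with bspec[OF V_extends g] show ?thesis by simp
qed

text \<open>
  The limit of the preceding formula along the cutoffs: in norm on the left, by boundedness of \<open>V\<close>, and pointwise
  on the right.
\<close>
lemma V_kernel_function:
  assumes z: "z \<notin> \<real>"
  shows "AE s in \<nu>. V (\<lambda>t. 1 / (of_real t - z)) s = (1 + of_real \<alpha> * borel_transform z) / (of_real s - z)"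
proof -
  let ?e = "\<lambda>t. 1 / (of_real t - z)"
  let ?f = "\<lambda>n t. cutoff n t / (of_real t - z)"
  note e = kernel_L2[OF z]
  note [measurable] = C1_compact_measurable[OF cutoff_C1_compact]
  have f: "?f n \<in> L2 \<mu>" for n by (intro L2_resolvent_kernel[OF mu_borel z] C1_compact_L2 cutoff_C1_compact)
  have lim_pt: "(\<lambda>n. ?f n t) \<longlonglongrightarrow> ?e t" for t
    by (intro tendsto_intros cutoff_tendsto_1) (rule nonreal_minus_neq_0[OF z])
  have "(\<lambda>n. L2_norm \<mu> (\<lambda>t. ?f n t - ?e t)) \<longlonglongrightarrow> 0"
  proof (rule L2_dominated_convergence[OF _ _ L2_scale[OF e, of 2]])
    show "AE t in \<mu>. cmod (?f n t - ?e t) \<le> cmod (2 * ?e t)" for n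
    proof (rule AE_I2)
      fix t
      have "cmod (cutoff n t - 1) \<le> 2"
        using norm_triangle_ineq4[of "cutoff n t" 1] cutoff_bounds(1)[of n t] by simp
      then have "cmod (cutoff n t - 1) * cmod (?e t) \<le> 2 * cmod (?e t)" by (intro mult_right_mono) auto
      moreover have "?f n t - ?e t = (cutoff n t - 1) * ?e t" by (simp add: diff_divide_distrib)
      ultimately show "cmod (?f n t - ?e t) \<le> cmod (2 * ?e t)" by (simp only: norm_mult norm_numeral)
    qed
  qed (use lim_pt in \<open>auto intro!: AE_I2\<close>)
  then have Vlim: "(\<lambda>n. L2_norm \<nu> (\<lambda>s. V (?f n) s - V ?e s)) \<longlonglongrightarrow> 0"
    by (rule bounded_op_tendsto[OF V_bounded f e])
  have "(\<lambda>n. LINT t|\<mu>. ?f n t) \<longlonglongrightarrow> (LINT t|\<mu>. ?e t)"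
  proof (rule integral_dominated_convergence[where w = "\<lambda>t. norm (?e t)"])
    show "AE t in \<mu>. norm (?f n t) \<le> norm (?e t)" for n
      using cutoff_bounds(1)[of n] by (auto simp: norm_divide intro!: AE_I2 divide_right_mono)
    show "integrable \<mu> (\<lambda>t. norm (?e t))" by (rule integrable_norm[OF kernel_integrable[OF z]])
    show "AE t in \<mu>. (\<lambda>n. ?f n t) \<longlonglongrightarrow> ?e t" using lim_pt by (rule AE_I2)
  qed measurable
  then have Flim: "(\<lambda>n. LINT t|\<mu>. ?f n t) \<longlonglongrightarrow> borel_transform z" by (simp only: borel_transform_def)
  have "AE s in \<nu>. \<forall>n. V (?f n) s = (V_formula \<mu> \<alpha> (cutoff n) s + of_real \<alpha> * (LINT t|\<mu>. ?f n t)) / (of_real s - z)"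
    unfolding AE_all_countable by (intro allI V_resolvent_C1_compact[OF z cutoff_C1_compact])
  then have "AE s in \<nu>. (\<lambda>n. V (?f n) s) \<longlonglongrightarrow> (1 + of_real \<alpha> * borel_transform z) / (of_real s - z)"
  proof eventually_elim
    case (elim s)
    show ?case unfolding elim[rule_format]
      by (intro tendsto_intros V_formula_cutoff_tendsto_1 Flim) (rule nonreal_minus_neq_0[OF z])
  qed
  then show ?thesis by (rule L2_limit_unique_AE[OF V_L2[OF f] V_L2[OF e] Vlim])
qed

text \<open>
  The coefficient of the rank one term of the resolvent is chosen so that the two contributions of the perturbation
  cancel.
\<close>
lemma V_rank_one_resolvent_C1_compact:
  assumes z: "z \<notin> \<real>" and f: "f \<in> C1_compact"
  shows "AE s in \<nu>. V (R \<alpha> z f) s = V f s / (of_real s - z)"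
proof -
  define D where "D = 1 + of_real \<alpha> * borel_transform z"
  define L where "L = (LINT t|\<mu>. f t / (of_real t - z))"
  have D: "D \<noteq> 0" unfolding D_def by (rule one_plus_borel_transform_neq_0[OF z])
  have fL: "(\<lambda>t. f t / (of_real t - z)) \<in> L2 \<mu>" by (rule L2_resolvent_kernel[OF mu_borel z C1_compact_L2[OF f]])
  show ?thesis
    unfolding rank_one_resolvent_eq
    using bounded_op_lincomb[OF V_bounded fL kernel_L2[OF z], of 1 "- (of_real \<alpha> * L / D)"]
      V_resolvent_C1_compact[OF z f] V_kernel_function[OF z] bspec[OF V_extends f]
    unfolding L_def[symmetric] D_def[symmetric]
  proof eventually_elim
    case (elim s)
    show ?case unfolding elim using D by (simp add: diff_divide_distrib add_divide_distrib)
  qed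
qed

text \<open>
  The relation for test functions passes to the adjoint \<open>W\<close> by density in the weak sense, and from there back to
  all of \<open>L\<^sup>2(\<mu>)\<close> by taking adjoints once more.
\<close>
lemma V_rank_one_resolvent:
  assumes W: "bounded_op \<nu> \<mu> W"
    and adj: "\<forall>f\<in>L2 \<mu>. \<forall>g\<in>L2 \<nu>. L2_inner \<nu> (V f) g = L2_inner \<mu> f (W g)"
    and z: "z \<notin> \<real>"
  shows "g \<in> L2 \<nu> \<Longrightarrow> AE t in \<mu>. W (\<lambda>s. g s / (of_real s - z)) t = R \<alpha> z (W g) t"
    and "f \<in> L2 \<mu> \<Longrightarrow> AE s in \<nu>. V (R \<alpha> z f) s = V f s / (of_real s - z)"
proof -
  note adj = adj[rule_format]
  note WL2 = bounded_op_L2[OF W] and RL2 = rank_one_resolvent_L2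
  note res = L2_resolvent_kernel[OF nu_borel]
  have move: "L2_inner \<nu> (\<lambda>s. k s / (of_real s - cnj z)) g = L2_inner \<nu> k (\<lambda>s. g s / (of_real s - z))" for k g z
    by (simp add: L2_inner_def)
  have W_res: "AE t in \<mu>. W (\<lambda>s. g s / (of_real s - z)) t = R \<alpha> z (W g) t"
    if g: "g \<in> L2 \<nu>" and z: "z \<notin> \<real>" for g z
  proof -
    have "AE t in \<mu>. W (\<lambda>s. g s / (of_real s - z)) t - R \<alpha> z (W g) t = 0"
    proof (rule AE_zero_if_orthogonal_C1_compact)
      show "(\<lambda>t. W (\<lambda>s. g s / (of_real s - z)) t - R \<alpha> z (W g) t) \<in> L2 \<mu>"
        by (intro L2_diff WL2 res RL2 g z)
      fix f assume f: "f \<in> C1_compact"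
      note fL2 = C1_compact_L2[OF f]
      have "L2_inner \<mu> f (W (\<lambda>s. g s / (of_real s - z))) = L2_inner \<nu> (V f) (\<lambda>s. g s / (of_real s - z))"
        by (rule adj[OF fL2 res[OF z g], symmetric])
      also have "\<dots> = L2_inner \<nu> (\<lambda>s. V f s / (of_real s - cnj z)) g" by (rule move[symmetric])
      also have "\<dots> = L2_inner \<nu> (V (R \<alpha> (cnj z) f)) g"
        using V_rank_one_resolvent_C1_compact[OF nonreal_cnj[OF z] f]
        by (intro L2_inner_cong_AE res nonreal_cnj z V_L2 RL2 fL2 g) auto
      also have "\<dots> = L2_inner \<mu> (R \<alpha> (cnj z) f) (W g)"
        by (rule adj[OF RL2[OF nonreal_cnj[OF z] fL2] g])
      also have "\<dots> = L2_inner \<mu> f (R \<alpha> z (W g))"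
        using rank_one_resolvent_adjoint[OF nonreal_cnj[OF z] fL2 WL2[OF g]] by simp
      finally show "L2_inner \<mu> f (\<lambda>t. W (\<lambda>s. g s / (of_real s - z)) t - R \<alpha> z (W g) t) = 0"
        by (simp add: L2_inner_diff_right WL2 res RL2 g z fL2)
    qed
    then show ?thesis by simp
  qed
  show "g \<in> L2 \<nu> \<Longrightarrow> AE t in \<mu>. W (\<lambda>s. g s / (of_real s - z)) t = R \<alpha> z (W g) t"
    by (rule W_res[OF _ z])
  assume f: "f \<in> L2 \<mu>"
  show "AE s in \<nu>. V (R \<alpha> z f) s = V f s / (of_real s - z)"
  proof (rule L2_eq_AE_if_inner)
    show "V (R \<alpha> z f) \<in> L2 \<nu>" "(\<lambda>s. V f s / (of_real s - z)) \<in> L2 \<nu>" by (intro V_L2 RL2 res z f)+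
    fix k assume k: "k \<in> L2 \<nu>"
    note z' = nonreal_cnj[OF z]
    have "L2_inner \<nu> (V (R \<alpha> z f)) k = L2_inner \<mu> (R \<alpha> z f) (W k)" by (rule adj[OF RL2[OF z f] k])
    also have "\<dots> = L2_inner \<mu> f (R \<alpha> (cnj z) (W k))" by (rule rank_one_resolvent_adjoint[OF z f WL2[OF k]])
    also have "\<dots> = L2_inner \<mu> f (W (\<lambda>s. k s / (of_real s - cnj z)))"
      using W_res[OF k z'] by (intro L2_inner_cong_AE RL2 WL2 res z' k f) auto
    also have "\<dots> = L2_inner \<nu> (V f) (\<lambda>s. k s / (of_real s - cnj z))" by (rule adj[OF f res[OF z' k], symmetric])
    also have "\<dots> = L2_inner \<nu> (\<lambda>s. V f s / (of_real s - z)) k" using move[of "V f" "cnj z" k] by simp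
    finally show "L2_inner \<nu> k (V (R \<alpha> z f)) = L2_inner \<nu> k (\<lambda>s. V f s / (of_real s - z))"
      by (subst (1 2) L2_inner_commute) simp
  qed
qed

text \<open>
  The image of \<open>1 / (t - \<i>)\<close> serves as the reference function without zeros that determines the weight.
\<close>
lemma unitary_normalization:
  obtains h where "h \<in> borel_measurable \<nu>" "AE s in \<nu>. h s \<noteq> 0" "(\<lambda>s. 1 / h s) \<in> Linfty \<nu>"
    "unitary_op \<mu> \<nu> (\<lambda>f s. h s * V f s)"
    "\<And>z f. z \<notin> \<real> \<Longrightarrow> f \<in> L2 \<mu> \<Longrightarrow> AE s in \<nu>. V (R \<alpha> z f) s = V f s / (of_real s - z)"
proof -
  obtain W where W: "bounded_op \<nu> \<mu> W"
    and adj: "\<forall>f\<in>L2 \<mu>. \<forall>g\<in>L2 \<nu>. L2_inner \<nu> (V f) g = L2_inner \<mu> f (W g)"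
    using bounded_op_adjoint[OF V_bounded] by blast
  note WL2 = bounded_op_L2[OF W]
  note res = V_rank_one_resolvent[OF W adj]
  have ii: "\<i> \<notin> \<real>" by (simp add: complex_is_Real_iff)
  let ?e = "\<lambda>t. 1 / (complex_of_real t - \<i>)"
  have e: "?e \<in> L2 \<mu>" by (rule kernel_L2[OF ii])
  have Ve: "AE s in \<nu>. V ?e s \<noteq> 0"
    using V_kernel_function[OF ii]
  proof eventually_elim
    case (elim s)
    show ?case unfolding elim
      using one_plus_borel_transform_neq_0[OF ii] nonreal_minus_neq_0[OF ii, of s] by simp
  qed
  have VW: "bounded_op \<nu> \<nu> (\<lambda>g. V (W g))"
    unfolding bounded_op_def
  proof (intro conjI ballI allI)
    fix g k a b assume gk: "g \<in> L2 \<nu>" "k \<in> L2 \<nu>"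
    have "AE s in \<nu>. V (W (\<lambda>t. a * g t + b * k t)) s = V (\<lambda>t. a * W g t + b * W k t) s"
      by (intro bounded_op_cong_AE[OF V_bounded] bounded_op_lincomb[OF W] WL2 L2_lincomb gk)
    with bounded_op_lincomb[OF V_bounded WL2[OF gk(1)] WL2[OF gk(2)], of a b]
    show "AE s in \<nu>. V (W (\<lambda>t. a * g t + b * k t)) s = a * V (W g) s + b * V (W k) s"
      by eventually_elim simp
  next
    obtain C where C: "C > 0" "\<And>f. f \<in> L2 \<mu> \<Longrightarrow> L2_norm \<nu> (V f) \<le> C * L2_norm \<mu> f"
      using bounded_op_bound[OF V_bounded] by blast
    obtain D where D: "\<And>g. g \<in> L2 \<nu> \<Longrightarrow> L2_norm \<mu> (W g) \<le> D * L2_norm \<nu> g"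
      using bounded_op_bound[OF W] by blast
    have "L2_norm \<nu> (V (W g)) \<le> (C * D) * L2_norm \<nu> g" if "g \<in> L2 \<nu>" for g
      using order_trans[OF C(2)[OF WL2[OF that]] mult_left_mono[OF D[OF that], of C]] C(1)
      by (simp add: mult.assoc)
    then show "\<exists>C. \<forall>g\<in>L2 \<nu>. L2_norm \<nu> (V (W g)) \<le> C * L2_norm \<nu> g" by blast
  qed (intro V_L2 WL2)
  obtain w where w: "w \<in> borel_measurable \<nu>"
    and VWw: "\<And>g. g \<in> L2 \<nu> \<Longrightarrow> AE s in \<nu>. V (W g) s = of_real (w s) * g s"
  proof (rule symmetric_commuting_op_is_multiplication[OF nu_borel VW _ _ V_L2[OF e] Ve])
    fix f g assume f: "f \<in> L2 \<nu>" and g: "g \<in> L2 \<nu>"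
    have "L2_inner \<nu> f (V (W g)) = cnj (L2_inner \<mu> (W g) (W f))"
      by (subst L2_inner_commute) (simp add: adj[rule_format] WL2 f g)
    then show "L2_inner \<nu> (V (W f)) g = L2_inner \<nu> f (V (W g))"
      by (simp add: adj[rule_format] WL2 f g L2_inner_commute[of \<mu> "W f" "W g"])
  next
    fix z :: complex and g assume z: "z \<notin> \<real>" and g: "g \<in> L2 \<nu>"
    have "AE s in \<nu>. V (W (\<lambda>s. g s / (complex_of_real s - z))) s = V (R \<alpha> z (W g)) s"
      by (intro bounded_op_cong_AE[OF V_bounded] res(1)[OF z g] WL2 rank_one_resolvent_L2 z
          L2_resolvent_kernel[OF nu_borel] g)
    with res(2)[OF z WL2[OF g]]
    show "AE s in \<nu>. V (W (\<lambda>s. g s / (of_real s - z))) s = V (W g) s / (of_real s - z)"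
      by eventually_elim simp
  qed blast
  from VWw have VWw: "\<forall>g\<in>L2 \<nu>. AE s in \<nu>. V (W g) s = of_real (w s) * g s" by blast
  have pos: "AE s in \<nu>. w s > 0" and "\<exists>C. AE s in \<nu>. w s \<le> C"
    using weight_positive_bounded[OF V_bounded W adj w VWw e Ve] by auto
  then obtain C where C: "AE s in \<nu>. w s \<le> C" by blast
  note [measurable] = w
  show ?thesis
  proof (rule that[of "\<lambda>s. of_real (1 / sqrt (w s))"])
    show "(\<lambda>s. complex_of_real (1 / sqrt (w s))) \<in> borel_measurable \<nu>" by measurable
    show "AE s in \<nu>. complex_of_real (1 / sqrt (w s)) \<noteq> 0" using pos by eventually_elim simp
    have "AE s in \<nu>. cmod (1 / complex_of_real (1 / sqrt (w s))) \<le> sqrt C"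
      using pos C by eventually_elim (simp add: norm_divide)
    then show "(\<lambda>s. 1 / complex_of_real (1 / sqrt (w s))) \<in> Linfty \<nu>"
      unfolding Linfty_def by auto
    show "unitary_op \<mu> \<nu> (\<lambda>f s. of_real (1 / sqrt (w s)) * V f s)"
      by (rule unitary_op_of_weight[OF V_bounded W adj w VWw pos V_kernel])
  qed (rule res(2))
qed

end

theorem theorem2p2:
  fixes \<alpha> :: real
    and \<mu> \<nu> :: "real measure"
    and V :: "(real \<Rightarrow> complex) \<Rightarrow> (real \<Rightarrow> complex)"
  assumes mu_borel: "sets \<mu> = sets borel"
    and mu_two_points: "\<exists>x\<in>msupport \<mu>. \<exists>y\<in>msupport \<mu>. x \<noteq> y"
    and mu_integral: "(\<integral>\<^sup>+ t. ennreal (1 / (1 + \<bar>t\<bar>)) \<partial>\<mu>) < \<infinity>"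
    and nu_borel: "sets \<nu> = sets borel"
    and V_bounded: "bounded_op \<mu> \<nu> V"
    and V_extends: "\<forall>f\<in>C1_compact. AE s in \<nu>. V f s = V_formula \<mu> \<alpha> f s"
    and V_kernel: "trivial_kernel \<mu> \<nu> V"
  shows "\<exists>h :: real \<Rightarrow> complex.
           h \<in> borel_measurable \<nu> \<and>
           (AE s in \<nu>. h s \<noteq> 0) \<and>
           (\<lambda>s. 1 / h s) \<in> Linfty \<nu> \<and>
           unitary_op \<mu> \<nu> (\<lambda>f s. h s * V f s) \<and>
           unitary_op \<mu> (density \<nu> (\<lambda>s. ennreal ((cmod (h s))\<^sup>2))) V \<and>
           rank_one_perturbation \<mu> \<alpha> O graph_of \<mu> \<nu> (\<lambda>f s. h s * V f s)
             = graph_of \<mu> \<nu> (\<lambda>f s. h s * V f s) O mult_graph \<nu> of_real"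
proof -
  interpret regularized_transform \<mu> \<alpha> \<nu> V
    by unfold_locales (fact mu_borel mu_integral nu_borel V_bounded V_extends V_kernel)+
  obtain h where h: "h \<in> borel_measurable \<nu>" "AE s in \<nu>. h s \<noteq> 0" "(\<lambda>s. 1 / h s) \<in> Linfty \<nu>"
    and U: "unitary_op \<mu> \<nu> (\<lambda>f s. h s * V f s)" (is "unitary_op \<mu> \<nu> ?U")
    and VR: "\<And>z f. z \<notin> \<real> \<Longrightarrow> f \<in> L2 \<mu> \<Longrightarrow> AE s in \<nu>. V (rank_one_resolvent \<mu> \<alpha> z f) s = V f s / (of_real s - z)"
    using unitary_normalization by blast
  let ?A = "mult_pullback \<mu> \<nu> ?U"
  have A_sa: "selfadjoint \<mu> ?A" by (rule selfadjoint_mult_pullback[OF nu_borel U])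
  have A_res: "resolvent_graph ?A z = graph_of \<mu> \<mu> (rank_one_resolvent \<mu> \<alpha> z)" if z: "z \<notin> \<real>" for z
  proof (rule resolvent_graph_mult_pullback[OF nu_borel U z])
    fix f assume f: "f \<in> L2 \<mu>"
    show "rank_one_resolvent \<mu> \<alpha> z f \<in> L2 \<mu>" by (rule rank_one_resolvent_L2[OF z f])
    show "AE s in \<nu>. h s * V (rank_one_resolvent \<mu> \<alpha> z f) s = h s * V f s / (of_real s - z)"
      using VR[OF z f] by eventually_elim simp
  qed
  have "rank_one_perturbation \<mu> \<alpha> = ?A"
    unfolding rank_one_perturbation_def
  proof (rule the_equality)
    show "selfadjoint \<mu> ?A \<and> (\<forall>z. z \<notin> \<real> \<longrightarrow> resolvent_graph ?A z = graph_of \<mu> \<mu> (rank_one_resolvent \<mu> \<alpha> z))"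
      using A_sa A_res by blast
    fix B assume B: "selfadjoint \<mu> B \<and> (\<forall>z. z \<notin> \<real> \<longrightarrow> resolvent_graph B z = graph_of \<mu> \<mu> (rank_one_resolvent \<mu> \<alpha> z))"
    have "\<i> \<notin> \<real>" by (simp add: complex_is_Real_iff)
    with B A_res have "resolvent_graph B \<i> = resolvent_graph ?A \<i>" by simp
    then show "B = ?A" by (rule op_graph_eq_if_resolvent_graph_eq)
  qed
  moreover have "unitary_op \<mu> (density \<nu> (\<lambda>s. ennreal ((cmod (h s))\<^sup>2))) V"
    by (rule unitary_op_density[OF U L2_measurable[OF V_L2] h(1,2)])
  ultimately show ?thesis
    using h U graph_of_mult_pullback[OF U] by (intro exI[of _ h]) simp
qed

end
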